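(* Let $n\ge 4$ be even and let $k$ be an integer with $2\le k\le n-1$. There is a polynomial-time algorithm which, for every instance of TTP-$k$ on $n$ teams with a distance function satisfying symmetry and the triangle inequality, outputs a feasible schedule whose total traveling distance is at most $5\cdot \mathrm{OPT}$, where $\mathrm{OPT}$ is the minimum total traveling distance over all feasible schedules. If moreover $k\ge n/2$, the algorithm's output has total traveling distance at most $4\cdot\mathrm{OPT}$.
   Context: TTP-$k$ (Traveling Tournament Problem): there are $n$ teams ($n$ even), team $i$ having a home venue; $d(i,j)\ge 0$ is the distance between the homes of teams $i$ and $j$, with $d(i,j)=d(j,i)$ and $d(i,h)\le d(i,j)+d(j,h)$ for all $i,j,h$. A feasible schedule is a double round-robin tournament on $2(n-1)$ consecutive days: every team plays exactly one game per day (so $n/2$ games per day), and for every ordered pair $(i,j)$ of distinct teams there is exactly one game between $i$ and $j$ played at the home of $j$. Constraints: (no-repeat) two teams do not play each other on two consecutive days; (direct-traveling) every team is at home before the first day and returns home after the last day, and travels directly from its game venue on day $i$ to its game venue on day $i+1$; (bounded-by-$k$) no team plays more than $k$ consecutive home games or more than $k$ consecutive away games. The cost of a schedule is the total distance traveled by all teams; $\mathrm{OPT}$ is the minimum cost of a feasible schedule. *)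

theory Defs
  imports Main "HOL-Library.Discrete_Functions"
begin

text \<open>Teams are 0..n-1, days are 0..2(n-1)-1.  A schedule is a pair (opp, home):
  opp t i is the opponent of team i on day t, home t i says whether team i plays at
  its own home venue on day t.\<close>

type_synonym schedule = "(nat \<Rightarrow> nat \<Rightarrow> nat) \<times> (nat \<Rightarrow> nat \<Rightarrow> bool)"

definition num_days :: "nat \<Rightarrow> nat" where
  "num_days n = 2 * (n - 1)"

definition ttp_metric :: "nat \<Rightarrow> (nat \<Rightarrow> nat \<Rightarrow> real) \<Rightarrow> bool" where
  "ttp_metric n d \<longleftrightarrow>
     (\<forall>i<n. d i i = 0) \<and>
     (\<forall>i<n. \<forall>j<n. 0 \<le> d i j \<and> d i j = d j i) \<and>
     (\<forall>i<n. \<forall>j<n. \<forall>h<n. d i h \<le> d i j + d j h)"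

definition ttp_feasible :: "nat \<Rightarrow> nat \<Rightarrow> schedule \<Rightarrow> bool" where
  "ttp_feasible n k s \<longleftrightarrow>
     (let opp = fst s; home = snd s; D = num_days n in
       \<comment> \<open>every team plays exactly one game per day, against a distinct team,
           exactly one of the two being at home\<close>
       (\<forall>t<D. \<forall>i<n. opp t i < n \<and> opp t i \<noteq> i \<and> opp t (opp t i) = i
                     \<and> home t (opp t i) = (\<not> home t i)) \<and>
       \<comment> \<open>double round robin: each ordered pair (i,j) meets exactly once at home of j\<close>
       (\<forall>i<n. \<forall>j<n. i \<noteq> j \<longrightarrow> card {t. t < D \<and> opp t i = j \<and> home t j} = 1) \<and>
       \<comment> \<open>no-repeat\<close>
       (\<forall>t. Suc t < D \<longrightarrow> (\<forall>i<n. opp (Suc t) i \<noteq> opp t i)) \<and>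
       \<comment> \<open>bounded-by-k: no k+1 consecutive home games / away games\<close>
       (\<forall>i<n. \<forall>a. a + k < D \<longrightarrow>
          \<not> (\<forall>t\<in>{a..a+k}. home t i) \<and> \<not> (\<forall>t\<in>{a..a+k}. \<not> home t i)))"

definition venue :: "schedule \<Rightarrow> nat \<Rightarrow> nat \<Rightarrow> nat" where
  "venue s t i = (if snd s t i then i else fst s t i)"

definition ttp_cost :: "nat \<Rightarrow> (nat \<Rightarrow> nat \<Rightarrow> real) \<Rightarrow> schedule \<Rightarrow> real" where
  "ttp_cost n d s =
     (\<Sum>i<n. d i (venue s 0 i)
            + (\<Sum>t<num_days n - 1. d (venue s t i) (venue s (Suc t) i))
            + d (venue s (num_days n - 1) i) i)"

definition ttp_OPT :: "nat \<Rightarrow> nat \<Rightarrow> (nat \<Rightarrow> nat \<Rightarrow> real) \<Rightarrow> real" where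
  "ttp_OPT n k d = Inf {ttp_cost n d s | s. ttp_feasible n k s}"

datatype instr =
    Const nat int
  | Add nat nat nat
  | Sub nat nat nat
  | Load nat nat
  | Store nat nat
  | JmpLe nat nat nat
  | Halt

type_synonym config = "nat \<times> (nat \<Rightarrow> real)"

definition halted :: "instr list \<Rightarrow> config \<Rightarrow> bool" where
  "halted P c \<longleftrightarrow> fst c \<ge> length P \<or> P ! fst c = Halt"

fun exec_instr :: "instr \<Rightarrow> config \<Rightarrow> config" where
  "exec_instr (Const a v) (pc, m) = (Suc pc, m(a := of_int v))"
| "exec_instr (Add a b c) (pc, m) = (Suc pc, m(a := m b + m c))"
| "exec_instr (Sub a b c) (pc, m) = (Suc pc, m(a := m b - m c))"
| "exec_instr (Load a b) (pc, m) = (Suc pc, m(a := m (nat \<lfloor>m b\<rfloor>)))"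
| "exec_instr (Store a b) (pc, m) = (Suc pc, m(nat \<lfloor>m a\<rfloor> := m b))"
| "exec_instr (JmpLe a b l) (pc, m) = (if m a \<le> m b then l else Suc pc, m)"
| "exec_instr Halt (pc, m) = (pc, m)"

definition step :: "instr list \<Rightarrow> config \<Rightarrow> config" where
  "step P c = (if halted P c then c else exec_instr (P ! fst c) c)"

definition ttp_input :: "nat \<Rightarrow> nat \<Rightarrow> (nat \<Rightarrow> nat \<Rightarrow> real) \<Rightarrow> nat \<Rightarrow> real" where
  "ttp_input n k d a =
     (if a = 0 then real n else if a = 1 then real k
      else if a - 2 < n * n then d ((a - 2) div n) ((a - 2) mod n) else 0)"

definition ttp_output :: "nat \<Rightarrow> (nat \<Rightarrow> real) \<Rightarrow> schedule" where
  "ttp_output n m =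
     ((\<lambda>t i. nat \<lfloor>m (2 * (t * n + i))\<rfloor>), (\<lambda>t i. m (2 * (t * n + i) + 1) > 0))"

end

theory Submission
  imports Defs "HOL-Library.Sublist"
begin

text \<open>
  Put the teams on a short cyclic tour, one special team aside, and play the circle method along it, so that
  consecutive opponents of a team are neighbours on the tour. Who travels is decided by the side of the rotating
  axis on which a team lies, flipped at the boundaries of \<open>q\<close> blocks of days, each of length at most \<open>k\<close>;
  the second half mirrors the first. Pairing each day with its mirror image, a day inside a block
  costs exactly one tour (so at most \<open>2/n\<close> times the optimum, as the nearest-insertion tour is at most twice a
  spanning path), whereas a block boundary costs two perfect matchings of the circle method. Averaging over the
  rotations of the tour bounds the matchings by the sum \<open>\<Delta>\<close> of all distances, and the special team, chosen with
  minimal distance sum, contributes at most \<open>4 \<Delta> / n\<close>. The lower bounds \<open>2 \<Delta> \<le> k OPT\<close> (every road trip has at most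
  \<open>k\<close> stops) and \<open>4 \<Delta> \<le> n OPT\<close> (every team walks around all venues) give the ratios. For \<open>k \<le> 4\<close> or \<open>n \<le> 8\<close> any
  feasible schedule is good enough, because it costs at most \<open>2 \<Delta>\<close>.

  The tour, the special team, the rotation and the schedule are computed by a program in a small structured
  language whose loops all run \<open>n\<close> times, compiled to the register machine.
\<close>

section \<open>A structured language for the register machine\<close>

text \<open>The ratio 5 splits as 2 + 2 + 1: tour legs inside blocks, matchings at block boundaries,
  games with the special team. If \<open>n \<le> 2 * k\<close>, two blocks suffice, and
  \<open>4 \<Delta> \<le> n OPT\<close> makes boundaries and special team cost 2 together. Parity
  shapes the construction. Without the special team the circle is odd, so exactly one team lies on
  the axis each day. The number of blocks is even, so that the flip also takes place where the
  mirrored half begins. Blocks have at least two days, because a team that meets the axis on a block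
  start changes side one day late. The tour is compared with every spanning walk directly; no
  spanning tree is built. The low memory cells are registers, input and output at once. Reading the
  input destroys a few distances. For \<open>n \<ge> 10\<close> they lie in row 0 and are recovered
  by symmetry; for \<open>n \<le> 8\<close> no distance is used at all. Likewise the first output
  entries must be parked elsewhere until the registers are free. Four teams need a table: for them
  the alternating pattern of the small cases has a run of three games.\<close>

datatype nexp = NC nat | NV nat | NAdd nexp nexp | NSub nexp nexp | NA nat nexp

datatype com =
    Skip
  | NSet nat nexp
  | NStore nat nexp nexp
  | RZero nat
  | RMov nat nat
  | RAdd nat nat nat
  | RLoad nat nexp
  | RStore nexp nat
  | Seq com com
  | IfLe nexp nexp com com
  | IfRLe nat nat com com
  | For nat com

text \<open>Distances are only loaded, stored, added and compared, so reals form a sort of their own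
  and all index arithmetic is on naturals. The fields are natural scalars, natural arrays, real
  scalars and one real array, which holds the distance matrix.\<close>

record st =
  nv :: "nat \<Rightarrow> nat"
  na :: "nat \<Rightarrow> nat \<Rightarrow> nat"
  rv :: "nat \<Rightarrow> real"
  ra :: "nat \<Rightarrow> real"

fun neval :: "nexp \<Rightarrow> st \<Rightarrow> nat" where
  "neval (NC v) s = v"
| "neval (NV x) s = nv s x"
| "neval (NAdd e f) s = neval e s + neval f s"
| "neval (NSub e f) s = neval e s - neval f s"
| "neval (NA a e) s = na s a (neval e s)"

definition nset :: "nat \<Rightarrow> nat \<Rightarrow> st \<Rightarrow> st" where
  "nset x v s = s\<lparr>nv := (nv s)(x := v)\<rparr>"

text \<open>Each round of a loop resets \<open>x\<close> from an independent counter, so a body that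
  overwrites \<open>x\<close> does not change the number of rounds. With exactly \<open>n\<close>
  rounds per loop, termination and the time bound become syntactic.\<close>

fun exec :: "nat \<Rightarrow> com \<Rightarrow> st \<Rightarrow> st" where
  "exec n Skip s = s"
| "exec n (NSet x e) s = nset x (neval e s) s"
| "exec n (NStore a e f) s = s\<lparr>na := (na s)(a := (na s a)(neval e s := neval f s))\<rparr>"
| "exec n (RZero x) s = s\<lparr>rv := (rv s)(x := 0)\<rparr>"
| "exec n (RMov x y) s = s\<lparr>rv := (rv s)(x := rv s y)\<rparr>"
| "exec n (RAdd x y z) s = s\<lparr>rv := (rv s)(x := rv s y + rv s z)\<rparr>"
| "exec n (RLoad x e) s = s\<lparr>rv := (rv s)(x := ra s (neval e s))\<rparr>"
| "exec n (RStore e x) s = s\<lparr>ra := (ra s)(neval e s := rv s x)\<rparr>"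
| "exec n (Seq c c') s = exec n c' (exec n c s)"
| "exec n (IfLe e f c c') s = (if neval e s \<le> neval f s then exec n c s else exec n c' s)"
| "exec n (IfRLe x y c c') s = (if rv s x \<le> rv s y then exec n c s else exec n c' s)"
| "exec n (For x c) s = fold (\<lambda>v s. exec n c (nset x v s)) [0..<n] s"

subsection \<open>Compilation\<close>

text \<open>The value ends up in cell \<open>r\<close>, with the cells above \<open>r\<close> used
  as a stack; jump targets are absolute, hence the code position \<open>p\<close>. Copying is
  addition to a zeroed cell, and the factor 16 of an array address is four doublings. For a
  truncated difference that would be negative, both operands are zeroed before the same
  \<open>Sub\<close> is reached.\<close>

fun ncomp :: "nexp \<Rightarrow> nat \<Rightarrow> nat \<Rightarrow> instr list" where
  "ncomp (NC v) r p = [Const r (int v)]"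
| "ncomp (NV x) r p = [Const r 0, Add r r x]"
| "ncomp (NAdd e f) r p = ncomp e r p @ ncomp f (Suc r) (p + length (ncomp e r p)) @ [Add r r (Suc r)]"
| "ncomp (NSub e f) r p = (let a = ncomp e r p; b = ncomp f (Suc r) (p + length a);
     q = p + length a + length b
     in a @ b @ [JmpLe (Suc r) r (q + 3), Const r 0, Const (Suc r) 0, Sub r r (Suc r)])"
| "ncomp (NA a e) r p = ncomp e r p @
     [Add r r r, Add r r r, Add r r r, Add r r r, Const (Suc r) (64 + int a), Add r r (Suc r), Load r r]"

fun nsz :: "nexp \<Rightarrow> nat" where
  "nsz (NC v) = 1"
| "nsz (NV x) = 2"
| "nsz (NAdd e f) = nsz e + nsz f + 1"
| "nsz (NSub e f) = nsz e + nsz f + 4"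
| "nsz (NA a e) = nsz e + 7"

lemma length_ncomp [simp]: "length (ncomp e r p) = nsz e"
  by (induction e r p rule: ncomp.induct) (auto simp: Let_def)

fun ndep :: "nexp \<Rightarrow> nat" where
  "ndep (NC v) = 1"
| "ndep (NV x) = 1"
| "ndep (NAdd e f) = max (ndep e) (Suc (ndep f))"
| "ndep (NSub e f) = max (ndep e) (Suc (ndep f))"
| "ndep (NA a e) = max (ndep e) 2"

fun nwf :: "nexp \<Rightarrow> bool" where
  "nwf (NC v) = True"
| "nwf (NV x) = (x < 24)"
| "nwf (NAdd e f) = (nwf e \<and> nwf f)"
| "nwf (NSub e f) = (nwf e \<and> nwf f)"
| "nwf (NA a e) = (a < 15 \<and> nwf e)"

definition addr_code :: "nat \<Rightarrow> nat \<Rightarrow> instr list" where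
  "addr_code r a = [Add r r r, Add r r r, Add r r r, Add r r r,
     Const (Suc r) (64 + int a), Add r r (Suc r)]"

text \<open>\<open>d\<close> counts the enclosing loops, whose counters occupy the cells from 32 to
  \<open>32 + d - 1\<close>. \<open>JmpLe 40 40\<close> serves as an unconditional jump. The
  else-branch comes first because the conditional jump is taken when the comparison holds. A loop is
  left once cell 0, which holds \<open>n\<close>, is at most the counter.\<close>

fun compile :: "com \<Rightarrow> nat \<Rightarrow> nat \<Rightarrow> instr list" where
  "compile Skip d p = []"
| "compile (NSet x e) d p = ncomp e 40 p @ [Const 41 0, Add x 40 41]"
| "compile (NStore a e f) d p = ncomp e 40 p @ ncomp f 41 (p + nsz e) @
     [Const 42 0, Add 43 41 42] @ addr_code 40 a @ [Store 40 43]"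
| "compile (RZero x) d p = [Const (24 + x) 0]"
| "compile (RMov x y) d p = [Const 40 0, Add (24 + x) (24 + y) 40]"
| "compile (RAdd x y z) d p = [Add (24 + x) (24 + y) (24 + z)]"
| "compile (RLoad x e) d p = ncomp e 40 p @ addr_code 40 15 @ [Load (24 + x) 40]"
| "compile (RStore e x) d p = ncomp e 40 p @ addr_code 40 15 @ [Store 40 (24 + x)]"
| "compile (Seq c c') d p = (let a = compile c d p in a @ compile c' d (p + length a))"
| "compile (IfLe e f c c') d p =
     (let q = p + nsz e + nsz f; b = compile c' d (q + 1); a = compile c d (q + 3 + length b) in
      ncomp e 40 p @ ncomp f 41 (p + nsz e) @ [JmpLe 40 41 (q + 3 + length b)] @ b @
      [Const 40 0, JmpLe 40 40 (q + 3 + length b + length a)] @ a)"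
| "compile (IfRLe x y c c') d p =
     (let b = compile c' d (p + 1); a = compile c d (p + 3 + length b) in
      [JmpLe (24 + x) (24 + y) (p + 3 + length b)] @ b @
      [Const 40 0, JmpLe 40 40 (p + 3 + length b + length a)] @ a)"
| "compile (For x c) d p =
     (let b = compile c (Suc d) (p + 4) in
      [Const (32 + d) 0, JmpLe 0 (32 + d) (p + 8 + length b), Const 40 0, Add x (32 + d) 40] @ b @
      [Const 40 1, Add (32 + d) (32 + d) 40, Const 40 0, JmpLe 40 40 (p + 1)])"

fun csz :: "com \<Rightarrow> nat" where
  "csz Skip = 0"
| "csz (NSet x e) = nsz e + 2"
| "csz (NStore a e f) = nsz e + nsz f + 9"
| "csz (RZero x) = 1"
| "csz (RMov x y) = 2"
| "csz (RAdd x y z) = 1"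
| "csz (RLoad x e) = nsz e + 7"
| "csz (RStore e x) = nsz e + 7"
| "csz (Seq c c') = csz c + csz c'"
| "csz (IfLe e f c c') = nsz e + nsz f + csz c + csz c' + 3"
| "csz (IfRLe x y c c') = csz c + csz c' + 3"
| "csz (For x c) = csz c + 8"

lemma length_comp [simp]: "length (compile c d p) = csz c"
  by (induction c d p rule: compile.induct) (auto simp: Let_def addr_code_def)

fun loop_depth :: "com \<Rightarrow> nat" where
  "loop_depth (Seq c c') = max (loop_depth c) (loop_depth c')"
| "loop_depth (IfLe e f c c') = max (loop_depth c) (loop_depth c')"
| "loop_depth (IfRLe x y c c') = max (loop_depth c) (loop_depth c')"
| "loop_depth (For x c) = Suc (loop_depth c)"
| "loop_depth _ = 0"

text \<open>Every loop test reads \<open>n\<close> from cell 0, so variable 0 must never be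
  assigned. The bound 20 on the stack depth keeps evaluations that start in cell 40 or 41 below cell
  64, where the arrays begin.\<close>

fun cwf :: "com \<Rightarrow> bool" where
  "cwf Skip = True"
| "cwf (NSet x e) = (0 < x \<and> x < 24 \<and> nwf e \<and> ndep e \<le> 20)"
| "cwf (NStore a e f) = (a < 15 \<and> nwf e \<and> nwf f \<and> ndep e \<le> 20 \<and> ndep f \<le> 20)"
| "cwf (RZero x) = (x < 8)"
| "cwf (RMov x y) = (x < 8 \<and> y < 8)"
| "cwf (RAdd x y z) = (x < 8 \<and> y < 8 \<and> z < 8)"
| "cwf (RLoad x e) = (x < 8 \<and> nwf e \<and> ndep e \<le> 20)"
| "cwf (RStore e x) = (x < 8 \<and> nwf e \<and> ndep e \<le> 20)"
| "cwf (Seq c c') = (cwf c \<and> cwf c')"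
| "cwf (IfLe e f c c') = (nwf e \<and> nwf f \<and> ndep e \<le> 20 \<and> ndep f \<le> 20 \<and> cwf c \<and> cwf c')"
| "cwf (IfRLe x y c c') = (x < 8 \<and> y < 8 \<and> cwf c \<and> cwf c')"
| "cwf (For x c) = (0 < x \<and> x < 24 \<and> cwf c)"

section \<open>Code placement and bounded runs of the machine\<close>

definition code_at :: "instr list \<Rightarrow> nat \<Rightarrow> instr list \<Rightarrow> bool" where
  "code_at P p xs \<longleftrightarrow> (\<forall>i<length xs. p + i < length P \<and> P ! (p + i) = xs ! i)"

lemma code_at_Nil [simp]: "code_at P p []"
  by (simp add: code_at_def)

lemma code_at_append [simp]:
  "code_at P p (xs @ ys) \<longleftrightarrow> code_at P p xs \<and> code_at P (p + length xs) ys"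
proof
  assume L: "code_at P p (xs @ ys)"
  show "code_at P p xs \<and> code_at P (p + length xs) ys"
    unfolding code_at_def
  proof (intro conjI allI impI)
    fix i assume "i < length xs"
    then show "p + i < length P" "P ! (p + i) = xs ! i"
      using L[unfolded code_at_def, rule_format, of i] by (auto simp: nth_append)
  next
    fix i assume "i < length ys"
    then show "p + length xs + i < length P" "P ! (p + length xs + i) = ys ! i"
      using L[unfolded code_at_def, rule_format, of "length xs + i"] by (auto simp: nth_append add.assoc)
  qed
next
  assume R: "code_at P p xs \<and> code_at P (p + length xs) ys"
  show "code_at P p (xs @ ys)"
    unfolding code_at_def
  proof (intro allI impI)
    fix i assume i: "i < length (xs @ ys)"
    show "p + i < length P \<and> P ! (p + i) = (xs @ ys) ! i"
    proof (cases "i < length xs")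
      case True then show ?thesis using R by (auto simp: code_at_def nth_append)
    next
      case False
      then have "i - length xs < length ys" "p + length xs + (i - length xs) = p + i" using i by auto
      then show ?thesis using R False by (auto simp: code_at_def nth_append)
    qed
  qed
qed

lemma code_at_Cons [simp]:
  "code_at P p (x # xs) \<longleftrightarrow> p < length P \<and> P ! p = x \<and> code_at P (Suc p) xs"
proof -
  have "code_at P p ([x] @ xs) \<longleftrightarrow> p < length P \<and> P ! p = x \<and> code_at P (Suc p) xs"
    by (subst code_at_append) (auto simp: code_at_def)
  then show ?thesis by simp
qed

text \<open>An upper bound on the number of steps is enough: a halted configuration is a fixed point
  of \<open>step\<close>, so surplus steps at the end do no harm, and branches of different length
  need no common count.\<close>

definition runs :: "instr list \<Rightarrow> nat \<Rightarrow> config \<Rightarrow> config \<Rightarrow> bool" where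
  "runs P T c c' \<longleftrightarrow> (\<exists>t\<le>T. (step P ^^ t) c = c')"

lemma runs_refl: "runs P T c c"
  unfolding runs_def by (rule exI[of _ 0]) simp

lemma runs_trans: "runs P T c c' \<Longrightarrow> runs P T' c' c'' \<Longrightarrow> runs P (T + T') c c''"
  unfolding runs_def
proof (elim exE conjE)
  fix t t' assume a: "t \<le> T" "(step P ^^ t) c = c'" "t' \<le> T'" "(step P ^^ t') c' = c''"
  then have "(step P ^^ (t' + t)) c = c''" by (simp only: funpow_add o_apply)
  then show "\<exists>t\<le>T + T'. (step P ^^ t) c = c''" using a by (intro exI[of _ "t' + t"]) auto
qed

lemma runs_mono: "runs P T c c' \<Longrightarrow> T \<le> T' \<Longrightarrow> runs P T' c c'"
  unfolding runs_def using le_trans by blast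

lemma runs_stepI:
  assumes "p < length P" "P ! p \<noteq> Halt" "runs P T (exec_instr (P ! p) (p, m)) c'"
  shows "runs P (Suc T) (p, m) c'"
proof -
  from assms(3) obtain t where "t \<le> T" "(step P ^^ t) (exec_instr (P ! p) (p, m)) = c'"
    unfolding runs_def by auto
  moreover have "step P (p, m) = exec_instr (P ! p) (p, m)"
    using assms by (simp add: step_def halted_def)
  ultimately show ?thesis unfolding runs_def
    by (intro exI[of _ "Suc t"]) (simp add: funpow_Suc_right del: funpow.simps)
qed

definition is_straight :: "instr \<Rightarrow> bool" where
  "is_straight c \<longleftrightarrow> (case c of JmpLe _ _ _ \<Rightarrow> False | Halt \<Rightarrow> False | _ \<Rightarrow> True)"

fun mem_eff :: "instr \<Rightarrow> (nat \<Rightarrow> real) \<Rightarrow> nat \<Rightarrow> real" where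
  "mem_eff (Const a v) m = m(a := of_int v)"
| "mem_eff (Add a b c) m = m(a := m b + m c)"
| "mem_eff (Sub a b c) m = m(a := m b - m c)"
| "mem_eff (Load a b) m = m(a := m (nat \<lfloor>m b\<rfloor>))"
| "mem_eff (Store a b) m = m(nat \<lfloor>m a\<rfloor> := m b)"
| "mem_eff _ m = m"

lemma runs_straight:
  assumes "code_at P p xs" "\<forall>c\<in>set xs. is_straight c"
  shows "runs P (length xs) (p, m) (p + length xs, fold mem_eff xs m)"
  using assms
proof (induction xs arbitrary: p m)
  case Nil then show ?case by (simp add: runs_refl)
next
  case (Cons x xs)
  have ex: "exec_instr x (p, m) = (Suc p, mem_eff x m)" using Cons.prems(2)
    by (cases x) (auto simp: is_straight_def)
  have "runs P (length xs) (Suc p, mem_eff x m) (Suc p + length xs, fold mem_eff xs (mem_eff x m))"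
    using Cons.IH[of "Suc p" "mem_eff x m"] Cons.prems by simp
  then have "runs P (Suc (length xs)) (p, m) (Suc p + length xs, fold mem_eff xs (mem_eff x m))"
    using Cons.prems ex by (intro runs_stepI) (auto simp: is_straight_def)
  then show ?case by simp
qed

text \<open>The memory map: natural scalars in cells 0 to 23, real scalars in 24 to 31, loop
  counters in 32 to 39, the expression stack in 40 to 63. From 64 on, sixteen arrays are interleaved
  with stride 16, so that each of them is unbounded; number 15 is the real one. Counters and stack
  are deliberately left unconstrained.\<close>

definition rel :: "nat \<Rightarrow> st \<Rightarrow> (nat \<Rightarrow> real) \<Rightarrow> bool" where
  "rel n s m \<longleftrightarrow> nv s 0 = n \<and> (\<forall>x<24. m x = real (nv s x)) \<and> (\<forall>y<8. m (24 + y) = rv s y) \<and>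
     (\<forall>a<15. \<forall>i. m (64 + 16 * i + a) = real (na s a i)) \<and> (\<forall>i. m (64 + 16 * i + 15) = ra s i)"

text \<open>Evaluation into cell \<open>r\<close> may dirty the stack from \<open>r\<close> to 63
  and nothing else. In particular a left operand in cell \<open>r\<close> survives the evaluation of
  the right one into \<open>Suc r\<close>.\<close>

definition same_below :: "nat \<Rightarrow> (nat \<Rightarrow> real) \<Rightarrow> (nat \<Rightarrow> real) \<Rightarrow> bool" where
  "same_below r m m' \<longleftrightarrow> (\<forall>x. x < r \<or> 64 \<le> x \<longrightarrow> m' x = m x)"

lemma same_below_refl [simp]: "same_below r m m"
  by (simp add: same_below_def)

lemma same_below_trans: "same_below r m m' \<Longrightarrow> same_below r' m' m'' \<Longrightarrow> r \<le> r' \<Longrightarrow> same_below r m m''"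
  by (auto simp: same_below_def)

lemma rel_same: "rel n s m \<Longrightarrow> same_below 40 m m' \<Longrightarrow> rel n s m'"
  by (auto simp: rel_def same_below_def)

lemma rel_same': "rel n s m \<Longrightarrow> same_below r m m' \<Longrightarrow> 32 \<le> r \<Longrightarrow> rel n s m'"
  by (auto simp: rel_def same_below_def)

lemma mem_eff_fold1: "runs P 1 (p, m) (Suc p, mem_eff c m)"
  if "p < length P" "P ! p = c" "is_straight c"
  using runs_straight[of P p "[c]" m] that by simp

lemma addr_eff:
  assumes "m r = real v" "r + 1 < 64"
  shows "fold mem_eff (addr_code r a) m r = real (64 + 16 * v + a)"
    "same_below r m (fold mem_eff (addr_code r a) m)"
    "\<And>x. x \<noteq> r \<Longrightarrow> x \<noteq> Suc r \<Longrightarrow> fold mem_eff (addr_code r a) m x = m x"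
  using assms by (auto simp: addr_code_def same_below_def)

lemma addr_straight: "\<forall>c\<in>set (addr_code r a). is_straight c" "length (addr_code r a) = 6"
  by (auto simp: addr_code_def is_straight_def)

lemma ncomp_correctI:
  "runs P T c (q, m') \<Longrightarrow> m' r = v \<Longrightarrow> same_below r m m' \<Longrightarrow>
   \<exists>m'. runs P T c (q, m') \<and> m' r = v \<and> same_below r m m'"
  by blast

lemma ncomp_correct:
  assumes "code_at P p (ncomp e r p)" "nwf e" "r + ndep e < 64" "40 \<le> r" "rel n s m"
  shows "\<exists>m'. runs P (nsz e) (p, m) (p + nsz e, m') \<and> m' r = real (neval e s) \<and> same_below r m m'"
  using assms
proof (induction e arbitrary: r p m)
  case (NC v)
  have "runs P 1 (p, m) (p + 1, fold mem_eff [Const r (int v)] m)"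
    using runs_straight[of P p "[Const r (int v)]" m] NC by (simp add: is_straight_def)
  moreover define m' where "m' = fold mem_eff [Const r (int v)] m"
  ultimately have "runs P (nsz (NC v)) (p, m) (p + nsz (NC v), m')" by simp
  moreover have "m' r = real v" "same_below r m m'"
    using NC by (auto simp: m'_def same_below_def)
  ultimately show ?case by auto
next
  case (NV x)
  have "runs P 2 (p, m) (p + 2, fold mem_eff [Const r 0, Add r r x] m)"
    using runs_straight[of P p "[Const r 0, Add r r x]" m] NV by (simp add: is_straight_def numeral_2_eq_2)
  moreover define m' where "m' = fold mem_eff [Const r 0, Add r r x] m"
  ultimately have "runs P (nsz (NV x)) (p, m) (p + nsz (NV x), m')" by simp
  moreover have "m' r = real (nv s x)" "same_below r m m'"
    using NV by (auto simp: m'_def same_below_def rel_def)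
  ultimately show ?case by auto
next
  case (NAdd e f)
  have dp: "r + ndep e < 64" "Suc r + ndep f < 64" using NAdd.prems(3) by auto
  obtain m1 where m1: "runs P (nsz e) (p, m) (p + nsz e, m1)" "m1 r = real (neval e s)" "same_below r m m1"
    using NAdd.IH(1)[of p r m] NAdd.prems dp by auto
  have rm1: "rel n s m1" using rel_same'[OF NAdd.prems(5) m1(3)] NAdd.prems by auto
  obtain m2 where m2: "runs P (nsz f) (p + nsz e, m1) (p + nsz e + nsz f, m2)" "m2 (Suc r) = real (neval f s)"
    "same_below (Suc r) m1 m2"
    using NAdd.IH(2)[of "p + nsz e" "Suc r" m1] NAdd.prems rm1 dp by auto
  have m3: "runs P 1 (p + nsz e + nsz f, m2) (p + nsz e + nsz f + 1, mem_eff (Add r r (Suc r)) m2)"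
    using mem_eff_fold1[of "p + nsz e + nsz f" P "Add r r (Suc r)" m2] NAdd.prems(1)
    by (simp add: is_straight_def add.assoc)
  have R: "runs P (nsz (NAdd e f)) (p, m) (p + nsz (NAdd e f), mem_eff (Add r r (Suc r)) m2)"
    using runs_trans[OF runs_trans[OF m1(1) m2(1)] m3] by (simp add: add.assoc)
  moreover have "m2 r = m1 r" using m2(3) by (simp add: same_below_def)
  moreover have "same_below r m m2" using same_below_trans[OF m1(3) m2(3)] by simp
  ultimately show ?case using m1 m2 NAdd.prems dp
    by (intro ncomp_correctI[OF R]) (auto simp: same_below_def)
next
  case (NSub e f)
  have dp: "r + ndep e < 64" "Suc r + ndep f < 64" using NSub.prems(3) by auto
  let ?q = "p + nsz e + nsz f"
  have pr: "code_at P p (ncomp e r p)" "code_at P (p + nsz e) (ncomp f (Suc r) (p + nsz e))"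
    and cd: "code_at P ?q [JmpLe (Suc r) r (?q + 3), Const r 0, Const (Suc r) 0, Sub r r (Suc r)]"
    using NSub.prems(1) by (simp_all add: Let_def add.assoc)
  obtain m1 where m1: "runs P (nsz e) (p, m) (p + nsz e, m1)" "m1 r = real (neval e s)" "same_below r m m1"
    using NSub.IH(1)[of p r m] NSub.prems dp pr by auto
  have rm1: "rel n s m1" using rel_same'[OF NSub.prems(5) m1(3)] NSub.prems by auto
  obtain m2 where m2: "runs P (nsz f) (p + nsz e, m1) (p + nsz e + nsz f, m2)" "m2 (Suc r) = real (neval f s)"
    "same_below (Suc r) m1 m2"
    using NSub.IH(2)[of "p + nsz e" "Suc r" m1] NSub.prems rm1 dp pr by auto
  have s2: "same_below r m m2" using same_below_trans[OF m1(3) m2(3)] by simp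
  have r2: "m2 r = m1 r" using m2(3) by (simp add: same_below_def)
  have R12: "runs P (nsz e + nsz f) (p, m) (?q, m2)" by (rule runs_trans[OF m1(1) m2(1)])
  obtain m3 where m3: "runs P 4 (?q, m2) (?q + 4, m3)" "m3 r = real (neval e s - neval f s)" "same_below r m2 m3"
  proof (cases "neval f s \<le> neval e s")
    case True
    have "runs P 1 (?q + 3, m2) (?q + 3 + 1, mem_eff (Sub r r (Suc r)) m2)"
      using mem_eff_fold1[of "?q + 3" P "Sub r r (Suc r)" m2] cd by (simp add: is_straight_def eval_nat_numeral)
    then have "runs P (Suc 1) (?q, m2) (?q + 4, mem_eff (Sub r r (Suc r)) m2)"
      using cd True r2 m1 m2 by (intro runs_stepI) (auto simp: eval_nat_numeral)
    then have "runs P 4 (?q, m2) (?q + 4, mem_eff (Sub r r (Suc r)) m2)" by (rule runs_mono) simp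
    then show ?thesis using True r2 m1 m2 dp
      by (intro that[of "mem_eff (Sub r r (Suc r)) m2"]) (auto simp: same_below_def of_nat_diff)
  next
    case False
    let ?cs = "[Const r 0, Const (Suc r) 0, Sub r r (Suc r)]"
    have "runs P 3 (Suc ?q, m2) (Suc ?q + 3, fold mem_eff ?cs m2)"
      using runs_straight[of P "Suc ?q" ?cs m2] cd by (simp add: is_straight_def eval_nat_numeral)
    then have "runs P (Suc 3) (?q, m2) (?q + 4, fold mem_eff ?cs m2)"
      using cd False r2 m1 m2 by (intro runs_stepI) (auto simp: eval_nat_numeral)
    moreover have "r < 63" using dp by simp
    ultimately show ?thesis using False dp
      by (intro that[of "fold mem_eff ?cs m2"]) (auto simp: same_below_def)
  qed
  have "runs P (nsz e + nsz f + 4) (p, m) (?q + 4, m3)" by (rule runs_trans[OF R12 m3(1)])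
  moreover have "same_below r m m3" using same_below_trans[OF s2 m3(3)] by simp
  ultimately show ?case using m3 by (intro exI[of _ m3]) (auto simp: add.assoc)
next
  case (NA a e)
  have dp: "r + ndep e < 64" "r + 1 < 64" using NA.prems(3) by auto
  obtain m1 where m1: "runs P (nsz e) (p, m) (p + nsz e, m1)" "m1 r = real (neval e s)" "same_below r m m1"
    using NA.IH[of p r m] NA.prems dp by auto
  have rm1: "rel n s m1" using rel_same'[OF NA.prems(5) m1(3)] NA.prems by auto
  let ?cs = "addr_code r a @ [Load r r]"
  have "code_at P (p + nsz e) ?cs" using NA.prems(1) by (simp add: addr_code_def)
  then have m2: "runs P 7 (p + nsz e, m1) (p + nsz e + 7, fold mem_eff ?cs m1)"
    using runs_straight[of P "p + nsz e" ?cs m1] addr_straight[of r a] by (auto simp: is_straight_def)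
  have R: "runs P (nsz e + 7) (p, m) (p + nsz e + 7, fold mem_eff ?cs m1)"
    by (rule runs_trans[OF m1(1) m2])
  let ?ma = "fold mem_eff (addr_code r a) m1"
  have ad: "?ma r = real (64 + 16 * neval e s + a)" "same_below r m1 ?ma"
    using addr_eff[of m1 r "neval e s" a] m1 NA.prems dp by auto
  have "?ma (64 + 16 * neval e s + a) = real (na s a (neval e s))"
    using ad(2) rm1 NA.prems(2) by (auto simp: same_below_def rel_def)
  then have "fold mem_eff ?cs m1 r = real (na s a (neval e s))"
    using ad(1) by (simp del: of_nat_add of_nat_mult)
  moreover have "same_below r m (fold mem_eff ?cs m1)"
    using same_below_trans[OF m1(3) ad(2)] NA.prems by (auto simp: same_below_def)
  ultimately show ?case using R by (intro exI[of _ "fold mem_eff ?cs m1"] conjI) (simp_all only: nsz.simps neval.simps add.assoc)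
qed

section \<open>Simulation of commands with a time bound\<close>

fun tcost :: "com \<Rightarrow> nat" where
  "tcost (Seq c c') = tcost c + tcost c'"
| "tcost (IfLe e f c c') = nsz e + nsz f + 3 + tcost c + tcost c'"
| "tcost (IfRLe x y c c') = 3 + tcost c + tcost c'"
| "tcost (For x c) = tcost c + 9"
| "tcost c = csz c"

text \<open>Loop counters are invisible to \<open>rel\<close>. What an enclosing loop relies on is
  that its body leaves the first \<open>d\<close> counters alone.\<close>

definition keeps :: "nat \<Rightarrow> (nat \<Rightarrow> real) \<Rightarrow> (nat \<Rightarrow> real) \<Rightarrow> bool" where
  "keeps d m m' \<longleftrightarrow> (\<forall>j<d. m' (32 + j) = m (32 + j))"

lemma keeps_trans: "keeps d m m' \<Longrightarrow> keeps d m' m'' \<Longrightarrow> keeps d m m''"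
  by (simp add: keeps_def)

lemma same_below_keeps: "same_below r m m' \<Longrightarrow> 40 \<le> r \<Longrightarrow> d \<le> 8 \<Longrightarrow> keeps d m m'"
  by (auto simp: same_below_def keeps_def)

lemma rel_nset:
  assumes "rel n s m" "0 < x" "x < 24" "\<forall>y. y \<noteq> x \<longrightarrow> y < 32 \<or> 64 \<le> y \<longrightarrow> m' y = m y" "m' x = real v"
  shows "rel n (nset x v s) m'"
  using assms by (auto simp: rel_def nset_def)

lemma rel_rset:
  assumes "rel n s m" "x < 8" "\<forall>y. y \<noteq> 24 + x \<longrightarrow> y < 32 \<or> 64 \<le> y \<longrightarrow> m' y = m y" "m' (24 + x) = v"
  shows "rel n (s\<lparr>rv := (rv s)(x := v)\<rparr>) m'"
  using assms by (auto simp: rel_def)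

lemma layout_inj:
  fixes a b i j :: nat
  assumes "a < 16" "b < 16"
  shows "64 + 16 * i + a = 64 + 16 * j + b \<longleftrightarrow> i = j \<and> a = b"
proof -
  have "i < j \<Longrightarrow> 64 + 16 * i + a \<noteq> 64 + 16 * j + b" "j < i \<Longrightarrow> 64 + 16 * i + a \<noteq> 64 + 16 * j + b"
    using assms by linarith+
  then show ?thesis by (cases i j rule: linorder_cases) auto
qed

lemma rel_nstore:
  assumes "rel n s m" "a < 15" "\<forall>y. y \<noteq> 64 + 16 * i + a \<longrightarrow> y < 32 \<or> 64 \<le> y \<longrightarrow> m' y = m y"
    "m' (64 + 16 * i + a) = real v"
  shows "rel n (s\<lparr>na := (na s)(a := (na s a)(i := v))\<rparr>) m'"
proof -
  have "m' (64 + 16 * j + b) = m (64 + 16 * j + b)" if "b < 16" "j \<noteq> i \<or> b \<noteq> a" for j b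
    using assms(2,3) that layout_inj[of b a j i] by (auto simp del: add_mult_distrib)
  from this[of 15] this show ?thesis using assms by (auto simp: rel_def)
qed

lemma rel_rstore:
  assumes "rel n s m" "\<forall>y. y \<noteq> 64 + 16 * i + 15 \<longrightarrow> y < 32 \<or> 64 \<le> y \<longrightarrow> m' y = m y"
    "m' (64 + 16 * i + 15) = v"
  shows "rel n (s\<lparr>ra := (ra s)(i := v)\<rparr>) m'"
proof -
  have "m' (64 + 16 * j + b) = m (64 + 16 * j + b)" if "b < 16" "j \<noteq> i \<or> b \<noteq> 15" for j b
    using assms(2) that layout_inj[of b 15 j i] by auto
  from this[of 15] this show ?thesis using assms by (auto simp: rel_def)
qed

definition simulates :: "instr list \<Rightarrow> nat \<Rightarrow> nat \<Rightarrow> com \<Rightarrow> nat \<Rightarrow> st \<Rightarrow> nat \<Rightarrow> (nat \<Rightarrow> real) \<Rightarrow> bool" where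
  "simulates P T n c d s p m \<longleftrightarrow>
     (\<exists>m'. runs P T (p, m) (p + csz c, m') \<and> rel n (exec n c s) m' \<and> keeps d m m')"

lemma simulatesI:
  "runs P T (p, m) (q, m') \<Longrightarrow> q = p + csz c \<Longrightarrow> rel n (exec n c s) m' \<Longrightarrow> keeps d m m' \<Longrightarrow>
   simulates P T n c d s p m"
  unfolding simulates_def by blast

lemma simulates_mono: "simulates P T n c d s p m \<Longrightarrow> T \<le> T' \<Longrightarrow> simulates P T' n c d s p m"
  unfolding simulates_def using runs_mono by blast

lemma ncomp40:
  assumes "code_at P p (ncomp e 40 p)" "nwf e" "ndep e \<le> 20" "rel n s m"
  obtains m1 where "runs P (nsz e) (p, m) (p + nsz e, m1)" "m1 40 = real (neval e s)"
    "same_below 40 m m1" "rel n s m1"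
proof -
  from ncomp_correct[OF assms(1,2) _ _ assms(4)] assms(3) obtain m1 where
    m1: "runs P (nsz e) (p, m) (p + nsz e, m1)" "m1 40 = real (neval e s)" "same_below 40 m m1"
    by auto
  with that rel_same[OF assms(4) m1(3)] show ?thesis by blast
qed

lemma ncomp40_41:
  assumes "code_at P p (ncomp e 40 p)" "nwf e" "ndep e \<le> 20" "rel n s m"
    "code_at P (p + nsz e) (ncomp f 41 (p + nsz e))" "nwf f" "ndep f \<le> 20"
  obtains m1 where "runs P (nsz e + nsz f) (p, m) (p + nsz e + nsz f, m1)" "m1 40 = real (neval e s)"
    "m1 41 = real (neval f s)" "same_below 40 m m1" "rel n s m1"
proof -
  obtain m1 where m1: "runs P (nsz e) (p, m) (p + nsz e, m1)" "m1 40 = real (neval e s)"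
    "same_below 40 m m1" "rel n s m1"
    using ncomp40[OF assms(1-4)] .
  obtain m2 where m2: "runs P (nsz f) (p + nsz e, m1) (p + nsz e + nsz f, m2)" "m2 41 = real (neval f s)"
    "same_below 41 m1 m2"
    using ncomp_correct[OF assms(5,6) _ _ m1(4)] assms(7) by auto
  have "same_below 40 m m2" using same_below_trans[OF m1(3) m2(3)] by simp
  moreover have "m2 40 = m1 40" using m2(3) by (simp add: same_below_def)
  ultimately show ?thesis
    using that[of m2] runs_trans[OF m1(1) m2(1)] m1 m2 rel_same[OF assms(4)] by auto
qed

lemma addr_code_run:
  assumes "code_at P p (addr_code 40 a)" "m 40 = real v"
  obtains m' where "runs P 6 (p, m) (p + 6, m')" "m' 40 = real (64 + 16 * v + a)"
    "\<forall>y. y \<noteq> 40 \<longrightarrow> y \<noteq> 41 \<longrightarrow> m' y = m y"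
proof -
  have "runs P 6 (p, m) (p + 6, fold mem_eff (addr_code 40 a) m)"
    using runs_straight[OF assms(1), of m] addr_straight[of 40 a] by simp
  then show ?thesis using that addr_eff[where m = m and r = 40 and v = v and a = a] assms(2) by simp
qed

lemma simulates_atomic:
  assumes "code_at P p (compile c d p)" "cwf c" "d \<le> 8" "rel n s m"
    "case c of Seq _ _ \<Rightarrow> False | IfLe _ _ _ _ \<Rightarrow> False | IfRLe _ _ _ _ \<Rightarrow> False | For _ _ \<Rightarrow> False | _ \<Rightarrow> True"
  shows "simulates P (csz c) n c d s p m"
proof (cases c)
  case Skip
  with assms show ?thesis by (intro simulatesI[OF runs_refl]) (auto simp: keeps_def)
next
  case [simp]: (NSet x e)
  have cd: "code_at P p (ncomp e 40 p)" "code_at P (p + nsz e) [Const 41 0, Add x 40 41]"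
    using assms by simp_all
  obtain m1 where m1: "runs P (nsz e) (p, m) (p + nsz e, m1)" "m1 40 = real (neval e s)"
    "same_below 40 m m1" "rel n s m1"
    using ncomp40[OF cd(1) _ _ assms(4)] assms(2) by auto
  let ?m = "fold mem_eff [Const 41 0, Add x 40 41] m1"
  have "runs P 2 (p + nsz e, m1) (p + nsz e + 2, ?m)"
    using runs_straight[OF cd(2), of m1] by (simp add: is_straight_def numeral_2_eq_2)
  note R = runs_trans[OF m1(1) this]
  have "rel n (nset x (neval e s) s) ?m"
    using m1 assms(2) by (intro rel_nset[OF m1(4)]) auto
  moreover have "keeps d m ?m"
    using same_below_keeps[OF m1(3) _ assms(3)] assms(2,3) by (auto simp: keeps_def)
  ultimately show ?thesis by (intro simulatesI[OF runs_mono[OF R]]) simp_all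
next
  case [simp]: (NStore a e f)
  have cd: "code_at P p (ncomp e 40 p)" "code_at P (p + nsz e) (ncomp f 41 (p + nsz e))"
    "code_at P (p + nsz e + nsz f) [Const 42 0, Add 43 41 42]"
    "code_at P (p + nsz e + nsz f + 2) (addr_code 40 a)"
    "code_at P (p + nsz e + nsz f + 8) [Store 40 43]"
    using assms by (simp_all add: addr_straight eval_nat_numeral add.assoc)
  obtain m1 where m1: "runs P (nsz e + nsz f) (p, m) (p + nsz e + nsz f, m1)" "m1 40 = real (neval e s)"
    "m1 41 = real (neval f s)" "same_below 40 m m1" "rel n s m1"
    using ncomp40_41[OF cd(1) _ _ assms(4) cd(2)] assms(2) by auto
  let ?m2 = "fold mem_eff [Const 42 0, Add 43 41 42] m1"
  have m2: "runs P 2 (p + nsz e + nsz f, m1) (p + nsz e + nsz f + 2, ?m2)"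
    using runs_straight[OF cd(3), of m1] by (simp add: is_straight_def numeral_2_eq_2)
  have m2': "?m2 40 = real (neval e s)" using m1 by simp
  obtain m3 where m3: "runs P 6 (p + nsz e + nsz f + 2, ?m2) (p + nsz e + nsz f + 2 + 6, m3)"
    "m3 40 = real (64 + 16 * neval e s + a)" "\<forall>y. y \<noteq> 40 \<longrightarrow> y \<noteq> 41 \<longrightarrow> m3 y = ?m2 y"
    using addr_code_run[of P _ a ?m2, OF cd(4) m2'] .
  let ?m4 = "mem_eff (Store 40 43) m3"
  have m4: "runs P 1 (p + nsz e + nsz f + 2 + 6, m3) (p + nsz e + nsz f + 9, ?m4)"
    using mem_eff_fold1[of "p + nsz e + nsz f + 8" P "Store 40 43" m3] cd(5)
    by (simp add: is_straight_def eval_nat_numeral)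
  have s4: "?m4 = m3(64 + 16 * neval e s + a := real (neval f s))"
    using m3 m1 by (simp del: of_nat_add of_nat_mult)
  note R = runs_trans[OF runs_trans[OF runs_trans[OF m1(1) m2] m3(1)] m4]
  have "rel n (exec n c s) ?m4"
    unfolding s4 using m1 m3 assms(2) by (auto intro!: rel_nstore[OF m1(5)])
  moreover have "keeps d m ?m4"
    unfolding s4 using same_below_keeps[OF m1(4) _ assms(3)] assms(2,3) m3 by (auto simp: keeps_def)
  ultimately show ?thesis by (intro simulatesI[OF runs_mono[OF R]]) simp_all
next
  case [simp]: (RZero x)
  let ?m = "fold mem_eff [Const (24 + x) 0] m"
  have R: "runs P 1 (p, m) (p + 1, ?m)"
    using runs_straight[of P p "[Const (24 + x) 0]" m] assms by (simp add: is_straight_def)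
  have "rel n (exec n c s) ?m"
    using assms by (auto intro!: rel_rset[OF assms(4)])
  moreover have "keeps d m ?m" using assms by (auto simp: keeps_def)
  ultimately show ?thesis by (intro simulatesI[OF runs_mono[OF R]]) simp_all
next
  case [simp]: (RMov x y)
  let ?m = "fold mem_eff [Const 40 0, Add (24 + x) (24 + y) 40] m"
  have R: "runs P 2 (p, m) (p + 2, ?m)"
    using runs_straight[of P p "[Const 40 0, Add (24 + x) (24 + y) 40]" m] assms
    by (simp add: is_straight_def numeral_2_eq_2)
  have "rel n (exec n c s) ?m"
    using assms unfolding RMov exec.simps by (intro rel_rset[OF assms(4)]) (auto simp: rel_def)
  moreover have "keeps d m ?m" using assms by (auto simp: keeps_def)
  ultimately show ?thesis by (intro simulatesI[OF runs_mono[OF R]]) simp_all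
next
  case [simp]: (RAdd x y z)
  let ?m = "fold mem_eff [Add (24 + x) (24 + y) (24 + z)] m"
  have R: "runs P 1 (p, m) (p + 1, ?m)"
    using runs_straight[of P p "[Add (24 + x) (24 + y) (24 + z)]" m] assms by (simp add: is_straight_def)
  have "rel n (exec n c s) ?m"
    using assms unfolding RAdd exec.simps by (intro rel_rset[OF assms(4)]) (auto simp: rel_def)
  moreover have "keeps d m ?m" using assms by (auto simp: keeps_def)
  ultimately show ?thesis by (intro simulatesI[OF runs_mono[OF R]]) simp_all
next
  case [simp]: (RLoad x e)
  have cd: "code_at P p (ncomp e 40 p)" "code_at P (p + nsz e) (addr_code 40 15)"
    "code_at P (p + nsz e + 6) [Load (24 + x) 40]"
    using assms by (simp_all add: addr_straight eval_nat_numeral)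
  obtain m1 where m1: "runs P (nsz e) (p, m) (p + nsz e, m1)" "m1 40 = real (neval e s)"
    "same_below 40 m m1" "rel n s m1"
    using ncomp40[OF cd(1) _ _ assms(4)] assms(2) by auto
  obtain m3 where m3: "runs P 6 (p + nsz e, m1) (p + nsz e + 6, m3)"
    "m3 40 = real (64 + 16 * neval e s + 15)" "\<forall>y. y \<noteq> 40 \<longrightarrow> y \<noteq> 41 \<longrightarrow> m3 y = m1 y"
    using addr_code_run[of P _ 15 m1, OF cd(2) m1(2)] .
  let ?m4 = "mem_eff (Load (24 + x) 40) m3"
  have m4: "runs P 1 (p + nsz e + 6, m3) (p + nsz e + 7, ?m4)"
    using mem_eff_fold1[of "p + nsz e + 6" P "Load (24 + x) 40" m3] cd(3)
    by (simp add: is_straight_def eval_nat_numeral)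
  have "m3 (64 + 16 * neval e s + 15) = ra s (neval e s)"
    using m3(3) m1(4) by (simp add: rel_def)
  then have s4: "?m4 = m3(24 + x := ra s (neval e s))"
    using m3 by (simp del: of_nat_add of_nat_mult)
  note R = runs_trans[OF runs_trans[OF m1(1) m3(1)] m4]
  have "rel n (exec n c s) ?m4"
    unfolding s4 using m1 m3 assms(2) by (auto intro!: rel_rset[OF m1(4)])
  moreover have "keeps d m ?m4"
    unfolding s4 using same_below_keeps[OF m1(3) _ assms(3)] assms(2,3) m3 by (auto simp: keeps_def)
  ultimately show ?thesis by (intro simulatesI[OF runs_mono[OF R]]) simp_all
next
  case [simp]: (RStore e x)
  have cd: "code_at P p (ncomp e 40 p)" "code_at P (p + nsz e) (addr_code 40 15)"
    "code_at P (p + nsz e + 6) [Store 40 (24 + x)]"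
    using assms by (simp_all add: addr_straight eval_nat_numeral)
  obtain m1 where m1: "runs P (nsz e) (p, m) (p + nsz e, m1)" "m1 40 = real (neval e s)"
    "same_below 40 m m1" "rel n s m1"
    using ncomp40[OF cd(1) _ _ assms(4)] assms(2) by auto
  obtain m3 where m3: "runs P 6 (p + nsz e, m1) (p + nsz e + 6, m3)"
    "m3 40 = real (64 + 16 * neval e s + 15)" "\<forall>y. y \<noteq> 40 \<longrightarrow> y \<noteq> 41 \<longrightarrow> m3 y = m1 y"
    using addr_code_run[of P _ 15 m1, OF cd(2) m1(2)] .
  let ?m4 = "mem_eff (Store 40 (24 + x)) m3"
  have m4: "runs P 1 (p + nsz e + 6, m3) (p + nsz e + 7, ?m4)"
    using mem_eff_fold1[of "p + nsz e + 6" P "Store 40 (24 + x)" m3] cd(3)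
    by (simp add: is_straight_def eval_nat_numeral)
  have "m3 (24 + x) = rv s x"
    using m3(3) m1(4) assms(2) by (simp add: rel_def)
  then have s4: "?m4 = m3(64 + 16 * neval e s + 15 := rv s x)"
    using m3 by (simp del: of_nat_add of_nat_mult)
  note R = runs_trans[OF runs_trans[OF m1(1) m3(1)] m4]
  have "rel n (exec n c s) ?m4"
    unfolding s4 using m1 m3 assms(2) by (auto intro!: rel_rstore[OF m1(4)])
  moreover have "keeps d m ?m4"
    unfolding s4 using same_below_keeps[OF m1(3) _ assms(3)] assms(2,3) m3 by (auto simp: keeps_def)
  ultimately show ?thesis by (intro simulatesI[OF runs_mono[OF R]]) simp_all
qed (use assms in auto)

lemma simulates_Seq:
  assumes "simulates P T n c d s p m"
    and "\<And>m'. rel n (exec n c s) m' \<Longrightarrow> simulates P T' n c' d (exec n c s) (p + csz c) m'"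
  shows "simulates P (T + T') n (Seq c c') d s p m"
proof -
  from assms(1) obtain m1 where m1: "runs P T (p, m) (p + csz c, m1)" "rel n (exec n c s) m1" "keeps d m m1"
    unfolding simulates_def by blast
  from assms(2)[OF m1(2)] obtain m2 where m2: "runs P T' (p + csz c, m1) (p + csz c + csz c', m2)"
    "rel n (exec n c' (exec n c s)) m2" "keeps d m1 m2"
    unfolding simulates_def by blast
  show ?thesis
    by (rule simulatesI[OF runs_trans[OF m1(1) m2(1)]]) (use m2 keeps_trans[OF m1(3) m2(3)] in auto)
qed

lemma jump_run:
  assumes "code_at P q [Const 40 0, JmpLe 40 40 l]"
  shows "runs P 2 (q, m) (l, m(40 := 0))"
proof -
  have "runs P 0 (l, m(40 := 0)) (l, m(40 := 0))" by (rule runs_refl)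
  then have "runs P (Suc 0) (Suc q, m(40 := 0)) (l, m(40 := 0))"
    using assms by (intro runs_stepI) auto
  then have "runs P (Suc (Suc 0)) (q, m) (l, m(40 := 0))"
    using assms by (intro runs_stepI) auto
  then show ?thesis by (simp add: numeral_2_eq_2)
qed

lemma rel_upd40: "rel n s m \<Longrightarrow> rel n s (m(40 := v))"
  by (auto simp: rel_def)

lemma keeps_upd40: "d \<le> 8 \<Longrightarrow> keeps d m (m(40 := v))"
  by (auto simp: keeps_def)

text \<open>A round costs the body plus seven instructions: one test, two to copy the counter into
  \<open>x\<close>, two to increment it and two to jump back. The final 2 pays for the
  initialisation of the counter and for the exit test.\<close>

lemma simulates_For:
  fixes d n :: nat
  assumes code: "code_at P p (compile (For x c) d p)" and wf: "0 < x" "x < 24" "d < 8" and m0: "rel n s m"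
    and body: "\<And>s m. rel n s m \<Longrightarrow> simulates P T n c (Suc d) s (p + 4) m"
  shows "simulates P (n * (T + 7) + 2) n (For x c) d s p m"
proof -
  let ?B = "csz c"
  have cd: "p < length P" "P ! p = Const (32 + d) 0"
    "Suc p < length P" "P ! (Suc p) = JmpLe 0 (32 + d) (p + 8 + ?B)"
    "code_at P (p + 2) [Const 40 0, Add x (32 + d) 40]"
    "code_at P (p + 4 + ?B) [Const 40 1, Add (32 + d) (32 + d) 40]"
    "code_at P (p + 6 + ?B) [Const 40 0, JmpLe 40 40 (p + 1)]"
    using code by (simp_all add: Let_def eval_nat_numeral)
  define S where "S j = fold (\<lambda>v s. exec n c (nset x v s)) [0..<j] s" for j
  have S_Suc: "S (Suc j) = exec n c (nset x j (S j))" for j by (simp add: S_def)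
  have iter: "\<exists>m'. runs P (T + 7) (p + 1, m1) (p + 1, m') \<and> rel n (S (Suc j)) m' \<and> m' (32 + d) = real (Suc j) \<and> keeps d m1 m'"
    if j: "j < n" "rel n (S j) m1" "m1 (32 + d) = real j" for j m1
  proof -
    have "m1 0 = real n" using j(2) by (auto simp: rel_def)
    then have r1: "runs P (Suc 0) (p + 1, m1) (p + 2, m1)"
      using cd(3,4) j runs_refl by (intro runs_stepI) auto
    let ?m2 = "fold mem_eff [Const 40 0, Add x (32 + d) 40] m1"
    have r2: "runs P 2 (p + 2, m1) (p + 4, ?m2)"
      using runs_straight[OF cd(5), of m1] by (simp add: is_straight_def eval_nat_numeral)
    have "rel n (nset x j (S j)) ?m2"
      using wf j by (intro rel_nset[OF j(2)]) auto
    from body[OF this] obtain m3 where m3: "runs P T (p + 4, ?m2) (p + 4 + ?B, m3)" "rel n (S (Suc j)) m3"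
      "keeps (Suc d) ?m2 m3"
      unfolding simulates_def S_Suc by blast
    have m3d: "m3 (32 + d) = real j" using m3(3) j(3) wf by (auto simp: keeps_def)
    let ?m4 = "fold mem_eff [Const 40 1, Add (32 + d) (32 + d) 40] m3"
    have r4: "runs P 2 (p + 4 + ?B, m3) (p + 6 + ?B, ?m4)"
      using runs_straight[OF cd(6), of m3] by (simp add: is_straight_def eval_nat_numeral)
    let ?m5 = "?m4(40 := 0)"
    have r5: "runs P 2 (p + 6 + ?B, ?m4) (p + 1, ?m5)" by (rule jump_run[OF cd(7)])
    have R: "runs P (Suc 0 + 2 + T + 2 + 2) (p + 1, m1) (p + 1, ?m5)"
      by (rule runs_trans[OF runs_trans[OF runs_trans[OF runs_trans[OF r1 r2] m3(1)] r4] r5])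
    have "rel n (S (Suc j)) ?m5"
      using m3(2) wf by (auto simp: rel_def)
    moreover have "?m5 (32 + d) = real (Suc j)" using m3d wf by simp
    moreover have "keeps d m1 ?m5" using m3(3) wf by (auto simp: keeps_def)
    ultimately show ?thesis using runs_mono[OF R, of "T + 7"] by fastforce
  qed
  have loop: "\<exists>m'. runs P (j * (T + 7) + 1) (p, m) (p + 1, m') \<and> rel n (S j) m' \<and> m' (32 + d) = real j \<and> keeps d m m'"
    if "j \<le> n" for j
    using that
  proof (induction j)
    case 0
    let ?m = "m(32 + d := 0)"
    have "runs P (Suc 0) (p, m) (p + 1, ?m)"
      using cd(1,2) runs_refl by (intro runs_stepI) auto
    moreover have "rel n s ?m" using m0 wf by (auto simp: rel_def)
    moreover have "keeps d m ?m" by (auto simp: keeps_def)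
    ultimately have "runs P 1 (p, m) (p + 1, ?m) \<and> rel n s ?m \<and> ?m (32 + d) = 0 \<and> keeps d m ?m" by simp
    then show ?case unfolding S_def by (metis add_0 fold_simps(1) mult_0 of_nat_0 upt_0)
  next
    case (Suc j)
    then obtain m1 where m1: "runs P (j * (T + 7) + 1) (p, m) (p + 1, m1)" "rel n (S j) m1"
      "m1 (32 + d) = real j" "keeps d m m1" by auto
    from iter[OF _ m1(2,3)] Suc.prems obtain m2 where m2: "runs P (T + 7) (p + 1, m1) (p + 1, m2)"
      "rel n (S (Suc j)) m2" "m2 (32 + d) = real (Suc j)" "keeps d m1 m2" by auto
    have "runs P (Suc j * (T + 7) + 1) (p, m) (p + 1, m2)"
      using runs_trans[OF m1(1) m2(1)] by (simp add: algebra_simps)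
    then show ?case using m2 keeps_trans[OF m1(4) m2(4)] by blast
  qed
  from loop[of n] obtain m1 where m1: "runs P (n * (T + 7) + 1) (p, m) (p + 1, m1)" "rel n (S n) m1"
    "m1 (32 + d) = real n" "keeps d m m1" by auto
  have "m1 0 = real n" using m1(2) by (auto simp: rel_def)
  then have "runs P (Suc 0) (p + 1, m1) (p + 8 + ?B, m1)"
    using cd(3,4) m1(3) runs_refl by (intro runs_stepI) auto
  from runs_trans[OF m1(1) this] show ?thesis
    using m1 by (intro simulatesI[where m' = m1 and q = "p + 8 + ?B"]) (auto simp: S_def)
qed

text \<open>One more loop raises the degree in \<open>n + 1\<close> by one, and its overhead is
  absorbed by 9 further units of the coefficient; this is the 9 in \<open>tcost\<close>.\<close>

lemma for_cost: "n * (t * (n + 1) ^ D + 7) + 2 \<le> (t + 9) * ((n::nat) + 1) ^ Suc D"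
proof -
  define X where "X = (n + 1) ^ D"
  have X: "1 \<le> X" by (simp add: X_def)
  then have nX: "n \<le> n * X" by simp
  have "n * (t * X + 7) + 2 = t * (n * X) + 7 * n + 2" by (simp add: algebra_simps)
  also have "\<dots> \<le> t * (n * X) + 7 * (n * X) + 2 * X" using X nX by linarith
  also have "\<dots> \<le> t * (n * X) + 9 * (n * X) + t * X + 9 * X" by simp
  also have "\<dots> = (t + 9) * (n + 1) ^ Suc D" by (simp add: X_def algebra_simps)
  finally show ?thesis by (simp only: X_def)
qed

theorem comp_correct:
  assumes "code_at P p (compile c d p)" "cwf c" "d + loop_depth c \<le> 8" "rel n s m"
  shows "simulates P (tcost c * (n + 1) ^ loop_depth c) n c d s p m"
  using assms
proof (induction c arbitrary: d p s m)
  case (Seq c c')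
  have cd: "code_at P p (compile c d p)" "code_at P (p + csz c) (compile c' d (p + csz c))"
    using Seq.prems by (simp_all add: Let_def)
  have "simulates P (tcost c * (n + 1) ^ loop_depth c + tcost c' * (n + 1) ^ loop_depth c') n (Seq c c') d s p m"
    using Seq.prems by (intro simulates_Seq Seq.IH cd) auto
  moreover have "tcost c * (n + 1) ^ loop_depth c + tcost c' * (n + 1) ^ loop_depth c'
     \<le> tcost c * (n + 1) ^ loop_depth (Seq c c') + tcost c' * (n + 1) ^ loop_depth (Seq c c')"
    by (intro add_mono mult_left_mono power_increasing) auto
  ultimately show ?case by (auto elim: simulates_mono simp: algebra_simps)
next
  case (IfLe e f c c')
  let ?q = "p + nsz e + nsz f"
  let ?l = "?q + 3 + csz c'"
  have cd: "code_at P p (ncomp e 40 p)" "code_at P (p + nsz e) (ncomp f 41 (p + nsz e))"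
    "?q < length P" "P ! ?q = JmpLe 40 41 ?l" "code_at P (?q + 1) (compile c' d (?q + 1))"
    "code_at P (?q + 1 + csz c') [Const 40 0, JmpLe 40 40 (?l + csz c)]"
    "code_at P ?l (compile c d ?l)"
    using IfLe.prems(1) by (simp_all add: Let_def add_ac eval_nat_numeral)
  obtain m1 where m1: "runs P (nsz e + nsz f) (p, m) (?q, m1)" "m1 40 = real (neval e s)"
    "m1 41 = real (neval f s)" "same_below 40 m m1" "rel n s m1"
    using ncomp40_41[OF cd(1) _ _ IfLe.prems(4) cd(2)] IfLe.prems(2) by auto
  have k1: "keeps d m m1" using same_below_keeps[OF m1(4)] IfLe.prems(3) by simp
  have tc: "nsz e + nsz f + 3 + t * (n + 1) ^ a \<le> tcost (IfLe e f c c') * (n + 1) ^ loop_depth (IfLe e f c c')"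
    if "a \<le> loop_depth (IfLe e f c c')" "t = tcost c \<or> t = tcost c'" for t a
  proof -
    have "nsz e + nsz f + 3 + t * (n + 1) ^ a \<le>
      (nsz e + nsz f + 3) * (n + 1) ^ loop_depth (IfLe e f c c') + t * (n + 1) ^ loop_depth (IfLe e f c c')"
      using that by (intro add_mono mult_left_mono power_increasing) auto
    also have "\<dots> \<le> tcost (IfLe e f c c') * (n + 1) ^ loop_depth (IfLe e f c c')"
      using that by (simp only: add_mult_distrib[symmetric]) (intro mult_right_mono, auto)
    finally show ?thesis .
  qed
  show ?case
  proof (cases "neval e s \<le> neval f s")
    case True
    have "runs P (Suc 0) (?q, m1) (?l, m1)"
      using cd(3,4) True m1 runs_refl by (intro runs_stepI) auto
    note R = runs_trans[OF m1(1) this]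
    have "simulates P (tcost c * (n + 1) ^ loop_depth c) n c d s ?l m1"
      using IfLe.prems m1 by (intro IfLe.IH cd) auto
    then obtain m2 where m2: "runs P (tcost c * (n + 1) ^ loop_depth c) (?l, m1) (?l + csz c, m2)"
      "rel n (exec n c s) m2" "keeps d m1 m2" unfolding simulates_def by blast
    show ?thesis
      by (rule simulatesI[OF runs_mono[OF runs_trans[OF R m2(1)]]])
        (use True m2 keeps_trans[OF k1 m2(3)] tc[of "loop_depth c" "tcost c"] in auto)
  next
    case False
    have "runs P (Suc 0) (?q, m1) (?q + 1, m1)"
      using cd(3,4) False m1 runs_refl by (intro runs_stepI) auto
    note R = runs_trans[OF m1(1) this]
    have "simulates P (tcost c' * (n + 1) ^ loop_depth c') n c' d s (?q + 1) m1"
      using IfLe.prems m1 by (intro IfLe.IH cd) auto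
    then obtain m2 where m2: "runs P (tcost c' * (n + 1) ^ loop_depth c') (?q + 1, m1) (?q + 1 + csz c', m2)"
      "rel n (exec n c' s) m2" "keeps d m1 m2" unfolding simulates_def by blast
    note R2 = runs_trans[OF runs_trans[OF R m2(1)] jump_run[OF cd(6)]]
    have "keeps d m (m2(40 := 0))"
      using keeps_trans[OF k1 keeps_trans[OF m2(3) keeps_upd40]] IfLe.prems(3) by auto
    then show ?thesis
      by (intro simulatesI[OF runs_mono[OF R2]])
        (use False m2 tc[of "loop_depth c'" "tcost c'"] in \<open>auto intro!: rel_upd40\<close>)
  qed
next
  case (IfRLe x y c c')
  let ?l = "p + 3 + csz c'"
  have cd: "p < length P" "P ! p = JmpLe (24 + x) (24 + y) ?l" "code_at P (p + 1) (compile c' d (p + 1))"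
    "code_at P (p + 1 + csz c') [Const 40 0, JmpLe 40 40 (?l + csz c)]"
    "code_at P ?l (compile c d ?l)"
    using IfRLe.prems(1) by (simp_all add: Let_def add_ac eval_nat_numeral)
  have xy: "m (24 + x) = rv s x" "m (24 + y) = rv s y"
    using IfRLe.prems by (auto simp: rel_def)
  have tc: "3 + t * (n + 1) ^ a \<le> tcost (IfRLe x y c c') * (n + 1) ^ loop_depth (IfRLe x y c c')"
    if "a \<le> loop_depth (IfRLe x y c c')" "t = tcost c \<or> t = tcost c'" for t a
  proof -
    have "3 + t * (n + 1) ^ a \<le>
      3 * (n + 1) ^ loop_depth (IfRLe x y c c') + t * (n + 1) ^ loop_depth (IfRLe x y c c')"
      using that by (intro add_mono mult_left_mono power_increasing) auto
    also have "\<dots> \<le> tcost (IfRLe x y c c') * (n + 1) ^ loop_depth (IfRLe x y c c')"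
      using that by (simp only: add_mult_distrib[symmetric]) (intro mult_right_mono, auto)
    finally show ?thesis .
  qed
  show ?case
  proof (cases "rv s x \<le> rv s y")
    case True
    have R: "runs P (Suc 0) (p, m) (?l, m)"
      using cd(1,2) True xy runs_refl by (intro runs_stepI) auto
    have "simulates P (tcost c * (n + 1) ^ loop_depth c) n c d s ?l m"
      using IfRLe.prems by (intro IfRLe.IH cd) auto
    then obtain m2 where m2: "runs P (tcost c * (n + 1) ^ loop_depth c) (?l, m) (?l + csz c, m2)"
      "rel n (exec n c s) m2" "keeps d m m2" unfolding simulates_def by blast
    show ?thesis
      by (rule simulatesI[OF runs_mono[OF runs_trans[OF R m2(1)]]])
        (use True m2 tc[of "loop_depth c" "tcost c"] in auto)
  next
    case False
    have R: "runs P (Suc 0) (p, m) (p + 1, m)"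
      using cd(1,2) False xy runs_refl by (intro runs_stepI) auto
    have "simulates P (tcost c' * (n + 1) ^ loop_depth c') n c' d s (p + 1) m"
      using IfRLe.prems by (intro IfRLe.IH cd) auto
    then obtain m2 where m2: "runs P (tcost c' * (n + 1) ^ loop_depth c') (p + 1, m) (p + 1 + csz c', m2)"
      "rel n (exec n c' s) m2" "keeps d m m2" unfolding simulates_def by blast
    note R2 = runs_trans[OF runs_trans[OF R m2(1)] jump_run[OF cd(4)]]
    have "keeps d m (m2(40 := 0))"
      using keeps_trans[OF m2(3) keeps_upd40] IfRLe.prems(3) by auto
    then show ?thesis
      by (intro simulatesI[OF runs_mono[OF R2]])
        (use False m2 tc[of "loop_depth c'" "tcost c'"] in \<open>auto intro!: rel_upd40\<close>)
  qed
next
  case (For x c)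
  have cd: "code_at P (p + 4) (compile c (Suc d) (p + 4))"
    using For.prems(1) by (simp add: Let_def eval_nat_numeral)
  have "simulates P (n * (tcost c * (n + 1) ^ loop_depth c + 7) + 2) n (For x c) d s p m"
    using For.prems by (intro simulates_For[OF For.prems(1)] For.IH cd) auto
  then show ?case using for_cost[of n "tcost c" "loop_depth c"] by (auto elim: simulates_mono)
qed (use simulates_atomic in \<open>auto simp del: compile.simps csz.simps cwf.simps exec.simps\<close>)

subsection \<open>Moving the input out of the way\<close>

text \<open>Written for address 0, as its jumps are absolute. It leaves \<open>n * n\<close> in cell
  2, the first address behind the blocks of the matrix in cell 3, and the constants 1, 0, 16 in
  cells 4 to 6. The product is found by adding \<open>n\<close> repeatedly.\<close>

definition square_code :: "instr list" where
  "square_code = [Const 2 0, Const 3 0, Const 4 1, JmpLe 0 2 7, Add 3 3 0, Add 2 2 4, JmpLe 4 4 3,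
     Const 5 0, Add 2 3 5, Add 3 3 3, Add 3 3 3, Add 3 3 3, Add 3 3 3, Const 6 64, Add 3 3 6, Const 6 16]"

definition zero_code :: "nat \<Rightarrow> instr list" where
  "zero_code j = concat (replicate j [Store 9 5, Add 9 9 4])"

definition block_code :: "instr list" where
  "block_code = [Sub 3 3 6, Add 7 2 4, Load 8 7, Add 9 3 5] @ zero_code 15 @ [Store 9 8, Sub 2 2 4]"

text \<open>The matrix is spread from its last entry downward. Entry \<open>c\<close> moves from
  cell \<open>c + 2\<close> to \<open>64 + 16 * c + 15\<close>, and the whole block starting at
  \<open>64 + 16 * c\<close> lies above every source that is still to be read. The other 15 cells of
  the block become zero entries of the natural arrays.\<close>

definition spread_code :: "instr list" where
  "spread_code = [JmpLe 2 5 54] @ block_code @ [JmpLe 5 5 16]"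

definition clear_code :: "instr list" where
  "clear_code = map (\<lambda>x. Const x 0) [2..<64]"

definition prologue :: "instr list" where
  "prologue = square_code @ spread_code @ clear_code"

lemma length_zero_code [simp]: "length (zero_code j) = 2 * j"
  by (induction j) (auto simp: zero_code_def)

lemma length_prologue:
  "length square_code = 16" "length block_code = 36" "length spread_code = 38" "length clear_code = 62"
  "length prologue = 116"
  by (simp_all add: square_code_def block_code_def spread_code_def clear_code_def prologue_def)

lemma zero_straight: "\<forall>c\<in>set (zero_code j). is_straight c"
  by (induction j) (auto simp: zero_code_def is_straight_def)

lemma zero_code_Suc: "zero_code (Suc j) = zero_code j @ [Store 9 5, Add 9 9 4]"
  unfolding zero_code_def by (simp add: replicate_append_same[symmetric] del: replicate_append_same)

lemma zero_eff:
  assumes "m 9 = real a" "m 5 = 0" "m 4 = 1" "64 \<le> a"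
  shows "fold mem_eff (zero_code j) m = (\<lambda>x. if x = 9 then real (a + j) else if a \<le> x \<and> x < a + j then 0 else m x)"
proof (induction j)
  case 0 then show ?case using assms by (auto simp: zero_code_def)
next
  case (Suc j)
  have "nat \<lfloor>real (a + j)\<rfloor> = a + j" by linarith
  with Suc assms show ?case
    unfolding zero_code_Suc fold_append o_apply by (simp add: fun_eq_iff)
qed

text \<open>The scratch registers lie below cell 12, and what the input had there is not claimed to
  survive. Matrix entry \<open>c\<close> sits in cell \<open>c + 2\<close>, which is where the
  condition \<open>10 \<le> c\<close> in the last conclusion, and later on all distances, comes
  from.\<close>

lemma block_eff:
  assumes "m 2 = real (Suc c)" "m 3 = real (64 + 16 * Suc c)" "m 4 = 1" "m 5 = 0" "m 6 = 16"
    and m': "m' = fold mem_eff block_code m"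
  shows "m' 2 = real c" "m' 3 = real (64 + 16 * c)" "m' 4 = 1" "m' 5 = 0" "m' 6 = 16" "m' 0 = m 0" "m' 1 = m 1"
    "\<And>x. 12 \<le> x \<Longrightarrow> x < 64 + 16 * c \<or> 64 + 16 * Suc c \<le> x \<Longrightarrow> m' x = m x"
    "\<And>a. a < 15 \<Longrightarrow> m' (64 + 16 * c + a) = 0"
    "10 \<le> c \<Longrightarrow> m' (64 + 16 * c + 15) = m (c + 2)"
proof -
  define m1 where "m1 = fold mem_eff [Sub 3 3 6, Add 7 2 4, Load 8 7, Add 9 3 5] m"
  define m2 where "m2 = fold mem_eff (zero_code 15) m1"
  have fl: "nat (2 + int c) = Suc (Suc c)" "nat (int c + 2) = Suc (Suc c)" by linarith+
  have m1: "m1 = m(3 := real (64 + 16 * c), 7 := real (c + 2),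
      8 := (m(3 := real (64 + 16 * c), 7 := real (c + 2))) (c + 2), 9 := real (64 + 16 * c))"
    using assms fl by (simp add: m1_def fun_eq_iff)
  have m2: "m2 = (\<lambda>x. if x = 9 then real (64 + 16 * c + 15)
     else if 64 + 16 * c \<le> x \<and> x < 64 + 16 * c + 15 then 0 else m1 x)"
    unfolding m2_def using assms m1 by (intro zero_eff) auto
  have fl2: "nat \<lfloor>m2 9\<rfloor> = 64 + 16 * c + 15" by (simp add: m2) linarith
  have e: "m' = m2(64 + 16 * c + 15 := m1 8, 2 := real c)"
    unfolding m' block_code_def fold_append o_apply m1_def[symmetric] m2_def[symmetric]
    using fl2 assms m1 by (simp add: m2 fun_eq_iff)
  show "m' 2 = real c" "m' 3 = real (64 + 16 * c)" "m' 4 = 1" "m' 5 = 0" "m' 6 = 16" "m' 0 = m 0" "m' 1 = m 1"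
    unfolding e using assms(1-5) by (simp_all add: m2 m1)
  show "\<And>x. 12 \<le> x \<Longrightarrow> x < 64 + 16 * c \<or> 64 + 16 * Suc c \<le> x \<Longrightarrow> m' x = m x"
    by (auto simp: e m2 m1)
  show "\<And>a. a < 15 \<Longrightarrow> m' (64 + 16 * c + a) = 0"
    by (simp add: e m2)
  show "10 \<le> c \<Longrightarrow> m' (64 + 16 * c + 15) = m (c + 2)"
    by (simp add: e m1)
qed

lemma square_run:
  assumes "code_at P 0 square_code" "m 0 = real n"
  obtains m' where "runs P (4 * n + 13) (0, m) (16, m')" "\<forall>x. x < 2 \<or> 12 \<le> x \<longrightarrow> m' x = m x"
    "m' 2 = real (n * n)" "m' 3 = real (64 + 16 * (n * n))" "m' 4 = 1" "m' 5 = 0" "m' 6 = 16"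
proof -
  have cd: "code_at P 0 [Const 2 0, Const 3 0, Const 4 1]" "3 < length P" "P ! 3 = JmpLe 0 2 7"
    "code_at P 4 [Add 3 3 0, Add 2 2 4]" "6 < length P" "P ! 6 = JmpLe 4 4 3"
    "code_at P 7 [Const 5 0, Add 2 3 5, Add 3 3 3, Add 3 3 3, Add 3 3 3, Add 3 3 3, Const 6 64, Add 3 3 6, Const 6 16]"
    using assms(1) by (simp_all add: square_code_def eval_nat_numeral)
  define M where "M j = m(2 := real j, 3 := real (j * n), 4 := 1)" for j
  have loop: "runs P (4 * j + 3) (0, m) (3, M j)" if "j \<le> n" for j
    using that
  proof (induction j)
    case 0
    have "fold mem_eff [Const 2 0, Const 3 0, Const 4 1] m = M 0" by (simp add: M_def)
    then show ?case
      using runs_straight[OF cd(1), of m] by (simp add: is_straight_def numeral_3_eq_3)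
  next
    case (Suc j)
    have r2: "runs P 2 (4, M j) (6, fold mem_eff [Add 3 3 0, Add 2 2 4] (M j))"
      using runs_straight[OF cd(4), of "M j"] by (simp add: is_straight_def eval_nat_numeral)
    have e: "fold mem_eff [Add 3 3 0, Add 2 2 4] (M j) = M (Suc j)"
      using assms(2) by (simp add: M_def fun_eq_iff algebra_simps)
    have r1: "runs P (Suc 0) (3, M j) (4, M j)"
      using cd(2,3) Suc.prems assms(2) runs_refl by (intro runs_stepI) (auto simp: M_def)
    have r3: "runs P (Suc 0) (6, M (Suc j)) (3, M (Suc j))"
      using cd(5,6) runs_refl by (intro runs_stepI) auto
    have "runs P (4 * j + 3) (0, m) (3, M j)" using Suc by simp
    from runs_trans[OF runs_trans[OF runs_trans[OF this r1] r2[unfolded e]] r3]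
    show ?case by (rule runs_mono) simp
  qed
  have r1: "runs P (Suc 0) (3, M n) (7, M n)"
    using cd(2,3) assms(2) runs_refl by (intro runs_stepI) (auto simp: M_def)
  define m' where "m' = fold mem_eff [Const 5 0, Add 2 3 5, Add 3 3 3, Add 3 3 3, Add 3 3 3, Add 3 3 3, Const 6 64, Add 3 3 6, Const 6 16] (M n)"
  have "runs P 9 (7, M n) (16, m')"
    unfolding m'_def using runs_straight[OF cd(7), of "M n"] by (simp add: is_straight_def eval_nat_numeral)
  from runs_trans[OF runs_trans[OF loop[of n] r1] this]
  have "runs P (4 * n + 13) (0, m) (16, m')" by (simp add: add.commute)
  then show ?thesis
    by (rule that) (simp_all add: m'_def M_def)
qed

lemma spread_run:
  assumes cd: "code_at P 16 spread_code"
    and m: "m 2 = real N" "m 3 = real (64 + 16 * N)" "m 4 = 1" "m 5 = 0" "m 6 = 16"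
    and z: "\<And>x. 64 + 16 * N \<le> x \<Longrightarrow> m x = 0"
  obtains m' where "runs P (38 * N + 1) (16, m) (54, m')" "m' 0 = m 0" "m' 1 = m 1"
    "\<And>i a. a < 15 \<Longrightarrow> m' (64 + 16 * i + a) = 0"
    "\<And>i. 10 \<le> i \<Longrightarrow> m' (64 + 16 * i + 15) = (if i < N then m (i + 2) else 0)"
proof -
  have cd: "16 < length P" "P ! 16 = JmpLe 2 5 54" "code_at P 17 block_code" "53 < length P" "P ! 53 = JmpLe 5 5 16"
    using cd by (simp_all add: spread_code_def length_prologue)
  have bs: "\<forall>c\<in>set block_code. is_straight c"
    using zero_straight[of 15] unfolding block_code_def by (auto simp: is_straight_def)
  have loop: "\<exists>m'. runs P (38 * j) (16, m) (16, m') \<and> m' 0 = m 0 \<and> m' 1 = m 1 \<and>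
      m' 2 = real (N - j) \<and> m' 3 = real (64 + 16 * (N - j)) \<and> m' 4 = 1 \<and> m' 5 = 0 \<and> m' 6 = 16 \<and>
      (\<forall>x. 12 \<le> x \<and> x < 64 + 16 * (N - j) \<longrightarrow> m' x = m x) \<and>
      (\<forall>i\<ge>N - j. \<forall>a<15. m' (64 + 16 * i + a) = 0) \<and>
      (\<forall>i\<ge>N - j. 10 \<le> i \<longrightarrow> m' (64 + 16 * i + 15) = (if i < N then m (i + 2) else 0))"
    if "j \<le> N" for j
    using that
  proof (induction j)
    case 0
    show ?case by (intro exI[of _ m]) (auto simp: m z runs_refl)
  next
    case (Suc j)
    define c where "c = N - Suc j"
    have c: "N - j = Suc c" using Suc.prems by (simp add: c_def)
    from Suc obtain m1 where m1: "runs P (38 * j) (16, m) (16, m1)" "m1 0 = m 0" "m1 1 = m 1"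
      "m1 2 = real (Suc c)" "m1 3 = real (64 + 16 * Suc c)" "m1 4 = 1" "m1 5 = 0" "m1 6 = 16"
      "\<And>x. 12 \<le> x \<Longrightarrow> x < 64 + 16 * Suc c \<Longrightarrow> m1 x = m x"
      "\<And>i a. Suc c \<le> i \<Longrightarrow> a < 15 \<Longrightarrow> m1 (64 + 16 * i + a) = 0"
      "\<And>i. Suc c \<le> i \<Longrightarrow> 10 \<le> i \<Longrightarrow> m1 (64 + 16 * i + 15) = (if i < N then m (i + 2) else 0)"
      unfolding c by (auto simp: c[symmetric] simp del: of_nat_Suc of_nat_add of_nat_mult mult_Suc_right)
    define m2 where "m2 = fold mem_eff block_code m1"
    note be = block_eff[OF m1(4-8) m2_def]
    have r1: "runs P (Suc 0) (16, m1) (17, m1)"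
      using cd(1,2) m1 runs_refl by (intro runs_stepI) auto
    have r2: "runs P 36 (17, m1) (53, m2)"
      using runs_straight[OF cd(3) bs, of m1] by (simp add: length_prologue m2_def)
    have r3: "runs P (Suc 0) (53, m2) (16, m2)"
      using cd(4,5) be runs_refl by (intro runs_stepI) auto
    have R: "runs P (38 * Suc j) (16, m) (16, m2)"
      using runs_trans[OF runs_trans[OF runs_trans[OF m1(1) r1] r2] r3] by simp
    have A: "m2 x = m x" if "12 \<le> x" "x < 64 + 16 * c" for x using be(8)[of x] m1(9)[of x] that by simp
    have B: "m2 (64 + 16 * i + a) = 0" if "c \<le> i" "a < 15" for i a
    proof (cases "i = c")
      case True then show ?thesis using be(9) that by simp
    next
      case False
      then show ?thesis using that be(8)[of "64 + 16 * i + a"] m1(10)[of i a] by simp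
    qed
    have C: "m2 (64 + 16 * i + 15) = (if i < N then m (i + 2) else 0)" if "c \<le> i" "10 \<le> i" for i
    proof (cases "i = c")
      case True
      have "c < N" using Suc.prems by (simp add: c_def)
      then show ?thesis using True be(10) that m1(9)[of "c + 2"] by simp
    next
      case False
      then show ?thesis using that be(8)[of "64 + 16 * i + 15"] m1(11)[of i] by simp
    qed
    show ?case
      unfolding c_def[symmetric] by (intro exI[of _ m2]) (use R be m1 A B C in auto)
  qed
  obtain m1 where m1: "runs P (38 * N) (16, m) (16, m1)" "m1 0 = m 0" "m1 1 = m 1" "m1 2 = 0" "m1 5 = 0"
      "\<forall>i. \<forall>a<15. m1 (64 + 16 * i + a) = 0"
      "\<forall>i. 10 \<le> i \<longrightarrow> m1 (64 + 16 * i + 15) = (if i < N then m (i + 2) else 0)"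
    using loop[of N] by auto
  have "runs P (Suc 0) (16, m1) (54, m1)"
    using cd(1,2) m1 runs_refl by (intro runs_stepI) auto
  from runs_trans[OF m1(1) this] show ?thesis
    using that[of m1] m1 by simp
qed

lemma clear_eff: "fold mem_eff (map (\<lambda>x. Const x 0) xs) m = (\<lambda>y. if y \<in> set xs then 0 else m y)"
  by (induction xs arbitrary: m) auto

definition init_st :: "nat \<Rightarrow> nat \<Rightarrow> (nat \<Rightarrow> real) \<Rightarrow> st" where
  "init_st n k D = \<lparr>nv = (\<lambda>x. if x = 0 then n else if x = 1 then k else 0), na = (\<lambda>a i. 0), rv = (\<lambda>y. 0), ra = D\<rparr>"

lemma prologue_run:
  assumes "code_at P 0 prologue"
  obtains m' D where "runs P (38 * (n * n) + 4 * n + 76) (0, ttp_input n k d) (116, m')"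
    "rel n (init_st n k D) m'" "\<And>i. 10 \<le> i \<Longrightarrow> i < n * n \<Longrightarrow> D i = d (i div n) (i mod n)"
proof -
  have cd: "code_at P 0 square_code" "code_at P 16 spread_code" "code_at P 54 clear_code"
    using assms by (simp_all add: prologue_def length_prologue)
  have cs: "\<forall>c\<in>set clear_code. is_straight c" by (auto simp: clear_code_def is_straight_def)
  let ?m = "ttp_input n k d"
  obtain m1 where m1: "runs P (4 * n + 13) (0, ?m) (16, m1)" "\<forall>x. x < 2 \<or> 12 \<le> x \<longrightarrow> m1 x = ?m x"
    "m1 2 = real (n * n)" "m1 3 = real (64 + 16 * (n * n))" "m1 4 = 1" "m1 5 = 0" "m1 6 = 16"
    using square_run[OF cd(1), of ?m n] by (auto simp: ttp_input_def)
  have z: "m1 x = 0" if "64 + 16 * (n * n) \<le> x" for x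
    using m1(2) that by (auto simp: ttp_input_def)
  obtain m2 where m2: "runs P (38 * (n * n) + 1) (16, m1) (54, m2)" "m2 0 = m1 0" "m2 1 = m1 1"
    "\<And>i a. a < 15 \<Longrightarrow> m2 (64 + 16 * i + a) = 0"
    "\<And>i. 10 \<le> i \<Longrightarrow> m2 (64 + 16 * i + 15) = (if i < n * n then m1 (i + 2) else 0)"
    using spread_run[OF cd(2) m1(3-7) z] by blast
  define m3 where "m3 = fold mem_eff clear_code m2"
  have r3: "runs P 62 (54, m2) (116, m3)"
    unfolding m3_def using runs_straight[OF cd(3) cs, of m2] by (simp add: length_prologue)
  have m3: "m3 y = (if 2 \<le> y \<and> y < 64 then 0 else m2 y)" for y
    unfolding m3_def clear_code_def clear_eff set_upt by simp
  define D where "D i = m2 (64 + 16 * i + 15)" for i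
  have "rel n (init_st n k D) m3"
    unfolding rel_def init_st_def
  proof (intro conjI allI impI)
    fix x :: nat
    have "x = 0 \<or> x = 1 \<or> 2 \<le> x" by linarith
    then show "x < 24 \<Longrightarrow> m3 x = real (nv \<lparr>nv = (\<lambda>x. if x = 0 then n else if x = 1 then k else 0),
        na = (\<lambda>a i. 0), rv = (\<lambda>y. 0), ra = D\<rparr> x)"
      using m1(2) m2(2,3) by (auto simp: m3 ttp_input_def)
  qed (use m2 in \<open>auto simp: m3 D_def\<close>)
  moreover have "D i = d (i div n) (i mod n)" if "10 \<le> i" "i < n * n" for i
    using that m1(2) m2(5)[of i] by (simp add: D_def ttp_input_def)
  moreover have "runs P (38 * (n * n) + 4 * n + 76) (0, ?m) (116, m3)"
    using runs_trans[OF runs_trans[OF m1(1) m2(1)] r3] by (simp add: add_ac)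
  ultimately show ?thesis using that by blast
qed

subsection \<open>Writing the output\<close>

text \<open>Output entry \<open>i\<close> belongs in cells \<open>2 * i\<close> and
  \<open>2 * i + 1\<close> and is found in cells \<open>64 + 16 * i\<close> and
  \<open>65 + 16 * i\<close>; targets lie below sources, so copying upward is safe. Cells 0 to 7
  contain the working registers, so copying starts with entry 4: hence
  \<open>128 = 64 + 16 * 4\<close> and \<open>8 = 2 * 4\<close>. The increment 15 completes an
  earlier increment 1 to the stride 16.\<close>

definition copy_code :: "nat \<Rightarrow> instr list" where
  "copy_code q = [Add 5 2 2, Const 3 1, Const 4 15, Const 0 128, Const 1 8,
     JmpLe 5 1 (q + 15), Load 2 0, Store 1 2, Add 0 0 3, Add 1 1 3, Load 2 0, Store 1 2, Add 1 1 3, Add 0 0 4,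
     JmpLe 3 3 (q + 5)]"

text \<open>The last eight cells have to be filled with no register left over. Each of them first
  receives the address of its own value in the copy parked behind the table, and then loads through
  itself.\<close>

definition unstash_code :: "instr list" where
  "unstash_code = [Const 7 1, Const 6 15, Add 1 0 7, Add 2 1 6, Add 3 2 7, Add 4 3 6, Add 5 4 7, Add 6 5 6, Add 7 6 7,
     Load 0 0, Load 1 1, Load 2 2, Load 3 3, Load 4 4, Load 5 5, Load 6 6, Load 7 7]"

lemma jle_taken: "p < length P \<Longrightarrow> P ! p = JmpLe a b l \<Longrightarrow> m a \<le> m b \<Longrightarrow> runs P (Suc 0) (p, m) (l, m)"
  using runs_stepI[of p P 0 m "(l, m)"] by (simp add: runs_refl)

lemma jle_not_taken:
  "p < length P \<Longrightarrow> P ! p = JmpLe a b l \<Longrightarrow> \<not> m a \<le> m b \<Longrightarrow> q = Suc p \<Longrightarrow> runs P (Suc 0) (p, m) (q, m)"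
  using runs_stepI[of p P 0 m "(q, m)"] by (simp add: runs_refl)

lemma copy_run:
  assumes code: "code_at P q (copy_code q)" and T: "m 2 = real T" "4 \<le> T"
  obtains m' where "runs P (10 * T + 6) (q, m) (q + 15, m')" "m' 0 = real (64 + 16 * T)"
    "\<And>i. 4 \<le> i \<Longrightarrow> i < T \<Longrightarrow> m' (2 * i) = m (64 + 16 * i) \<and> m' (2 * i + 1) = m (65 + 16 * i)"
    "\<And>x. 64 + 16 * T \<le> x \<Longrightarrow> m' x = m x"
proof -
  let ?init = "[Add 5 2 2, Const 3 1, Const 4 15, Const 0 128, Const 1 8]"
  let ?body = "[Load 2 0, Store 1 2, Add 0 0 3, Add 1 1 3, Load 2 0, Store 1 2, Add 1 1 3, Add 0 0 4]"
  have cd: "code_at P q ?init" "q + 5 < length P" "P ! (q + 5) = JmpLe 5 1 (q + 15)"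
    "code_at P (q + 6) ?body" "q + 14 < length P" "P ! (q + 14) = JmpLe 3 3 (q + 5)"
    using code by (simp_all add: copy_code_def eval_nat_numeral)
  have loop: "\<exists>m'. runs P (10 * j + 5) (q, m) (q + 5, m') \<and> m' 0 = real (64 + 16 * (4 + j)) \<and> m' 1 = real (2 * (4 + j)) \<and>
      m' 3 = 1 \<and> m' 4 = 15 \<and> m' 5 = real (2 * T) \<and>
      (\<forall>i. 4 \<le> i \<and> i < 4 + j \<longrightarrow> m' (2 * i) = m (64 + 16 * i) \<and> m' (2 * i + 1) = m (65 + 16 * i)) \<and>
      (\<forall>x. 64 + 16 * (4 + j) \<le> x \<longrightarrow> m' x = m x)"
    if "4 + j \<le> T" for j
    using that
  proof (induction j)
    case 0
    define m1 where "m1 = fold mem_eff ?init m"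
    have "runs P 5 (q, m) (q + 5, m1)"
      unfolding m1_def using runs_straight[OF cd(1), of m] by (simp add: is_straight_def eval_nat_numeral)
    moreover have "m1 0 = 128" "m1 1 = 8" "m1 3 = 1" "m1 4 = 15" "m1 5 = real (2 * T)"
      "\<And>x. 64 \<le> x \<Longrightarrow> m1 x = m x"
      using T by (simp_all add: m1_def)
    ultimately show ?case by (intro exI[of _ m1]) simp
  next
    case (Suc j)
    then obtain m1 where m1: "runs P (10 * j + 5) (q, m) (q + 5, m1)" "m1 0 = real (64 + 16 * (4 + j))"
      "m1 1 = real (2 * (4 + j))" "m1 3 = 1" "m1 4 = 15" "m1 5 = real (2 * T)"
      "\<And>i. 4 \<le> i \<Longrightarrow> i < 4 + j \<Longrightarrow> m1 (2 * i) = m (64 + 16 * i) \<and> m1 (2 * i + 1) = m (65 + 16 * i)"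
      "\<And>x. 64 + 16 * (4 + j) \<le> x \<Longrightarrow> m1 x = m x" by auto
    define c where "c = 4 + j"
    have fl: "nat \<lfloor>real (64 + 16 * c)\<rfloor> = 64 + 16 * c" "nat \<lfloor>real (64 + 16 * c) + 1\<rfloor> = 65 + 16 * c"
      "nat \<lfloor>real (2 * c)\<rfloor> = 2 * c" "nat \<lfloor>real (2 * c) + 1\<rfloor> = 2 * c + 1" by linarith+
    have c8: "8 \<le> 2 * c" by (simp add: c_def)
    define m2 where "m2 = fold mem_eff ?body m1"
    have m2: "m2 = m1(2 * c := m (64 + 16 * c), 2 * c + 1 := m (65 + 16 * c), 2 := m (65 + 16 * c),
      0 := real (64 + 16 * c) + 16, 1 := real (2 * c) + 2)"
      unfolding m2_def using m1(2-5) m1(8)[of "64 + 16 * c"] m1(8)[of "65 + 16 * c"] fl c8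
      unfolding c_def[symmetric]
      by (simp add: fun_eq_iff del: of_nat_add of_nat_mult)
    have r1: "runs P (Suc 0) (q + 5, m1) (q + 6, m1)"
      by (rule jle_not_taken[OF cd(2,3)]) (use Suc.prems m1(3,6) in simp_all)
    have r2: "runs P 8 (q + 6, m1) (q + 14, m2)"
      using runs_straight[OF cd(4), of m1] by (simp add: m2_def is_straight_def eval_nat_numeral)
    have r3: "runs P (Suc 0) (q + 14, m2) (q + 5, m2)"
      by (intro jle_taken[OF cd(5,6)]) simp
    have R: "runs P (10 * Suc j + 5) (q, m) (q + 5, m2)"
      using runs_trans[OF runs_trans[OF runs_trans[OF m1(1) r1] r2] r3] by (rule runs_mono) simp
    have A: "m2 (2 * i) = m (64 + 16 * i) \<and> m2 (2 * i + 1) = m (65 + 16 * i)" if "4 \<le> i" "i < 4 + Suc j" for i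
    proof (cases "i = c")
      case True then show ?thesis using c8 by (simp add: m2)
    next
      case False
      then have "i < 4 + j" using that by (simp add: c_def)
      then have "2 * i \<noteq> 2 * c + 1" "2 * i + 1 \<noteq> 2 * c" "i \<noteq> c" by (auto simp: c_def)
      then show ?thesis using that m1(7)[of i] \<open>i < 4 + j\<close> by (simp add: m2)
    qed
    have B: "m2 x = m x" if "64 + 16 * (4 + Suc j) \<le> x" for x
      using that m1(8)[of x] by (simp add: m2 c_def)
    have C: "m2 0 = real (64 + 16 * (4 + Suc j))" "m2 1 = real (2 * (4 + Suc j))" "m2 3 = 1" "m2 4 = 15" "m2 5 = real (2 * T)"
      using c8 m1(4-6) by (simp_all add: m2 c_def)
    show ?case
      by (intro exI[of _ m2] conjI allI impI) (use R A B C in auto)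
  qed
  obtain m1 where m1: "runs P (10 * (T - 4) + 5) (q, m) (q + 5, m1)" "m1 0 = real (64 + 16 * T)" "m1 1 = real (2 * T)"
      "m1 5 = real (2 * T)"
      "\<And>i. 4 \<le> i \<Longrightarrow> i < T \<Longrightarrow> m1 (2 * i) = m (64 + 16 * i) \<and> m1 (2 * i + 1) = m (65 + 16 * i)"
      "\<And>x. 64 + 16 * T \<le> x \<Longrightarrow> m1 x = m x"
    using loop[of "T - 4"] T(2) by auto
  have "runs P (Suc 0) (q + 5, m1) (q + 15, m1)"
    by (rule jle_taken[OF cd(2,3)]) (use m1(3,4) in simp)
  from runs_trans[OF m1(1) this] have "runs P (10 * T + 6) (q, m) (q + 15, m1)"
    by (rule runs_mono) simp
  then show ?thesis using that m1 by blast
qed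

text \<open>All addresses are at least 8 and all pointer cells are below 8, so no load disturbs a
  value or a pointer that is needed later.\<close>

lemma load_self_eff:
  assumes "distinct xs" "\<And>x. x \<in> set xs \<Longrightarrow> x < 8 \<and> m x = real (f x) \<and> 8 \<le> f x"
  shows "fold mem_eff (map (\<lambda>x. Load x x) xs) m = (\<lambda>y. if y \<in> set xs then m (f y) else m y)"
  using assms
proof (induction xs arbitrary: m)
  case (Cons x xs)
  have x: "nat \<lfloor>m x\<rfloor> = f x" using Cons.prems(2)[of x] by simp
  have lt: "y \<in> set (x # xs) \<Longrightarrow> f y \<noteq> x" for y using Cons.prems(2)[of x] Cons.prems(2)[of y] by force
  have "fold mem_eff (map (\<lambda>x. Load x x) xs) (m(x := m (f x)))
     = (\<lambda>y. if y \<in> set xs then (m(x := m (f x))) (f y) else (m(x := m (f x))) y)"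
    using Cons.prems by (intro Cons.IH) auto
  then show ?case using lt Cons.prems(1) by (auto simp: x fun_eq_iff)
qed simp

lemma unstash_run:
  assumes code: "code_at P q unstash_code" and b: "m 0 = real b" "64 \<le> b"
  obtains m' where "runs P 17 (q, m) (q + 17, m')"
    "\<And>j. j < 4 \<Longrightarrow> m' (2 * j) = m (b + 16 * j) \<and> m' (2 * j + 1) = m (b + 16 * j + 1)"
    "\<And>x. 8 \<le> x \<Longrightarrow> m' x = m x"
proof -
  let ?a = "[Const 7 1, Const 6 15, Add 1 0 7, Add 2 1 6, Add 3 2 7, Add 4 3 6, Add 5 4 7, Add 6 5 6, Add 7 6 7]"
  let ?b = "[Load 0 0, Load 1 1, Load 2 2, Load 3 3, Load 4 4, Load 5 5, Load 6 6, Load 7 7]"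
  define m1 where "m1 = fold mem_eff ?a m"
  have m1: "m1 0 = real b" "m1 1 = real (b + 1)" "m1 2 = real (b + 16)" "m1 3 = real (b + 17)"
    "m1 4 = real (b + 32)" "m1 5 = real (b + 33)" "m1 6 = real (b + 48)" "m1 7 = real (b + 49)"
    "\<And>x. 8 \<le> x \<Longrightarrow> m1 x = m x"
    using b by (simp_all add: m1_def)
  define m2 where "m2 = fold mem_eff ?b m1"
  define f where "f x = b + 16 * (x div 2) + x mod 2" for x
  have lt8: "x = 0 \<or> x = 1 \<or> x = 2 \<or> x = 3 \<or> x = 4 \<or> x = 5 \<or> x = 6 \<or> x = 7" if "x < 8" for x :: nat
    using that by linarith
  have "m1 x = real (f x)" if "x < 8" for x
    using lt8[OF that] m1 by (auto simp: f_def)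
  then have "fold mem_eff (map (\<lambda>x. Load x x) [0,1,2,3,4,5,6,7]) m1 =
      (\<lambda>y. if y \<in> set [0,1,2,3,4,5,6,7] then m1 (f y) else m1 y)"
    using b by (intro load_self_eff) (auto simp: f_def)
  then have m2e: "m2 = (\<lambda>y. if y < 8 then m1 (f y) else m1 y)"
    using lt8 by (simp only: m2_def list.map) (auto simp: fun_eq_iff)
  have m2: "m2 y = m (f y)" if "y < 8" for y
    using that b m1(9)[of "f y"] by (simp add: m2e f_def)
  have m2': "m2 x = m x" if "8 \<le> x" for x using that m1(9) by (simp add: m2e)
  have "fold mem_eff unstash_code m = m2"
    by (simp only: unstash_code_def m2_def m1_def fold_append[symmetric] append.simps o_apply fold_simps)
  moreover have "runs P 17 (q, m) (q + 17, fold mem_eff unstash_code m)"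
  proof -
    have "length unstash_code = 17" "\<forall>c\<in>set unstash_code. is_straight c"
      by (simp_all add: unstash_code_def is_straight_def)
    then show ?thesis using runs_straight[OF code, of m] by simp
  qed
  moreover have "m2 (2 * j) = m (b + 16 * j) \<and> m2 (2 * j + 1) = m (b + 16 * j + 1)" if "j < 4" for j
    using m2[of "2 * j"] m2[of "2 * j + 1"] that by (simp add: f_def)
  ultimately show ?thesis using that m2' by metis
qed

definition program :: "com \<Rightarrow> instr list" where
  "program c = prologue @ compile c 0 116 @ copy_code (116 + csz c) @ unstash_code @ [Halt]"

lemma step_halted: "halted P c \<Longrightarrow> (step P ^^ t) c = c"
  by (induction t) (auto simp: step_def)

text \<open>\<open>spec\<close> asks the command to repeat the first four entries behind the end of
  the table, from where \<open>unstash_code\<close> fetches them. In the time bound, 58 is 38 for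
  spreading the matrix plus 20 for copying at most \<open>2 * n * n\<close> entries in ten steps
  each, and 99 is 76 + 6 + 17 from the three fixed pieces of code.\<close>

theorem program_correct:
  assumes wf: "cwf c" "loop_depth c \<le> 8"
    and spec: "\<And>D. (\<And>i. 10 \<le> i \<Longrightarrow> i < n * n \<Longrightarrow> D i = d (i div n) (i mod n)) \<Longrightarrow>
       (let s = exec n c (init_st n k D) in 4 \<le> nv s 2 \<and> nv s 2 \<le> 2 * n * n \<and>
         (\<forall>i<4. na s 0 (nv s 2 + i) = na s 0 i \<and> na s 1 (nv s 2 + i) = na s 1 i) \<and>
         Q (nv s 2) (na s 0) (na s 1))"
    and t: "tcost c * (n + 1) ^ loop_depth c + 58 * (n * n) + 4 * n + 99 \<le> t"
  shows "\<exists>T f g. let cfg = (step (program c) ^^ t) (0, ttp_input n k d) in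
     halted (program c) cfg \<and> Q T f g \<and>
     (\<forall>i<T. snd cfg (2 * i) = real (f i) \<and> snd cfg (2 * i + 1) = real (g i))"
proof -
  let ?P = "program c" and ?q = "116 + csz c"
  have c0: "code_at ?P 0 ?P" by (simp add: code_at_def)
  have cd: "code_at ?P 0 prologue" "code_at ?P 116 (compile c 0 116)" "code_at ?P ?q (copy_code ?q)"
    "code_at ?P (?q + 15) unstash_code" "?q + 32 < length ?P" "?P ! (?q + 32) = Halt"
    using c0 unfolding program_def code_at_append length_prologue length_comp code_at_Cons
    by (simp_all add: copy_code_def unstash_code_def length_prologue add.assoc del: code_at_Cons)
  obtain m1 D where m1: "runs ?P (38 * (n * n) + 4 * n + 76) (0, ttp_input n k d) (116, m1)"
    "rel n (init_st n k D) m1" "\<And>i. 10 \<le> i \<Longrightarrow> i < n * n \<Longrightarrow> D i = d (i div n) (i mod n)"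
    using prologue_run[OF cd(1), where n = n and k = k and d = d] by blast
  define s where "s = exec n c (init_st n k D)"
  define T where "T = nv s 2"
  have s: "4 \<le> T" "T \<le> 2 * n * n" "\<And>i. i < 4 \<Longrightarrow> na s 0 (T + i) = na s 0 i \<and> na s 1 (T + i) = na s 1 i"
    "Q T (na s 0) (na s 1)"
    using spec[of D] m1(3) unfolding s_def[symmetric] T_def Let_def by blast+
  obtain m2 where m2: "runs ?P (tcost c * (n + 1) ^ loop_depth c) (116, m1) (?q, m2)" "rel n s m2"
    using comp_correct[OF cd(2) wf(1) _ m1(2)] wf(2) unfolding simulates_def s_def by auto
  have m2v: "m2 2 = real T" "\<And>i. m2 (64 + 16 * i) = real (na s 0 i)" "\<And>i. m2 (65 + 16 * i) = real (na s 1 i)"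
  proof -
    show "m2 2 = real T" using m2(2) by (simp add: rel_def T_def)
    have "\<And>a i. a < 15 \<Longrightarrow> m2 (64 + 16 * i + a) = real (na s a i)" using m2(2) by (simp add: rel_def)
    from this[of 0] this[of 1]
    show "\<And>i. m2 (64 + 16 * i) = real (na s 0 i)" "\<And>i. m2 (65 + 16 * i) = real (na s 1 i)" by simp_all
  qed
  obtain m3 where m3: "runs ?P (10 * T + 6) (?q, m2) (?q + 15, m3)" "m3 0 = real (64 + 16 * T)"
    "\<And>i. 4 \<le> i \<Longrightarrow> i < T \<Longrightarrow> m3 (2 * i) = m2 (64 + 16 * i) \<and> m3 (2 * i + 1) = m2 (65 + 16 * i)"
    "\<And>x. 64 + 16 * T \<le> x \<Longrightarrow> m3 x = m2 x"
    using copy_run[where m = m2 and T = T, OF cd(3) m2v(1) s(1)] by metis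
  obtain m4 where m4: "runs ?P 17 (?q + 15, m3) (?q + 15 + 17, m4)"
    "\<And>j. j < 4 \<Longrightarrow> m4 (2 * j) = m3 (64 + 16 * T + 16 * j) \<and> m4 (2 * j + 1) = m3 (64 + 16 * T + 16 * j + 1)"
    "\<And>x. 8 \<le> x \<Longrightarrow> m4 x = m3 x"
    using unstash_run[where m = m3 and b = "64 + 16 * T", OF cd(4) m3(2)] by auto
  have out: "m4 (2 * i) = real (na s 0 i) \<and> m4 (2 * i + 1) = real (na s 1 i)" if "i < T" for i
  proof (cases "i < 4")
    case True
    then show ?thesis
      using m4(2)[OF True] m3(4)[of "64 + 16 * T + 16 * i"] m3(4)[of "64 + 16 * T + 16 * i + 1"]
        m2v(2)[of "T + i"] m2v(3)[of "T + i"] s(3)[OF True] by (simp add: algebra_simps)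
  next
    case False
    then show ?thesis using m4(3)[of "2 * i"] m4(3)[of "2 * i + 1"] m3(3)[of i] that m2v by simp
  qed
  have "38 * (n * n) + 4 * n + 76 + tcost c * (n + 1) ^ loop_depth c + (10 * T + 6) + 17 \<le> t"
    using t s(2) by (simp add: algebra_simps)
  from runs_mono[OF runs_trans[OF runs_trans[OF runs_trans[OF m1(1) m2(1)] m3(1)] m4(1)] this]
  have "runs ?P t (0, ttp_input n k d) (?q + 32, m4)" by (simp add: add.assoc)
  then obtain t' where t': "t' \<le> t" "(step ?P ^^ t') (0, ttp_input n k d) = (?q + 32, m4)"
    unfolding runs_def by auto
  have h: "halted ?P (?q + 32, m4)" using cd(6) by (simp add: halted_def)
  have "(step ?P ^^ t) (0, ttp_input n k d) = (step ?P ^^ (t - t')) ((step ?P ^^ t') (0, ttp_input n k d))"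
    using t'(1) by (simp only: funpow_add[symmetric, THEN fun_cong, unfolded o_apply]) simp
  then have "(step ?P ^^ t) (0, ttp_input n k d) = (?q + 32, m4)"
    using step_halted[OF h] t'(2) by simp
  then show ?thesis using h s(4) out unfolding Let_def by (metis snd_conv)
qed

section \<open>The circle method\<close>

text \<open>This is \<open>t - i\<close> modulo \<open>N\<close> without negative numbers:
  \<open>i\<close> and \<open>j\<close> meet on day \<open>t\<close> when \<open>i + j\<close> is
  congruent to \<open>t\<close>.\<close>

definition cj :: "nat \<Rightarrow> nat \<Rightarrow> nat \<Rightarrow> nat" where
  "cj N t i = (t + (N - i)) mod N"

text \<open>One half of \<open>t\<close> modulo the odd number \<open>N\<close>: the only label that
  \<open>cj\<close> pairs with itself. It lies on the axis and plays the special label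
  \<open>N\<close>.\<close>

definition mid :: "nat \<Rightarrow> nat \<Rightarrow> nat" where
  "mid N t = (if even (t mod N) then t mod N div 2 else (t mod N + N) div 2)"

definition copp :: "nat \<Rightarrow> nat \<Rightarrow> nat \<Rightarrow> nat" where
  "copp N t i = (if i = N then mid N t else if cj N t i = i then N else cj N t i)"

text \<open>\<open>w t i\<close> is to be read as: label \<open>i\<close> is away on day
  \<open>t\<close>. Orientations are thus given for ordinary labels only; the special label takes
  the opposite role of its opponent on the axis.\<close>

definition chome :: "nat \<Rightarrow> (nat \<Rightarrow> nat \<Rightarrow> bool) \<Rightarrow> nat \<Rightarrow> nat \<Rightarrow> bool" where
  "chome N w t i = (if i = N then w t (mid N t) else \<not> w t i)"

lemma mod_lt_double: "x < 2 * N \<Longrightarrow> x mod N = (if x < N then x else x - N)" for x N :: nat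
  by (auto simp: le_mod_geq)

lemma cj_alt: "i < N \<Longrightarrow> cj N t i = (if i \<le> t mod N then t mod N - i else t mod N + N - i)"
proof -
  assume i: "i < N"
  have "cj N t i = (t mod N + (N - i)) mod N" by (simp add: cj_def mod_add_left_eq)
  moreover have "t mod N < N" using i by simp
  ultimately show ?thesis using i
    by (auto simp: mod_lt_double)
qed

lemma cj_less: "i < N \<Longrightarrow> cj N t i < N"
  by (simp add: cj_def)

lemma cj_invol: "i < N \<Longrightarrow> cj N t (cj N t i) = i"
proof -
  assume i: "i < N"
  have "t mod N < N" using i by simp
  then show ?thesis
    using i cj_less[OF i, of t] cj_alt[OF i, of t] cj_alt[of "cj N t i" N t] by (auto split: if_splits)
qed

lemma mod_add_small: "i < N \<Longrightarrow> j < N \<Longrightarrow> (i + j) mod N = (if i + j < N then i + j else i + j - N)" for i j N :: nat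
  by (auto simp: le_mod_geq)

lemma cj_eq_iff: "i < N \<Longrightarrow> j < N \<Longrightarrow> cj N t i = j \<longleftrightarrow> t mod N = (i + j) mod N"
proof -
  assume a: "i < N" "j < N"
  have "t mod N < N" using a by simp
  then show ?thesis using a by (auto simp: cj_alt mod_add_small)
qed

lemma cj_mod: "cj N (t mod N) i = cj N t i"
  by (simp add: cj_def mod_add_left_eq)

lemma mid_less: "0 < N \<Longrightarrow> mid N t < N"
proof -
  assume "0 < N"
  then have "t mod N < N" by simp
  then show ?thesis by (auto simp: mid_def)
qed

lemma cj_self_iff: "odd N \<Longrightarrow> i < N \<Longrightarrow> cj N t i = i \<longleftrightarrow> i = mid N t"
proof -
  assume a: "odd N" "i < N"
  have l: "t mod N < N" using a by simp
  have "cj N t i = i \<longleftrightarrow> t mod N = (if i + i < N then i + i else i + i - N)"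
    using cj_eq_iff[OF a(2) a(2)] mod_add_small[OF a(2) a(2)] by simp
  also have "\<dots> \<longleftrightarrow> i = mid N t"
  proof (cases "even (t mod N)")
    case True
    then obtain h where h: "t mod N = 2 * h" by blast
    have "mid N t = h" using h by (simp add: mid_def)
    moreover have "2 * h \<noteq> i + i - N" if "N \<le> i + i" using a(1) that by presburger
    ultimately show ?thesis using a l h by auto
  next
    case False
    then obtain h where h: "t mod N = 2 * h + 1" by (rule oddE)
    obtain g where g: "N = 2 * g + 1" using a(1) by (rule oddE)
    have "mid N t = h + g + 1" using h g by (simp add: mid_def)
    moreover have "2 * h + 1 \<noteq> i + i" by presburger
    ultimately show ?thesis using a l h g by auto
  qed
  finally show ?thesis .
qed

definition meet :: "nat \<Rightarrow> nat \<Rightarrow> nat \<Rightarrow> nat" where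
  "meet N i j = (if i = N then (j + j) mod N else if j = N then (i + i) mod N else (i + j) mod N)"

lemma copp_eq_iff:
  assumes "odd N" "i \<le> N" "j \<le> N" "i \<noteq> j"
  shows "copp N t i = j \<longleftrightarrow> t mod N = meet N i j"
proof (cases "i = N \<or> j = N")
  case False
  then show ?thesis using assms cj_eq_iff[of i N j t] by (auto simp: copp_def meet_def)
next
  case True
  have m: "(x = mid N t) = (t mod N = (x + x) mod N)" "(cj N t x = x) = (x = mid N t)" "cj N t x < N" if "x < N" for x
    using cj_eq_iff[OF that that] cj_self_iff[OF assms(1) that] cj_less[OF that] by auto
  show ?thesis
  proof (cases "i = N")
    case True
    then show ?thesis using m(1)[of j] assms by (auto simp: copp_def meet_def)
  next
    case False
    then have "i < N" "j = N" using assms \<open>i = N \<or> j = N\<close> by auto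
    then show ?thesis using m[of i] by (auto simp: copp_def meet_def)
  qed
qed

lemma copp_less: "odd N \<Longrightarrow> i \<le> N \<Longrightarrow> copp N t i \<le> N \<and> copp N t i \<noteq> i"
  using mid_less[of N t] cj_less[of i N t] by (auto simp: copp_def odd_pos)

lemma copp_invol:
  assumes "odd N" "i \<le> N" shows "copp N t (copp N t i) = i"
proof -
  let ?j = "copp N t i"
  have j: "?j \<le> N" "?j \<noteq> i" using copp_less[OF assms, of t] by auto
  have "t mod N = meet N i ?j" using copp_eq_iff[OF assms j(1) j(2)[symmetric]] by blast
  then have "t mod N = meet N ?j i" by (simp add: meet_def add.commute)
  then show ?thesis using copp_eq_iff[OF assms(1) j(1) assms(2) j(2)] by simp
qed

lemma two_rounds: "{t. t < 2 * N \<and> t mod N = \<mu>} = {\<mu>, \<mu> + N}" if "\<mu> < N" for N \<mu> :: nat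
proof -
  have "t mod N = (if t < N then t else t - N)" if "t < 2 * N" for t
    using that \<open>\<mu> < N\<close> by (auto simp: mod_lt_double)
  then show ?thesis using that by (auto split: if_splits)
qed

text \<open>Each pair meets once in either half and \<open>w2\<close> reverses the venue, so every
  ordered pair occurs once. Consecutive days have different residues modulo \<open>N\<close>, also
  where the halves join, which excludes repeats. The assumption \<open>runs\<close> puts a change
  between home and away into every window of \<open>k + 1\<close> days.\<close>

theorem circle_feasible:
  assumes N: "odd N" "3 \<le> N" and k: "1 \<le> k"
    and w1: "\<And>t i. t < 2 * N \<Longrightarrow> i < N \<Longrightarrow> cj N t i \<noteq> i \<Longrightarrow> w t (cj N t i) = (\<not> w t i)"
    and w2: "\<And>t i. t < N \<Longrightarrow> i < N \<Longrightarrow> w (t + N) i = (\<not> w t i)"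
    and runs: "\<And>i a. i \<le> N \<Longrightarrow> a + k < 2 * N \<Longrightarrow> \<exists>t\<in>{a..<a + k}. chome N w (Suc t) i \<noteq> chome N w t i"
  shows "ttp_feasible (Suc N) k (copp N, chome N w)"
proof -
  have D: "num_days (Suc N) = 2 * N" by (simp add: num_days_def)
  have mN: "mid N t < N" for t using mid_less N by simp
  have home_opp: "chome N w t (copp N t i) = (\<not> chome N w t i)" if "t < 2 * N" "i \<le> N" for t i
  proof (cases "i = N")
    case True then show ?thesis using mN[of t] by (simp add: copp_def chome_def)
  next
    case False
    then have i: "i < N" using that by simp
    show ?thesis
    proof (cases "cj N t i = i")
      case True
      then have "i = mid N t" using cj_self_iff[OF N(1) i] by simp
      then show ?thesis using True False by (simp add: copp_def chome_def)
    next
      case nf: False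
      then show ?thesis using False w1[OF that(1) i nf] cj_less[OF i, of t] by (simp add: copp_def chome_def)
    qed
  qed
  have mid_shift: "mid N (t + N) = mid N t" for t by (simp add: mid_def)
  have home_shift: "chome N w (t + N) i = (\<not> chome N w t i)" if "t < N" "i \<le> N" for t i
    using that w2[OF that(1), of i] w2[OF that(1) mN[of t]] by (auto simp: chome_def mid_shift)
  have rr: "card {t. t < 2 * N \<and> copp N t i = j \<and> chome N w t j} = 1" if "i \<le> N" "j \<le> N" "i \<noteq> j" for i j
  proof -
    let ?\<mu> = "meet N i j"
    have \<mu>: "?\<mu> < N" using N by (simp add: meet_def)
    have "{t. t < 2 * N \<and> copp N t i = j \<and> chome N w t j} = {t \<in> {?\<mu>, ?\<mu> + N}. chome N w t j}"
      unfolding two_rounds[OF \<mu>, symmetric] using copp_eq_iff[OF N(1) that] by auto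
    also have "\<dots> = (if chome N w ?\<mu> j then {?\<mu>} else {?\<mu> + N})"
      using home_shift[OF \<mu> that(2)] by auto
    finally show ?thesis by (simp split: if_splits)
  qed
  have norep: "copp N (Suc t) i \<noteq> copp N t i" if "i \<le> N" for t i
  proof
    assume e: "copp N (Suc t) i = copp N t i"
    have j: "copp N t i \<le> N" "i \<noteq> copp N t i" using copp_less[OF N(1) that, of t] by auto
    have "Suc t mod N = t mod N"
      using copp_eq_iff[OF N(1) that j, of t] e copp_eq_iff[OF N(1) that j, of "Suc t"] by metis
    then show False using N(2) by (auto simp: mod_Suc split: if_splits)
  qed
  have bnd: "\<not> (\<forall>t\<in>{a..a + k}. chome N w t i) \<and> \<not> (\<forall>t\<in>{a..a + k}. \<not> chome N w t i)"
    if ia: "i \<le> N" "a + k < 2 * N" for i a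
  proof -
    obtain t where t: "a \<le> t" "t < a + k" "chome N w (Suc t) i \<noteq> chome N w t i"
      using runs[OF ia] unfolding Bex_def atLeastLessThan_iff by blast
    then have "t \<in> {a..a + k}" "Suc t \<in> {a..a + k}" by auto
    then show ?thesis using t(3) by blast
  qed
  show ?thesis
    unfolding ttp_feasible_def Let_def D fst_conv snd_conv less_Suc_eq_le
  proof (intro conjI)
    show "\<forall>t<2 * N. \<forall>i\<le>N. copp N t i \<le> N \<and> copp N t i \<noteq> i \<and> copp N t (copp N t i) = i \<and>
        chome N w t (copp N t i) = (\<not> chome N w t i)"
      using copp_less[OF N(1)] copp_invol[OF N(1)] home_opp by simp
    show "\<forall>i\<le>N. \<forall>j\<le>N. i \<noteq> j \<longrightarrow> card {t. t < 2 * N \<and> copp N t i = j \<and> chome N w t j} = 1"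
      using rr by simp
    show "\<forall>t. Suc t < 2 * N \<longrightarrow> (\<forall>i\<le>N. copp N (Suc t) i \<noteq> copp N t i)"
      using norep by simp
    show "\<forall>i\<le>N. \<forall>a. a + k < 2 * N \<longrightarrow>
        \<not> (\<forall>t\<in>{a..a + k}. chome N w t i) \<and> \<not> (\<forall>t\<in>{a..a + k}. \<not> chome N w t i)"
      using bnd by simp
  qed
qed

lemma ttp_feasible_mono:
  assumes "ttp_feasible n k s" "k \<le> k'"
  shows "ttp_feasible n k' s"
proof -
  have sub: "{a..a + k} \<subseteq> {a..a + k'}" "a + k' < num_days n \<Longrightarrow> a + k < num_days n" for a
    using assms(2) by auto
  have bnd: "\<forall>i<n. \<forall>a. a + k < num_days n \<longrightarrow>
      \<not> (\<forall>t\<in>{a..a + k}. snd s t i) \<and> \<not> (\<forall>t\<in>{a..a + k}. \<not> snd s t i)"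
    using assms(1) unfolding ttp_feasible_def Let_def by blast
  have "\<not> (\<forall>t\<in>{a..a + k'}. snd s t i) \<and> \<not> (\<forall>t\<in>{a..a + k'}. \<not> snd s t i)"
    if "i < n" "a + k' < num_days n" for i a
    using bnd[rule_format, OF that(1) sub(2)[OF that(2)]] sub(1)[of a] by (meson subsetD)
  then have "\<forall>i<n. \<forall>a. a + k' < num_days n \<longrightarrow>
      \<not> (\<forall>t\<in>{a..a + k'}. snd s t i) \<and> \<not> (\<forall>t\<in>{a..a + k'}. \<not> snd s t i)" by blast
  with assms(1) show ?thesis unfolding ttp_feasible_def Let_def by (elim conjE, intro conjI) assumption+
qed

subsection \<open>Orientations\<close>

text \<open>The phase \<open>t - 2 * i\<close> modulo \<open>2 * N\<close>. Modulo \<open>N\<close>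
  it is \<open>j - i\<close> for the opponent \<open>j\<close> of \<open>i\<close>; it grows by one
  each day, and off the axis opponents have opposite phases. Phases 0 and \<open>N\<close> mean
  being on the axis. Working modulo \<open>2 * N\<close> gives the label a side (phase below or
  above \<open>N\<close>) that is exchanged after \<open>N\<close> days.\<close>

definition ee :: "nat \<Rightarrow> nat \<Rightarrow> nat \<Rightarrow> nat" where
  "ee N t i = (t + 2 * (N - i)) mod (2 * N)"

lemma ee_alt: "i < N \<Longrightarrow> t < 2 * N \<Longrightarrow> ee N t i = (if 2 * i \<le> t then t - 2 * i else t + 2 * N - 2 * i)"
proof -
  assume a: "i < N" "t < 2 * N"
  have "ee N t i = (if t + 2 * (N - i) < 2 * N then t + 2 * (N - i) else t + 2 * (N - i) - 2 * N)"
    unfolding ee_def using a by (intro mod_lt_double) auto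
  then show ?thesis using a by (auto simp: diff_mult_distrib2)
qed

lemma ee_less: "0 < N \<Longrightarrow> ee N t i < 2 * N"
  by (simp add: ee_def)

lemma ee_mid: "odd N \<Longrightarrow> t < 2 * N \<Longrightarrow> ee N t (mid N t) = (if even t then 0 else N)"
proof -
  assume a: "odd N" "t < 2 * N"
  have t: "t mod N = (if t < N then t else t - N)" using a(2) by (auto simp: mod_lt_double)
  have "mid N t < N" using mid_less odd_pos[OF a(1)] by simp
  then show ?thesis using a
    by (auto simp: ee_alt mid_def t elim!: evenE oddE split: if_splits)
qed

lemma ee_Suc: "0 < N \<Longrightarrow> ee N (Suc t) i = (if ee N t i = 2 * N - 1 then 0 else Suc (ee N t i))"
  by (auto simp: ee_def mod_Suc)

lemma ee_cross: "odd N \<Longrightarrow> i < N \<Longrightarrow> t < 2 * N \<Longrightarrow> (ee N t i = 0 \<or> ee N t i = N) \<longleftrightarrow> cj N t i = i"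
proof -
  assume a: "odd N" "i < N" "t < 2 * N"
  have t: "t mod N = (if t < N then t else t - N)" using a by (auto simp: mod_lt_double)
  show ?thesis
    unfolding cj_eq_iff[OF a(2) a(2)] using a mod_add_small[OF a(2) a(2)] by (auto simp: ee_alt t)
qed

text \<open>The phases \<open>e\<close> and \<open>f\<close> of opponents add up to a multiple of
  \<open>2 * N\<close> strictly between 0 and \<open>4 * N\<close>; so the sum is
  \<open>2 * N\<close>.\<close>

lemma ee_opp_arith:
 fixes e f i J t N :: nat
 assumes "J + i = t \<or> J + i = t + N \<or> J + i + N = t"
 "e + 2 * i = t \<or> e + 2 * i = t + 2 * N" "f + 2 * J = t \<or> f + 2 * J = t + 2 * N"
    "e < 2 * N" "f < 2 * N" "e \<noteq> 0"
 shows "f + e = 2 * N"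
proof -
 have "0 < e" using assms(6) by simp
 then have "0 < e + f" "e + f < 4 * N" using assms by linarith+
 show ?thesis
  using assms(1)
 proof (elim disjE)
   assume a: "J + i = t"
   then have "2 * J + 2 * i = 2 * t" by simp
   then show ?thesis using assms(2,3,4,5) \<open>0 < e+f\<close> by (elim disjE) linarith+
 next
   assume a: "J + i = t + N"
   then have "2 * J + 2 * i = 2 * t + 2 * N" by simp
   then show ?thesis using assms(2,3,4,5) \<open>0 < e+f\<close> by (elim disjE) linarith+
 next
   assume a: "J + i + N = t"
   then have "2 * J + 2 * i + 2 * N = 2 * t" by simp
   then show ?thesis using assms(2,3,4,5) \<open>0 < e+f\<close> by (elim disjE) linarith+
 qed
qed

lemma ee_opp:
  assumes "odd N" "i < N" "t < 2 * N" "cj N t i \<noteq> i"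
  shows "ee N t (cj N t i) = 2 * N - ee N t i" "ee N t i \<noteq> 0" "ee N t i \<noteq> N"
proof -
  have t: "t mod N = (if t < N then t else t - N)" using assms by (auto simp: mod_lt_double)
  let ?j = "cj N t i"
  show n: "ee N t i \<noteq> 0" "ee N t i \<noteq> N" using ee_cross[OF assms(1-3)] assms(4) by auto
  obtain J where J: "J = ?j" by blast
  have j: "J < N" unfolding J using cj_less assms(2) by auto
  have "J + i = t \<or> J + i = t + N \<or> J + i + N = t"
    using cj_alt[OF assms(2), of t] unfolding J[symmetric] t using assms(2) by (auto split: if_splits)
  moreover have "ee N t i + 2 * i = t \<or> ee N t i + 2 * i = t + 2 * N" "ee N t J + 2 * J = t \<or> ee N t J + 2 * J = t + 2 * N"
    "ee N t i < 2 * N" "ee N t J < 2 * N"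
    using assms(2,3) j by (auto simp: ee_alt)
  ultimately have "ee N t J + ee N t i = 2 * N"
    using n(1) by (intro ee_opp_arith[of J i t N])
  then have "ee N t J = 2 * N - ee N t i" by simp
  then show "ee N t ?j = 2 * N - ee N t i" by (simp only: J)
qed

lemma ee_shift: "i < N \<Longrightarrow> t < N \<Longrightarrow> ee N (t + N) i = (if ee N t i < N then ee N t i + N else ee N t i - N)"
  by (auto simp: ee_alt)

text \<open>Home and away alternate daily, except for a slip when the phase modulo \<open>N\<close>
  enters the upper half or returns to 0. Opponents have phases adding up to \<open>N\<close> modulo
  \<open>N\<close>, hence in different halves off the axis. Since \<open>N\<close> is odd, day
  \<open>t + N\<close> has the other parity but the same phase modulo \<open>N\<close>, so it is the
  mirror image.\<close>

definition alt_orient :: "nat \<Rightarrow> nat \<Rightarrow> nat \<Rightarrow> bool" where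
  "alt_orient N t i \<longleftrightarrow> (odd t \<noteq> ((N - 1) div 2 < ee N t i mod N))"

text \<open>From \<open>N = 5\<close> on, the two kinds of slip never happen on adjacent
  transitions, so no run exceeds two games. For \<open>N = 3\<close> they are adjacent and give a
  run of three. The special label sees only axis phases, which are 0 modulo \<open>N\<close>, and
  alternates strictly.\<close>

lemma alt_feasible:
  assumes "odd N" "5 \<le> N" "2 \<le> k"
  shows "ttp_feasible (Suc N) k (copp N, chome N (alt_orient N))"
proof -
  have "ttp_feasible (Suc N) 2 (copp N, chome N (alt_orient N))"
  proof (rule circle_feasible)
    fix t i assume a: "t < 2 * N" "i < N" "cj N t i \<noteq> i"
    note o = ee_opp[OF assms(1) a(2,1,3)]
    have l: "ee N t i < 2 * N" using ee_less assms by simp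
    obtain h where h: "N = 2 * h + 1" using assms(1) by (rule oddE)
    have "ee N t i mod N = (if ee N t i < N then ee N t i else ee N t i - N)"
      using l by (auto simp: mod_lt_double)
    moreover have "(2 * N - ee N t i) mod N = (if ee N t i < N then N - ee N t i else 2 * N - ee N t i)"
      using l o(2,3) by (auto simp: mod_lt_double)
    ultimately show "alt_orient N t (cj N t i) = (\<not> alt_orient N t i)"
      unfolding alt_orient_def o(1) using o(2,3) l h by auto
  next
    fix t i assume a: "t < N" "i < N"
    have "ee N (t + N) i mod N = ee N t i mod N"
      using ee_less[of N t i] a by (auto simp: ee_shift[OF a(2,1)] le_mod_geq)
    then show "alt_orient N (t + N) i = (\<not> alt_orient N t i)"
      using assms(1) by (simp add: alt_orient_def)
  next
    fix i a assume a: "i \<le> N" "a + 2 < 2 * N"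
    have "chome N (alt_orient N) (Suc a) i \<noteq> chome N (alt_orient N) a i \<or>
      chome N (alt_orient N) (Suc (Suc a)) i \<noteq> chome N (alt_orient N) (Suc a) i"
    proof (cases "i = N")
      case True
      have "ee N t (mid N t) mod N = 0" if "t < 2 * N" for t using ee_mid[OF assms(1) that] by simp
      from this[of a] this[of "Suc a"] show ?thesis using a True by (simp add: chome_def alt_orient_def)
    next
      case False
      obtain h where h: "N = 2 * h + 1" using assms(1) by (rule oddE)
      define x where "x = ee N a i mod N"
      have S: "ee N (Suc t) i mod N = (if ee N t i mod N = N - 1 then 0 else Suc (ee N t i mod N))"
        if "Suc t < 2 * N" for t
        using ee_Suc[of N t i] ee_less[of N t i] False a(1) that assms(2) by (auto simp: mod_Suc mod_lt_double)
      have "x < N" using assms by (simp add: x_def)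
      moreover have "ee N (Suc a) i mod N = (if x = N - 1 then 0 else Suc x)"
        using S[of a] a by (simp add: x_def)
      moreover from this have "ee N (Suc (Suc a)) i mod N
         = (if (if x = N - 1 then 0 else Suc x) = N - 1 then 0 else Suc (if x = N - 1 then 0 else Suc x))"
        using S[of "Suc a"] a by simp
      ultimately show ?thesis using assms(2) h False
        unfolding chome_def alt_orient_def x_def[symmetric] by auto
    qed
    then show "\<exists>t\<in>{a..<a + 2}. chome N (alt_orient N) (Suc t) i \<noteq> chome N (alt_orient N) t i"
      by (auto simp: numeral_2_eq_2)
  qed (use assms in auto)
  then show ?thesis using ttp_feasible_mono assms(3) by blast
qed

text \<open>With \<open>B\<close> the set of first days of blocks, this toggles at every block
  start; for \<open>0 \<in> B\<close> it is false throughout the first block.\<close>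

definition bt :: "nat set \<Rightarrow> nat \<Rightarrow> bool" where
  "bt B t \<longleftrightarrow> even (card (B \<inter> {..t}))"

text \<open>The side of the axis, flipped from block to block. The last conjunction repairs one
  coincidence: a label reaching the axis on a block start would change side and block parity
  together and so keep its role. Its change of side is postponed by a day.\<close>

definition blk_orient :: "nat \<Rightarrow> nat set \<Rightarrow> nat \<Rightarrow> nat \<Rightarrow> bool" where
  "blk_orient N B t i \<longleftrightarrow> ((ee N t i < N) \<noteq> bt B (t mod N)) \<noteq> (t mod N \<in> B \<and> (ee N t i = 0 \<or> ee N t i = N))"

lemma bt_0: "0 \<in> B \<Longrightarrow> \<not> bt B 0"
proof -
  assume "0 \<in> B"
  then have "B \<inter> {..0} = {0}" by auto
  then show ?thesis by (simp add: bt_def)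
qed

lemma bt_Suc: "bt B (Suc t) = (bt B t \<noteq> (Suc t \<in> B))"
proof (cases "Suc t \<in> B")
  case True
  then have "B \<inter> {..Suc t} = insert (Suc t) (B \<inter> {..t})" by (auto simp: le_Suc_eq)
  then show ?thesis using True by (simp add: bt_def)
next
  case False
  then have "B \<inter> {..Suc t} = B \<inter> {..t}" by (auto simp: le_Suc_eq)
  then show ?thesis using False by (simp add: bt_def)
qed

text \<open>An even number of blocks makes the parity toggle at residue 0 too, where the second half
  starts. \<open>isolated\<close> says that blocks have at least two days, so that a postponed
  change of side is over before the next block begins. \<open>dense\<close> bounds the block lengths
  by \<open>k\<close>, read cyclically.\<close>

locale blocks =
  fixes N k :: nat and B :: "nat set"
  assumes N: "odd N" "3 \<le> N" and k: "2 \<le> k"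
    and B: "B \<subseteq> {..<N}" "0 \<in> B" "even (card B)"
    and isolated: "\<And>t. Suc t mod N \<in> B \<Longrightarrow> t mod N \<notin> B"
    and dense: "\<And>a. \<exists>b. a < b \<and> b \<le> a + k \<and> b mod N \<in> B"
begin

lemma bt_flip: "Suc t mod N \<in> B \<Longrightarrow> bt B (Suc t mod N) = (\<not> bt B (t mod N))"
proof (cases "Suc (t mod N) = N")
  case True
  have "B \<inter> {..t mod N} = B" using B(1) True by (metis Int_absorb2 lessThan_Suc_atMost)
  then have "bt B (t mod N)" using B(3) by (simp add: bt_def)
  then show ?thesis using True bt_0[OF B(2)] by (simp add: mod_Suc)
next
  case False
  then show "Suc t mod N \<in> B \<Longrightarrow> ?thesis" by (simp add: mod_Suc bt_Suc)
qed

lemma bt_keep: "Suc t mod N \<notin> B \<Longrightarrow> bt B (Suc t mod N) = bt B (t mod N)"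
proof (cases "Suc (t mod N) = N")
  case True
  then show "Suc t mod N \<notin> B \<Longrightarrow> ?thesis" using B(2) by (simp add: mod_Suc)
next
  case False
  then show "Suc t mod N \<notin> B \<Longrightarrow> ?thesis" by (simp add: mod_Suc bt_Suc)
qed

text \<open>Off the axis only the block parity changes. On the axis side, parity and correction all
  change, which is again an odd number of flips.\<close>

lemma orient_flip:
  assumes "Suc t < 2 * N" "i < N" "Suc t mod N \<in> B"
  shows "blk_orient N B (Suc t) i = (\<not> blk_orient N B t i)"
proof -
  have l: "ee N t i < 2 * N" using ee_less N by simp
  have S: "ee N (Suc t) i = (if ee N t i = 2 * N - 1 then 0 else Suc (ee N t i))"
    using ee_Suc N by simp
  show ?thesis
    unfolding blk_orient_def bt_flip[OF assms(3)] S
    using assms(3) isolated[OF assms(3)] l N(2) by auto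
qed

text \<open>The side changes only when the phase passes 0 or \<open>N\<close>, that is on the axis,
  and the correction applies only there.\<close>

lemma orient_keep:
  assumes "Suc t < 2 * N" "i < N" "Suc t mod N \<notin> B" "cj N t i \<noteq> i" "cj N (Suc t) i \<noteq> i"
  shows "blk_orient N B (Suc t) i = blk_orient N B t i"
proof -
  have l: "ee N t i < 2 * N" using ee_less N by simp
  have S: "ee N (Suc t) i = (if ee N t i = 2 * N - 1 then 0 else Suc (ee N t i))"
    using ee_Suc N by simp
  have "ee N t i \<noteq> 0" "ee N t i \<noteq> N" "ee N (Suc t) i \<noteq> 0" "ee N (Suc t) i \<noteq> N"
    using ee_cross[OF N(1) assms(2), of t] ee_cross[OF N(1) assms(2), of "Suc t"] assms by auto
  then show ?thesis
    unfolding blk_orient_def bt_keep[OF assms(3)] using S l by (auto split: if_splits)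
qed

lemma orient_opp:
  assumes "t < 2 * N" "i < N" "cj N t i \<noteq> i"
  shows "blk_orient N B t (cj N t i) = (\<not> blk_orient N B t i)"
proof -
  note o = ee_opp[OF N(1) assms(2,1,3)]
  have "ee N t i < 2 * N" using ee_less N by simp
  then show ?thesis unfolding blk_orient_def o(1) using o(2,3) by auto
qed

lemma orient_shift:
  assumes "t < N" "i < N"
  shows "blk_orient N B (t + N) i = (\<not> blk_orient N B t i)"
proof -
  have "ee N t i < 2 * N" using ee_less N by simp
  then show ?thesis unfolding blk_orient_def ee_shift[OF assms(2,1)] by auto
qed

lemma home_flip:
  assumes "Suc t < 2 * N" "i \<le> N" "Suc t mod N \<in> B"
  shows "chome N (blk_orient N B) (Suc t) i \<noteq> chome N (blk_orient N B) t i"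
proof (cases "i = N")
  case False
  then show ?thesis using orient_flip[of t i] assms by (simp add: chome_def)
next
  case True
  \<comment> \<open>The phase on the axis alternates between 0 and \<open>N\<close>, so the special
    label changes side every day. At a block start, parity and correction change as well, which
    leaves one net flip.\<close>
  have "ee N t (mid N t) = (if even t then 0 else N)" "ee N (Suc t) (mid N (Suc t)) = (if even (Suc t) then 0 else N)"
    using ee_mid[OF N(1)] assms by auto
  then show ?thesis
    unfolding chome_def blk_orient_def using True bt_flip[OF assms(3)] assms(3) isolated[OF assms(3)] N(2)
    by auto
qed

theorem blocks_feasible: "ttp_feasible (Suc N) k (copp N, chome N (blk_orient N B))"
proof (rule circle_feasible)
  fix i a assume a: "i \<le> N" "a + k < 2 * N"
  obtain b where b: "a < b" "b \<le> a + k" "b mod N \<in> B" using dense by blast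
  then obtain t where t: "b = Suc t" by (cases b) auto
  then show "\<exists>t\<in>{a..<a + k}. chome N (blk_orient N B) (Suc t) i \<noteq> chome N (blk_orient N B) t i"
    using home_flip[of t i] a b by (intro bexI[of _ t]) auto
qed (use N k orient_opp orient_shift in auto)

end

subsection \<open>Relabelling\<close>

text \<open>Schedules are total functions, so only days and teams in range are compared. With
  \<open>\<tau> = id\<close> this says that two schedules agree wherever it matters.\<close>

definition relabels :: "nat \<Rightarrow> (nat \<Rightarrow> nat) \<Rightarrow> schedule \<Rightarrow> schedule \<Rightarrow> bool" where
  "relabels n \<tau> s s' \<longleftrightarrow> bij_betw \<tau> {..<n} {..<n} \<and>
     (\<forall>t<num_days n. \<forall>i<n. fst s' t (\<tau> i) = \<tau> (fst s t i) \<and> snd s' t (\<tau> i) = snd s t i)"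

lemma relabel_feasible:
  assumes "relabels n \<tau> s s'" "ttp_feasible n k s"
  shows "ttp_feasible n k s'"
proof -
  let ?D = "num_days n"
  have bij: "bij_betw \<tau> {..<n} {..<n}" using assms(1) by (simp add: relabels_def)
  have o: "fst s' t (\<tau> i) = \<tau> (fst s t i)" and h: "snd s' t (\<tau> i) = snd s t i" if "t < ?D" "i < n" for t i
    using assms(1) that by (auto simp: relabels_def)
  have inj: "\<tau> i = \<tau> j \<longleftrightarrow> i = j" if "i < n" "j < n" for i j
    using bij that by (auto simp: bij_betw_def inj_on_def)
  have lt: "\<tau> i < n" if "i < n" for i using bij that by (auto simp: bij_betw_def)
  have all: "(\<forall>i<n. Q i) \<longleftrightarrow> (\<forall>i<n. Q (\<tau> i))" for Q
  proof -
    have "(\<forall>i<n. Q i) \<longleftrightarrow> (\<forall>i\<in>\<tau> ` {..<n}. Q i)" using bij by (auto simp: bij_betw_def)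
    then show ?thesis by auto
  qed
  have f: "\<forall>t<?D. \<forall>i<n. fst s t i < n \<and> fst s t i \<noteq> i \<and> fst s t (fst s t i) = i \<and> snd s t (fst s t i) = (\<not> snd s t i)"
    "\<forall>i<n. \<forall>j<n. i \<noteq> j \<longrightarrow> card {t. t < ?D \<and> fst s t i = j \<and> snd s t j} = 1"
    "\<forall>t. Suc t < ?D \<longrightarrow> (\<forall>i<n. fst s (Suc t) i \<noteq> fst s t i)"
    "\<forall>i<n. \<forall>a. a + k < ?D \<longrightarrow> \<not> (\<forall>t\<in>{a..a + k}. snd s t i) \<and> \<not> (\<forall>t\<in>{a..a + k}. \<not> snd s t i)"
    using assms(2) unfolding ttp_feasible_def Let_def by blast+
  show ?thesis
    unfolding ttp_feasible_def Let_def
  proof (intro conjI)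
    show "\<forall>t<?D. \<forall>i<n. fst s' t i < n \<and> fst s' t i \<noteq> i \<and> fst s' t (fst s' t i) = i \<and>
        snd s' t (fst s' t i) = (\<not> snd s' t i)"
      by (subst all) (use f(1) in \<open>auto simp: o h inj lt\<close>)
    have "card {t. t < ?D \<and> fst s' t (\<tau> i) = \<tau> j \<and> snd s' t (\<tau> j)} = 1" if "i < n" "j < n" "i \<noteq> j" for i j
    proof -
      have "{t. t < ?D \<and> fst s' t (\<tau> i) = \<tau> j \<and> snd s' t (\<tau> j)} = {t. t < ?D \<and> fst s t i = j \<and> snd s t j}"
        using f(1) that by (auto simp: o h inj)
      then show ?thesis using f(2) that by simp
    qed
    then show "\<forall>i<n. \<forall>j<n. i \<noteq> j \<longrightarrow> card {t. t < ?D \<and> fst s' t i = j \<and> snd s' t j} = 1"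
      by (subst all, subst (2) all) (auto simp: inj)
    show "\<forall>t. Suc t < ?D \<longrightarrow> (\<forall>i<n. fst s' (Suc t) i \<noteq> fst s' t i)"
      by (subst all) (use f(1,3) in \<open>auto simp: o inj\<close>)
    have "\<not> (\<forall>t\<in>{a..a + k}. snd s' t (\<tau> i)) \<and> \<not> (\<forall>t\<in>{a..a + k}. \<not> snd s' t (\<tau> i))"
      if "i < n" "a + k < ?D" for i a
    proof -
      have "snd s' t (\<tau> i) = snd s t i" if "t \<in> {a..a + k}" for t
        using h[of t i] that \<open>i < n\<close> \<open>a + k < ?D\<close> by auto
      then show ?thesis using f(4) that by (metis (no_types, lifting))
    qed
    then show "\<forall>i<n. \<forall>a. a + k < ?D \<longrightarrow> \<not> (\<forall>t\<in>{a..a + k}. snd s' t i) \<and> \<not> (\<forall>t\<in>{a..a + k}. \<not> snd s' t i)"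
      by (subst all) blast
  qed
qed

lemma relabel_cost:
  assumes "relabels n \<tau> s s'" "ttp_feasible n k s" "2 \<le> n"
  shows "ttp_cost n d s' = ttp_cost n (\<lambda>i j. d (\<tau> i) (\<tau> j)) s"
proof -
  have bij: "bij_betw \<tau> {..<n} {..<n}" using assms(1) by (simp add: relabels_def)
  have v: "venue s' t (\<tau> i) = \<tau> (venue s t i)" if "t < num_days n" "i < n" for t i
    using assms(1) that by (auto simp: relabels_def venue_def)
  have "0 < num_days n" using assms(3) by (simp add: num_days_def)
  then show ?thesis
    unfolding ttp_cost_def
    by (subst sum.reindex_bij_betw[OF bij, symmetric]) (auto intro!: sum.cong simp: v)
qed

text \<open>Four teams mean \<open>N = 3\<close>, where \<open>alt_feasible\<close> does not apply.
  This explicit schedule (one row per day, one column per team) respects the bound 2 and is checked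
  by evaluation.\<close>

definition opp4 :: "nat list list" where
  "opp4 = [[1,0,3,2], [2,3,0,1], [3,2,1,0], [2,3,0,1], [1,0,3,2], [3,2,1,0]]"

definition home4 :: "nat list list" where
  "home4 = [[1,0,0,1], [0,1,1,0], [0,0,1,1], [1,0,0,1], [0,1,1,0], [1,1,0,0]]"

definition sched4 :: schedule where
  "sched4 = ((\<lambda>t i. opp4 ! t ! i), (\<lambda>t i. 0 < home4 ! t ! i))"

lemma all_less_upt: "(\<forall>i<n. P i) = list_all P [0..<n]" for n :: nat
  by (auto simp: list_all_iff)

lemma sched4_feasible: "ttp_feasible 4 2 sched4"
proof -
  have D: "num_days 4 = 6" by (simp add: num_days_def)
  have c: "card {t. t < 6 \<and> P t} = length (filter P [0..<6])" for P :: "nat \<Rightarrow> bool"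
  proof -
    have "{t. t < 6 \<and> P t} = set (filter P [0..<6])" by auto
    then show ?thesis by (metis distinct_card distinct_filter distinct_upt)
  qed
  have A: "(\<forall>a. a + 2 < 6 \<longrightarrow> P a) = (\<forall>a<4. P a)" "(\<forall>t. Suc t < 6 \<longrightarrow> P t) = (\<forall>t<5. P t)" for P :: "nat \<Rightarrow> bool"
    by (auto simp: less_diff_conv)
  have b: "(\<forall>t\<in>{a..a + 2}. P t) = list_all P [a..<a + 3]" for P and a :: nat
    by (auto simp: list_all_iff)
  have "list_all (\<lambda>t. list_all (\<lambda>i. opp4 ! t ! i < 4 \<and> opp4 ! t ! i \<noteq> i \<and> opp4 ! t ! (opp4 ! t ! i) = i \<and>
     (0 < home4 ! t ! (opp4 ! t ! i)) = (\<not> 0 < home4 ! t ! i)) [0..<4]) [0..<6] \<and>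
    list_all (\<lambda>i. list_all (\<lambda>j. i \<noteq> j \<longrightarrow> length (filter (\<lambda>t. opp4 ! t ! i = j \<and> 0 < home4 ! t ! j) [0..<6]) = 1) [0..<4]) [0..<4] \<and>
    list_all (\<lambda>t. list_all (\<lambda>i. opp4 ! Suc t ! i \<noteq> opp4 ! t ! i) [0..<4]) [0..<5] \<and>
    list_all (\<lambda>i. list_all (\<lambda>a. \<not> list_all (\<lambda>t. 0 < home4 ! t ! i) [a..<a + 3] \<and>
      \<not> list_all (\<lambda>t. \<not> 0 < home4 ! t ! i) [a..<a + 3]) [0..<4]) [0..<4]"
    by code_simp
  then show ?thesis
    unfolding ttp_feasible_def Let_def sched4_def fst_conv snd_conv
    by (simp only: D A b c all_less_upt)
qed

section \<open>Travel costs\<close>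

text \<open>Every leg is routed through home, so the distance of each venue is counted once for
  arriving and once for leaving.\<close>

lemma venue_cost_le:
  assumes m: "ttp_metric n d" and i: "i < n" and v: "\<And>t. t \<le> M \<Longrightarrow> v t < n"
  shows "d i (v 0) + (\<Sum>t<M. d (v t) (v (Suc t))) + d (v M) i \<le> 2 * (\<Sum>t\<le>M. d i (v t))"
proof -
  have sym: "a < n \<Longrightarrow> b < n \<Longrightarrow> d a b = d b a" for a b using m by (auto simp: ttp_metric_def)
  have tri: "a < n \<Longrightarrow> b < n \<Longrightarrow> c < n \<Longrightarrow> d a c \<le> d a b + d b c" for a b c
    using m by (auto simp: ttp_metric_def)
  have "(\<Sum>t<M. d (v t) (v (Suc t))) \<le> (\<Sum>t<M. d i (v t) + d i (v (Suc t)))"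
  proof (rule sum_mono)
    fix t assume "t \<in> {..<M}"
    then have "v t < n" "v (Suc t) < n" using v by auto
    then show "d (v t) (v (Suc t)) \<le> d i (v t) + d i (v (Suc t))"
      using tri[of "v t" i "v (Suc t)"] sym[of "v t" i] i by simp
  qed
  also have "\<dots> = (\<Sum>t<M. d i (v t)) + (\<Sum>t<M. d i (v (Suc t)))" by (rule sum.distrib)
  also have "(\<Sum>t<M. d i (v (Suc t))) = (\<Sum>t\<le>M. d i (v t)) - d i (v 0)"
    by (simp add: sum.atMost_shift)
  also have "(\<Sum>t<M. d i (v t)) = (\<Sum>t\<le>M. d i (v t)) - d i (v M)"
    by (simp add: lessThan_Suc_atMost[symmetric])
  finally show ?thesis using sym[OF v i, of M] by simp
qed

text \<open>Home days contribute 0, and the away days are in bijection with the opponents.\<close>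

lemma metric_sum_venue:
  assumes f: "ttp_feasible n k s" and m: "ttp_metric n d" and i: "i < n"
  shows "(\<Sum>t<num_days n. d i (venue s t i)) = (\<Sum>j<n. d i j)"
proof -
  let ?D = "num_days n"
  let ?A = "{t. t < ?D \<and> \<not> snd s t i}"
  have f1: "\<And>t i. t < ?D \<Longrightarrow> i < n \<Longrightarrow> fst s t i < n \<and> fst s t i \<noteq> i \<and> snd s t (fst s t i) = (\<not> snd s t i)"
    and f2: "\<And>i j. i < n \<Longrightarrow> j < n \<Longrightarrow> i \<noteq> j \<Longrightarrow> card {t. t < ?D \<and> fst s t i = j \<and> snd s t j} = 1"
    using f unfolding ttp_feasible_def Let_def by auto
  have d0: "d i i = 0" using m i by (auto simp: ttp_metric_def)
  have "bij_betw (\<lambda>t. fst s t i) ?A ({..<n} - {i})"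
    unfolding bij_betw_def
  proof
    show "inj_on (\<lambda>t. fst s t i) ?A"
    proof (rule inj_onI)
      fix t u assume a: "t \<in> ?A" "u \<in> ?A" "fst s t i = fst s u i"
      let ?j = "fst s t i"
      have j: "?j < n" "i \<noteq> ?j" using f1[of t i] a i by auto
      then obtain w where w: "{t. t < ?D \<and> fst s t i = ?j \<and> snd s t ?j} = {w}"
        using card_1_singletonE[OF f2[OF i j]] by blast
      have "t \<in> {t. t < ?D \<and> fst s t i = ?j \<and> snd s t ?j}" "u \<in> {t. t < ?D \<and> fst s t i = ?j \<and> snd s t ?j}"
        using a f1[OF _ i, of t] f1[OF _ i, of u] by auto
      then show "t = u" unfolding w by simp
    qed
    show "(\<lambda>t. fst s t i) ` ?A = {..<n} - {i}"
    proof (intro equalityI subsetI)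
      fix j assume j: "j \<in> {..<n} - {i}"
      then have j': "j < n" "i \<noteq> j" by auto
      obtain w where "{t. t < ?D \<and> fst s t i = j \<and> snd s t j} = {w}"
        using card_1_singletonE[OF f2[OF i j']] by blast
      then have "w < ?D" "fst s w i = j" "snd s w j" by auto
      then show "j \<in> (\<lambda>t. fst s t i) ` ?A" using f1[of w i] i by auto
    qed (use f1 i in auto)
  qed
  then have 1: "(\<Sum>t\<in>?A. d i (fst s t i)) = (\<Sum>j\<in>{..<n} - {i}. d i j)"
    by (rule sum.reindex_bij_betw)
  have 2: "(\<Sum>j\<in>{..<n} - {i}. d i j) = (\<Sum>j<n. d i j)"
    using i d0 by (intro sum.mono_neutral_left) auto
  have 3: "(\<Sum>t\<in>?A. d i (fst s t i)) = (\<Sum>t\<in>?A. d i (venue s t i))"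
    by (intro sum.cong) (auto simp: venue_def)
  have 4: "(\<Sum>t\<in>?A. d i (venue s t i)) = (\<Sum>t<?D. d i (venue s t i))"
    using d0 by (intro sum.mono_neutral_left) (auto simp: venue_def)
  show ?thesis using 1 2 3 4 by simp
qed

lemma venue_less: "ttp_feasible n k s \<Longrightarrow> i < n \<Longrightarrow> t < num_days n \<Longrightarrow> venue s t i < n"
  unfolding ttp_feasible_def Let_def venue_def by auto

lemma team_cost_le:
  assumes f: "ttp_feasible n k s" and m: "ttp_metric n d" and i: "i < n" and n: "2 \<le> n"
  shows "d i (venue s 0 i) + (\<Sum>t<num_days n - 1. d (venue s t i) (venue s (Suc t) i))
            + d (venue s (num_days n - 1) i) i \<le> 2 * (\<Sum>j<n. d i j)"
proof -
  have D: "Suc (num_days n - 1) = num_days n" using n by (simp add: num_days_def)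
  have "(\<Sum>t\<le>num_days n - 1. d i (venue s t i)) = (\<Sum>j<n. d i j)"
    using metric_sum_venue[OF f m i] by (simp only: lessThan_Suc_atMost[symmetric] D)
  moreover have "venue s t i < n" if "t \<le> num_days n - 1" for t
    using venue_less[OF f i] that D by simp
  ultimately show ?thesis
    using venue_cost_le[OF m i, of "num_days n - 1" "\<lambda>t. venue s t i"] by simp
qed

theorem cost_le_twice_total:
  assumes "ttp_feasible n k s" "ttp_metric n d" "2 \<le> n"
  shows "ttp_cost n d s \<le> 2 * (\<Sum>i<n. \<Sum>j<n. d i j)"
  unfolding ttp_cost_def
  by (subst sum_distrib_left) (intro sum_mono team_cost_le[OF assms(1,2) _ assms(3)], simp)

text \<open>Each stop is an end of exactly two legs, and moving it from \<open>u t\<close> to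
  \<open>v t\<close> lengthens each of them by at most the distance between the two.\<close>

lemma walk_perturb:
  assumes m: "ttp_metric n d" and i: "i < n" and v: "\<And>t. t \<le> M \<Longrightarrow> v t < n" and u: "\<And>t. t \<le> M \<Longrightarrow> u t < n"
  shows "d i (v 0) + (\<Sum>t<M. d (v t) (v (Suc t))) + d (v M) i
      \<le> d i (u 0) + (\<Sum>t<M. d (u t) (u (Suc t))) + d (u M) i + 2 * (\<Sum>t\<le>M. d (v t) (u t))"
proof -
  have sym: "a < n \<Longrightarrow> b < n \<Longrightarrow> d a b = d b a" for a b using m by (auto simp: ttp_metric_def)
  have tri: "a < n \<Longrightarrow> b < n \<Longrightarrow> c < n \<Longrightarrow> d a c \<le> d a b + d b c" for a b c
    using m by (auto simp: ttp_metric_def)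
  have "(\<Sum>t<M. d (v t) (v (Suc t))) \<le> (\<Sum>t<M. d (u t) (u (Suc t)) + d (v t) (u t) + d (v (Suc t)) (u (Suc t)))"
  proof (rule sum_mono)
    fix t assume "t \<in> {..<M}"
    then have lt: "v t < n" "v (Suc t) < n" "u t < n" "u (Suc t) < n" using v u by auto
    show "d (v t) (v (Suc t)) \<le> d (u t) (u (Suc t)) + d (v t) (u t) + d (v (Suc t)) (u (Suc t))"
      using tri[OF lt(1,3,2)] tri[OF lt(3,4,2)] sym[OF lt(4,2)] by linarith
  qed
  also have "\<dots> = (\<Sum>t<M. d (u t) (u (Suc t))) + (\<Sum>t<M. d (v t) (u t)) + (\<Sum>t<M. d (v (Suc t)) (u (Suc t)))"
    by (simp add: sum.distrib)
  also have "(\<Sum>t<M. d (v (Suc t)) (u (Suc t))) = (\<Sum>t\<le>M. d (v t) (u t)) - d (v 0) (u 0)"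
    by (simp add: sum.atMost_shift)
  also have "(\<Sum>t<M. d (v t) (u t)) = (\<Sum>t\<le>M. d (v t) (u t)) - d (v M) (u M)"
    by (simp add: lessThan_Suc_atMost[symmetric])
  finally show ?thesis
    using tri[OF i u v, of 0 0] sym[OF u v, of 0 0] tri[OF v u i, of M M] by simp
qed

definition tour_len :: "nat \<Rightarrow> (nat \<Rightarrow> nat \<Rightarrow> real) \<Rightarrow> real" where
  "tour_len N d = (\<Sum>a<N. d a (Suc a mod N))"

text \<open>Each pair of the day is counted from both ends, so for a metric this is twice the length
  of the matching; the label on the axis contributes \<open>d i i\<close>.\<close>

definition day_len :: "nat \<Rightarrow> (nat \<Rightarrow> nat \<Rightarrow> real) \<Rightarrow> nat \<Rightarrow> real" where
  "day_len N d t = (\<Sum>i<N. d i (cj N t i))"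

lemma bij_cj: "bij_betw (cj N t) {..<N} {..<N}"
  by (rule bij_betw_byWitness[where f' = "cj N t"]) (auto simp: cj_invol cj_less)

lemma cj_Suc: "i < N \<Longrightarrow> cj N (Suc t) i = Suc (cj N t i) mod N"
  by (simp add: cj_def mod_Suc_eq)

lemma sum_tour_shift: "(\<Sum>i<N. d (cj N t i) (cj N (Suc t) i)) = tour_len N d"
proof -
  have "(\<Sum>i<N. d (cj N t i) (cj N (Suc t) i)) = (\<Sum>i<N. d (cj N t i) (Suc (cj N t i) mod N))"
    by (simp add: cj_Suc)
  also have "\<dots> = (\<Sum>a<N. d a (Suc a mod N))"
    by (rule sum.reindex_bij_betw[OF bij_cj])
  finally show ?thesis by (simp add: tour_len_def)
qed

lemma cj_shift: "cj N (t + N) i = cj N t i"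
  using cj_mod[of N "t + N" i] cj_mod[of N t i] by simp

lemma sum_split_half:
  fixes X :: "nat \<Rightarrow> real"
  assumes "0 < N"
  shows "(\<Sum>t<2 * N - 1. X t) = (\<Sum>t<N - 1. X t + X (t + N)) + X (N - 1)"
proof -
  obtain M where M: "N = Suc M" using assms by (cases N) auto
  have "(\<Sum>t<2 * N - 1. X t) = sum X {..<N + M}" by (simp add: M mult_2)
  also have "\<dots> = sum X {..<N} + (\<Sum>t<M. X (t + N))"
    by (simp only: lessThan_atLeast0 sum.atLeastLessThan_concat[symmetric, of 0 N "N + M"])
      (simp add: sum.shift_bounds_nat_ivl[of X 0 N M, simplified] add.commute)
  finally show ?thesis by (simp add: M sum.distrib)
qed

text \<open>Days \<open>t\<close> and \<open>t + N\<close> are charged together, since each label is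
  away on exactly one of them. Inside a block the legs of the pair add up, for each label, to one
  step between consecutive opponents. At a boundary all legs are routed through home instead. The
  last summand pays for the special label: \<open>2 * d i N\<close> for the visit of each ordinary
  label \<open>i\<close>, and twice the sum of its distances for its own travel.\<close>

theorem circle_cost:
  assumes N: "odd N" "3 \<le> N"
    and f: "ttp_feasible (Suc N) k (copp N, chome N w)" and m: "ttp_metric (Suc N) d"
    and w2: "\<And>t i. t < N \<Longrightarrow> i < N \<Longrightarrow> w (t + N) i = (\<not> w t i)"
    and B: "B \<subseteq> {..<N}" "0 \<in> B"
    and keep: "\<And>t i. Suc t < N \<Longrightarrow> Suc t \<notin> B \<Longrightarrow> i < N \<Longrightarrow> cj N t i \<noteq> i \<Longrightarrow> cj N (Suc t) i \<noteq> i \<Longrightarrow> w (Suc t) i = w t i"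
  shows "ttp_cost (Suc N) d (copp N, chome N w)
     \<le> (real N - real (card B)) * tour_len N d + (\<Sum>b\<in>B. day_len N d (b + N - 1) + day_len N d b) + 4 * (\<Sum>i<N. d i N)"
proof -
  let ?s = "(copp N, chome N w)"
  let ?L = "tour_len N d" and ?P = "day_len N d"
  have D: "num_days (Suc N) = 2 * N" by (simp add: num_days_def)
  have sym: "a \<le> N \<Longrightarrow> b \<le> N \<Longrightarrow> d a b = d b a" for a b using m by (auto simp: ttp_metric_def)
  have tri: "a \<le> N \<Longrightarrow> b \<le> N \<Longrightarrow> c \<le> N \<Longrightarrow> d a c \<le> d a b + d b c" for a b c
    using m by (auto simp: ttp_metric_def)
  have d0: "a \<le> N \<Longrightarrow> d a a = 0" for a using m by (auto simp: ttp_metric_def)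
  have pos: "a \<le> N \<Longrightarrow> b \<le> N \<Longrightarrow> 0 \<le> d a b" for a b using m by (auto simp: ttp_metric_def)
  define v where "v t i = venue ?s t i" for t i
  \<comment> \<open>\<open>u\<close> pretends that a game with the special label is always a day at
    home: on such a day \<open>cj N t i = i\<close>.\<close>
  define u where "u t i = (if w t i then cj N t i else i)" for t i
  have ul: "u t i < N" if "i < N" for t i using that cj_less by (simp add: u_def)
  have vl: "v t i \<le> N" if "i \<le> N" "t < 2 * N" for t i
    using venue_less[OF f, of i t] that by (simp add: D v_def)
  define M where "M = 2 * N - 1"
  have M: "{..M} = {..<2 * N}" using N by (auto simp: M_def)
  define tc where "tc x i = d i (x 0 i) + (\<Sum>t<M. d (x t i) (x (Suc t) i)) + d (x M i) i" for x i
  have cost: "ttp_cost (Suc N) d ?s = (\<Sum>i<N. tc v i) + tc v N"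
    by (simp add: ttp_cost_def tc_def v_def D M_def)
  have special: "tc v N \<le> 2 * (\<Sum>i<N. d i N)"
  proof -
    have "tc v N \<le> 2 * (\<Sum>j<Suc N. d N j)"
      using team_cost_le[OF f m, of N] N by (simp add: tc_def v_def D M_def)
    also have "(\<Sum>j<Suc N. d N j) = (\<Sum>i<N. d i N)" using d0 sym by simp
    finally show ?thesis .
  qed
  have regular: "tc v i \<le> tc u i + 2 * d i N" if i: "i < N" for i
  proof -
    \<comment> \<open>The true venue \<open>v\<close> and the fictitious \<open>u\<close> differ
      only on the single day when \<open>i\<close> plays at the home of the special label.\<close>
    have "(\<Sum>t\<le>M. d (v t i) (u t i)) \<le> d i N"
    proof -
      let ?A = "{t. t < 2 * N \<and> copp N t i = N \<and> chome N w t N}"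
      have c: "card ?A = 1"
        using f i unfolding ttp_feasible_def Let_def D by auto
      then have fin: "finite ?A" by (metis card.infinite zero_neq_one)
      have home: "chome N w t (copp N t i) = (\<not> chome N w t i)" if "t < 2 * N" for t
        using f i that unfolding ttp_feasible_def Let_def D by auto
      have "d (v t i) (u t i) = (if t \<in> ?A then d i N else 0)" if "t < 2 * N" for t
      proof (cases "w t i")
        case True
        then have h: "\<not> chome N w t i" using i by (simp add: chome_def)
        show ?thesis
        proof (cases "cj N t i = i")
          case True
          then show ?thesis using h home[OF that] that i sym[of N i] \<open>w t i\<close>
            by (simp add: v_def u_def venue_def copp_def)
        next
          case False
          then show ?thesis using h that i \<open>w t i\<close> d0[of "cj N t i"] cj_less[OF i, of t]
            by (simp add: v_def u_def venue_def copp_def)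
        qed
      next
        case False
        then have "chome N w t i" using i by (simp add: chome_def)
        then show ?thesis using False home[OF that] d0[of i] i
          by (auto simp: v_def u_def venue_def)
      qed
      then have "(\<Sum>t\<le>M. d (v t i) (u t i)) = (\<Sum>t<2 * N. if t \<in> ?A then d i N else 0)"
        unfolding M by (intro sum.cong) auto
      also have "\<dots> = (\<Sum>t\<in>{..<2 * N} \<inter> ?A. d i N)"
        by (simp only: sum.inter_restrict[symmetric] finite_lessThan)
      also have "{..<2 * N} \<inter> ?A = ?A" by auto
      finally show ?thesis using c by simp
    qed
    moreover have "v t i < Suc N" "u t i < Suc N" if "t \<le> M" for t
    proof -
      have "t < 2 * N" using that M by auto
      then show "v t i < Suc N" "u t i < Suc N" using vl[of i t] ul[OF i, of t] i by auto
    qed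
    ultimately show ?thesis
      using walk_perturb[OF m, of i M "\<lambda>t. v t i" "\<lambda>t. u t i"] i unfolding tc_def by simp
  qed
  define X where "X t = (\<Sum>i<N. d (u t i) (u (Suc t) i))" for t
  define A where "A t = (\<Sum>i<N. d i (u t i))" for t
  have sum_tc: "(\<Sum>i<N. tc u i) = A 0 + (\<Sum>t<M. X t) + A M"
  proof -
    have "(\<Sum>i<N. d (u M i) i) = A M" unfolding A_def by (intro sum.cong) (auto simp: sym ul less_imp_le)
    moreover have "(\<Sum>i<N. \<Sum>t<M. d (u t i) (u (Suc t) i)) = (\<Sum>t<M. X t)"
      unfolding X_def by (rule sum.swap)
    ultimately show ?thesis by (simp add: tc_def sum.distrib A_def)
  qed
  have us: "u (t + N) i = (if w t i then i else cj N t i)" if "t < N" "i < N" for t i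
    using w2[OF that] by (simp add: u_def cj_shift)
  have AP: "A t + A (t + N) = ?P t" if "t < N" for t
    unfolding A_def day_len_def sum.distrib[symmetric]
    by (intro sum.cong refl) (use us[OF that] d0 in \<open>auto simp: u_def\<close>)
  have XA: "X t \<le> A t + A (Suc t)" for t
    unfolding X_def A_def sum.distrib[symmetric]
  proof (rule sum_mono)
    fix i assume "i \<in> {..<N}"
    then have i: "i \<le> N" "u t i \<le> N" "u (Suc t) i \<le> N" using ul[of i] by (auto simp: less_imp_le)
    show "d (u t i) (u (Suc t) i) \<le> d i (u t i) + d i (u (Suc t) i)"
      using tri[OF i(2,1,3)] sym[OF i(1,2)] by simp
  qed
  have XB: "X t + X (t + N) \<le> ?P t + ?P (Suc t)" if "Suc t < N" for t
    using XA[of t] XA[of "t + N"] AP[of t] AP[of "Suc t"] that by simp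
  have XK: "X t + X (t + N) \<le> ?L" if t: "Suc t < N" "Suc t \<notin> B" for t
  proof -
    have "X t + X (t + N) \<le> (\<Sum>i<N. d (cj N t i) (cj N (Suc t) i))"
      unfolding X_def sum.distrib[symmetric]
    proof (rule sum_mono)
      fix i assume "i \<in> {..<N}"
      then have i: "i < N" by simp
      have us1: "u (t + N) i = (if w t i then i else cj N t i)"
        and us2: "u (Suc (t + N)) i = (if w (Suc t) i then i else cj N (Suc t) i)"
        using us[of t i] us[of "Suc t" i] t i by auto
      show "d (u t i) (u (Suc t) i) + d (u (t + N) i) (u (Suc (t + N)) i) \<le> d (cj N t i) (cj N (Suc t) i)"
      \<comment> \<open>On the axis both alternatives in \<open>u\<close> are \<open>i\<close>
        itself, so a change of \<open>w\<close> has no effect there.\<close>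
      proof (cases "cj N t i = i \<or> cj N (Suc t) i = i")
        case True
        then show ?thesis unfolding us1 us2 using d0[of i] i by (auto simp: u_def)
      next
        case False
        then have "w (Suc t) i = w t i" using keep[OF t i] by auto
        then show ?thesis unfolding us1 us2 using d0[of i] i by (auto simp: u_def)
      qed
    qed
    then show ?thesis by (simp only: sum_tour_shift)
  qed
  have "A 0 + (\<Sum>t<M. X t) + A M = A 0 + X (N - 1) + A M + (\<Sum>t<N - 1. X t + X (t + N))"
    using sum_split_half[of N X] N by (simp add: M_def)
  \<comment> \<open>Departure from home, the leg between the two halves and the final return
    together form the boundary at day 0; this is why 0 has to be in \<open>B\<close>.\<close>
  also have "A 0 + X (N - 1) + A M \<le> ?P (N - 1) + ?P 0"
  proof -
    have "M = N - 1 + N" "Suc (N - 1) = N" using N by (auto simp: M_def)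
    then show ?thesis using XA[of "N - 1"] AP[of 0] AP[of "N - 1"] N by simp
  qed
  also have "(\<Sum>t<N - 1. X t + X (t + N)) \<le> (\<Sum>t<N - 1. if Suc t \<in> B then ?P t + ?P (Suc t) else ?L)"
    using XB XK by (intro sum_mono) auto
  also have "?P (N - 1) + ?P 0 + (\<Sum>t<N - 1. if Suc t \<in> B then ?P t + ?P (Suc t) else ?L)
     = (\<Sum>b<N. if b \<in> B then ?P (b + N - 1) + ?P b else ?L)"
  proof -
    obtain N' where N': "N = Suc N'" using N by (cases N) auto
    have "?P (Suc t + N - 1) = ?P t" for t using cj_shift[of N t] by (simp add: day_len_def)
    then show ?thesis using B(2) unfolding N' by (subst sum.lessThan_Suc_shift) (simp cong: if_cong)
  qed
  also have "\<dots> = (\<Sum>b\<in>B. ?P (b + N - 1) + ?P b) + (\<Sum>b\<in>{..<N} - B. ?L)"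
  proof -
    have "{..<N} = B \<union> ({..<N} - B)" using B(1) by auto
    then have "(\<Sum>b<N. if b \<in> B then ?P (b + N - 1) + ?P b else ?L)
      = (\<Sum>b\<in>B. if b \<in> B then ?P (b + N - 1) + ?P b else ?L) + (\<Sum>b\<in>{..<N} - B. if b \<in> B then ?P (b + N - 1) + ?P b else ?L)"
      using finite_subset[OF B(1)] by (subst sum.union_disjoint[symmetric]) auto
    then show ?thesis by simp
  qed
  also have "(\<Sum>b\<in>{..<N} - B. ?L) = (real N - real (card B)) * ?L"
    using card_mono[OF _ B(1)] by (simp add: card_Diff_subset[OF finite_subset[OF B(1)] B(1)] of_nat_diff)
  finally have U: "(\<Sum>i<N. tc u i) \<le> (\<Sum>b\<in>B. ?P (b + N - 1) + ?P b) + (real N - real (card B)) * ?L"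
    unfolding sum_tc by simp
  have "(\<Sum>i<N. tc v i) \<le> (\<Sum>i<N. tc u i + 2 * d i N)"
    using regular by (intro sum_mono) auto
  then have "(\<Sum>i<N. tc v i) \<le> (\<Sum>i<N. tc u i) + 2 * (\<Sum>i<N. d i N)"
    by (simp add: sum.distrib sum_distrib_left)
  then show ?thesis using U special unfolding cost by linarith
qed

section \<open>Lower bounds\<close>

fun pl :: "(nat \<Rightarrow> nat \<Rightarrow> real) \<Rightarrow> nat list \<Rightarrow> real" where
  "pl d (x # y # zs) = d x y + pl d (y # zs)"
| "pl d _ = 0"

lemma pl_append: "pl d (xs @ x # ys) = pl d (xs @ [x]) + pl d (x # ys)"
  by (induction xs rule: induct_list012) simp_all

lemma pl_map_upt: "pl d (map f [0..<Suc m]) = (\<Sum>t<m. d (f t) (f (Suc t)))"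
proof (induction m)
  case (Suc m)
  have "pl d (map f [0..<Suc (Suc m)]) = pl d (map f [0..<m] @ f m # [f (Suc m)])" by simp
  also have "\<dots> = pl d (map f [0..<Suc m]) + d (f m) (f (Suc m))" by (subst pl_append) simp
  finally show ?case using Suc by simp
qed simp

lemma bij_rot:
  assumes "0 < n"
  shows "bij_betw (\<lambda>a. (a + e) mod n) {..<n} {..<n::nat}"
proof (rule bij_betw_imageI)
  show "inj_on (\<lambda>a. (a + e) mod n) {..<n}"
  proof (rule inj_onI)
    fix a b assume ab: "a \<in> {..<n}" "b \<in> {..<n}" "(a + e) mod n = (b + e) mod n"
    have "e mod n < n" using assms by simp
    moreover have "(a + e mod n) mod n = (b + e mod n) mod n" using ab(3) by (simp add: mod_add_right_eq)
    ultimately show "a = b" using ab(1,2) mod_add_small[of _ n "e mod n"] by (auto split: if_splits)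
  qed
  then show "(\<lambda>a. (a + e) mod n) ` {..<n} = {..<n}"
    using assms by (intro endo_inj_surj) auto
qed

locale ttp_met =
  fixes n :: nat and d :: "nat \<Rightarrow> nat \<Rightarrow> real"
  assumes met: "ttp_metric n d"
begin

lemma sym: "a < n \<Longrightarrow> b < n \<Longrightarrow> d a b = d b a" using met by (auto simp: ttp_metric_def)

lemma tri: "a < n \<Longrightarrow> b < n \<Longrightarrow> c < n \<Longrightarrow> d a c \<le> d a b + d b c" using met by (auto simp: ttp_metric_def)

lemma nonneg: "a < n \<Longrightarrow> b < n \<Longrightarrow> 0 \<le> d a b" using met by (auto simp: ttp_metric_def)

lemma self: "a < n \<Longrightarrow> d a a = 0" using met by (auto simp: ttp_metric_def)

lemma pl_nonneg: "set xs \<subseteq> {..<n} \<Longrightarrow> 0 \<le> pl d xs"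
  by (induction xs rule: induct_list012) (auto intro!: add_nonneg_nonneg nonneg)

lemma pl_skip: "a < n \<Longrightarrow> b < n \<Longrightarrow> set xs \<subseteq> {..<n} \<Longrightarrow> pl d (a # xs) \<le> d a b + pl d (b # xs)"
  by (cases xs) (auto simp: nonneg tri add.assoc[symmetric] intro: add_right_mono)

lemma subseq_set: "subseq ys xs \<Longrightarrow> set ys \<subseteq> set xs"
  by (induction rule: list_emb.induct) auto

lemma pl_subseq_Cons: "subseq ys xs \<Longrightarrow> set xs \<subseteq> {..<n} \<Longrightarrow> a < n \<Longrightarrow> pl d (a # ys) \<le> pl d (a # xs)"
proof (induction arbitrary: a rule: list_emb.induct)
  case (list_emb_Nil xs)
  then show ?case using pl_nonneg[of "a # xs"] by auto
next
  case (list_emb_Cons ys xs x)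
  have "set ys \<subseteq> {..<n}" using subseq_set[OF list_emb_Cons.hyps] list_emb_Cons.prems(1) by (simp, blast)
  then have "pl d (a # ys) \<le> d a x + pl d (x # ys)" using list_emb_Cons.prems by (intro pl_skip) auto
  then show ?case using list_emb_Cons.IH[of x] list_emb_Cons.prems by auto
next
  case (list_emb_Cons2 x y ys xs)
  then show ?case by auto
qed

lemma pl_subseq: "subseq ys xs \<Longrightarrow> set xs \<subseteq> {..<n} \<Longrightarrow> pl d ys \<le> pl d xs"
proof (induction rule: list_emb.induct)
  case (list_emb_Cons ys xs x)
  have "pl d xs \<le> pl d (x # xs)" using list_emb_Cons.prems by (cases xs) (auto simp: nonneg)
  then show ?case using list_emb_Cons by auto
next
  case (list_emb_Cons2 x y ys xs)
  then show ?case using pl_subseq_Cons[of ys xs x] by auto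
qed (use pl_nonneg in auto)

lemma detour_le:
  assumes "x \<in> set xs" "set xs \<subseteq> {..<n}" "i < n"
  shows "2 * d i x \<le> pl d (i # xs @ [i])"
proof -
  have x: "x < n" using assms by auto
  have "subseq [x, i] (xs @ [i])"
    using assms(1) by (metis append.left_neutral append_Cons list_emb_append_mono subseq_order.order_refl subseq_singleton_left)
  from pl_subseq_Cons[OF this _ assms(3)] assms show ?thesis using sym[OF x assms(3)] by auto
qed

text \<open>The walk is cut at its visits to \<open>i\<close>. A piece between two visits has at
  most \<open>k\<close> stops, and each stop \<open>x\<close> forces the closed trip around it to
  have length at least \<open>2 * d i x\<close>.\<close>

lemma trips_bound:
  assumes "set xs \<subseteq> {..<n}" "i < n"
    "\<And>ys zs us. xs = ys @ zs @ us \<Longrightarrow> i \<notin> set zs \<Longrightarrow> length zs \<le> k"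
  shows "2 * (\<Sum>x\<leftarrow>xs. d i x) \<le> real k * pl d (i # xs @ [i])"
  using assms(1,3)
proof (induction "length xs" arbitrary: xs rule: less_induct)
  case less
  have short: "2 * (\<Sum>x\<leftarrow>zs. d i x) \<le> real k * pl d (i # zs @ [i])"
    if z: "i \<notin> set zs" "set zs \<subseteq> {..<n}" "length zs \<le> k" for zs
  proof -
    have p: "0 \<le> pl d (i # zs @ [i])" using z(2) assms(2) by (intro pl_nonneg) auto
    have "2 * (\<Sum>x\<leftarrow>zs. d i x) = (\<Sum>x\<leftarrow>zs. 2 * d i x)" by (simp add: sum_list_const_mult)
    also have "\<dots> \<le> (\<Sum>x\<leftarrow>zs. pl d (i # zs @ [i]))"
      using detour_le[OF _ z(2) assms(2)] by (intro sum_list_mono) auto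
    also have "\<dots> = real (length zs) * pl d (i # zs @ [i])" by (simp add: sum_list_triv)
    also have "\<dots> \<le> real k * pl d (i # zs @ [i])" using z(3) p by (intro mult_right_mono) auto
    finally show ?thesis .
  qed
  show ?case
  proof (cases "i \<in> set xs")
    case False
    then show ?thesis using short[of xs] less.prems(1) less.prems(2)[of "[]" xs "[]"] by auto
  next
    case True
    then obtain ys zs where xs: "xs = ys @ i # zs" "i \<notin> set ys" by (metis split_list_first)
    have "2 * (\<Sum>x\<leftarrow>ys. d i x) \<le> real k * pl d (i # ys @ [i])"
      using short[of ys] less.prems(1) less.prems(2)[of "[]" ys "i # zs"] xs by auto
    moreover have "2 * (\<Sum>x\<leftarrow>zs. d i x) \<le> real k * pl d (i # zs @ [i])"
    proof (rule less.hyps)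
      fix ys' zs' us assume "zs = ys' @ zs' @ us" "i \<notin> set zs'"
      then show "length zs' \<le> k" using less.prems(2)[of "ys @ i # ys'" zs' us] xs by auto
    qed (use xs less.prems in auto)
    moreover have "pl d (i # xs @ [i]) = pl d (i # ys @ [i]) + pl d (i # zs @ [i])"
      using pl_append[of d "i # ys" i "zs @ [i]"] xs by simp
    ultimately show ?thesis using self[OF assms(2)] xs by (simp add: distrib_left)
  qed
qed

text \<open>With \<open>S \<delta>\<close> the sum of all distances between tour positions at offset \<open>\<delta>\<close>,
  the triangle inequality gives \<open>S \<delta> \<le> min \<delta> (n - \<delta>) * T\<close>, and these bounds add up to \<open>(n/2)\<^sup>2 * T\<close>.\<close>

lemma total_le_tour:
  assumes c: "bij_betw c {..<n} {..<n}" and n: "n = 2 * h"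
  shows "(\<Sum>i<n. \<Sum>j<n. d i j) \<le> real (h * h) * tour_len n (\<lambda>a b. d (c a) (c b))"
proof (cases "n = 0")
  case False
  then have n0: "0 < n" by simp
  let ?T = "tour_len n (\<lambda>a b. d (c a) (c b))"
  have cl: "c (a mod n) < n" for a using c n0 by (auto simp: bij_betw_def)
  note rot = bij_rot[OF n0]
  define S where "S e = (\<Sum>a<n. d (c a) (c ((a + e) mod n)))" for e
  have S0: "S 0 = 0" unfolding S_def using self cl[of a for a] by (intro sum.neutral) (metis lessThan_iff mod_less add_0_right)
  have SS: "S (Suc e) \<le> S e + ?T" for e
  proof -
    have "S (Suc e) \<le> (\<Sum>a<n. d (c a) (c ((a + e) mod n)) + d (c ((a + e) mod n)) (c (Suc ((a + e) mod n) mod n)))"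
      unfolding S_def
    proof (rule sum_mono)
      fix a assume "a \<in> {..<n}"
      then have "c a < n" using cl[of a] by simp
      then show "d (c a) (c ((a + Suc e) mod n))
        \<le> d (c a) (c ((a + e) mod n)) + d (c ((a + e) mod n)) (c (Suc ((a + e) mod n) mod n))"
        using tri[OF _ cl cl, of "c a" "Suc ((a + e) mod n)" "a + e"] by (simp add: mod_Suc_eq)
    qed
    also have "\<dots> = S e + (\<Sum>a<n. d (c ((a + e) mod n)) (c (Suc ((a + e) mod n) mod n)))"
      by (simp add: sum.distrib S_def)
    also have "(\<Sum>a<n. d (c ((a + e) mod n)) (c (Suc ((a + e) mod n) mod n))) = ?T"
      unfolding tour_len_def by (rule sum.reindex_bij_betw[OF rot])
    finally show ?thesis .
  qed
  have S1: "S e \<le> real e * ?T" for e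
  proof (induction e)
    case (Suc e)
    then show ?case using SS[of e] by (simp add: algebra_simps)
  qed (simp add: S0)
  \<comment> \<open>A pair at offset \<open>e\<close>, read from its other end, is a pair at offset
    \<open>n - e\<close>.\<close>
  have S2: "S (n - e) = S e" if "e < n" for e
  proof -
    have "S (n - e) = (\<Sum>a<n. d (c ((a + e) mod n)) (c (((a + e) mod n + (n - e)) mod n)))"
      unfolding S_def by (rule sum.reindex_bij_betw[OF rot, symmetric])
    also have "\<dots> = (\<Sum>a<n. d (c a) (c ((a + e) mod n)))"
    proof (rule sum.cong)
      fix a assume a: "a \<in> {..<n}"
      have "((a + e) mod n + (n - e)) mod n = (a + e + (n - e)) mod n" by (simp add: mod_add_left_eq)
      also have "\<dots> = a" using that a by simp
      finally show "d (c ((a + e) mod n)) (c (((a + e) mod n + (n - e)) mod n)) = d (c a) (c ((a + e) mod n))"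
        using sym cl[of "a + e"] cl[of a] a by auto
    qed simp
    finally show ?thesis by (simp add: S_def)
  qed
  have "(\<Sum>i<n. \<Sum>j<n. d i j) = (\<Sum>a<n. \<Sum>b<n. d (c a) (c b))"
    using sum.reindex_bij_betw[OF c, of "\<lambda>i. \<Sum>j<n. d i j", symmetric]
      sum.reindex_bij_betw[OF c, of "d i" for i] by simp
  also have "\<dots> = (\<Sum>a<n. \<Sum>e<n. d (c a) (c ((a + e) mod n)))"
  proof (rule sum.cong)
    fix a
    show "(\<Sum>b<n. d (c a) (c b)) = (\<Sum>e<n. d (c a) (c ((a + e) mod n)))"
      using sum.reindex_bij_betw[OF rot[of a], of "\<lambda>b. d (c a) (c b)"] by (simp add: add.commute)
  qed simp
  also have "\<dots> = (\<Sum>e<n. S e)" unfolding S_def by (rule sum.swap)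
  also have "\<dots> = (\<Sum>e<h. S e) + (\<Sum>e<h. S (e + h))"
    unfolding n mult_2 by (simp only: lessThan_atLeast0 sum.atLeastLessThan_concat[symmetric, of 0 h "h + h"])
      (simp add: sum.shift_bounds_nat_ivl[of S 0 h h, simplified])
  \<comment> \<open>Offset \<open>e\<close> costs at most \<open>e\<close> tours and offset
    \<open>e + h\<close>, seen from the other end, at most \<open>h - e\<close>; the two bounds add
    up to \<open>h\<close> for every \<open>e\<close>.\<close>
  also have "\<dots> \<le> (\<Sum>e<h. real e * ?T) + (\<Sum>e<h. real (h - e) * ?T)"
  proof (intro add_mono sum_mono S1)
    fix e assume "e \<in> {..<h}"
    then have "S (e + h) = S (h - e)" using S2[of "e + h"] n by simp
    then show "S (e + h) \<le> real (h - e) * ?T" using S1[of "h - e"] by simp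
  qed
  also have "\<dots> = (\<Sum>e<h. real h * ?T)"
    unfolding sum.distrib[symmetric] by (intro sum.cong) (auto simp: of_nat_diff algebra_simps)
  finally show ?thesis by (simp add: mult.assoc)
qed (simp add: tour_len_def)

end

section \<open>The nearest-insertion tour compared with an arbitrary spanning walk\<close>

definition links :: "nat list \<Rightarrow> nat set \<Rightarrow> (nat \<times> nat) set" where
  "links ys I = (\<Union>a\<in>I. {(ys ! a, ys ! Suc a), (ys ! Suc a, ys ! a)})"

text \<open>The links in \<open>I\<close> play the role of a spanning forest rooted in
  \<open>S\<close>, without any demand of acyclicity. Links are named by their positions in the walk
  \<open>ys\<close>, so a link traversed twice counts twice.\<close>

definition attaches :: "nat list \<Rightarrow> nat set \<Rightarrow> nat set \<Rightarrow> bool" where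
  "attaches ys I S \<longleftrightarrow> (\<forall>x\<in>set ys - S. \<exists>y\<in>S. (x, y) \<in> (links ys I)\<^sup>*)"

lemma links_sym: "(x, y) \<in> links ys I \<Longrightarrow> (y, x) \<in> links ys I"
  by (auto simp: links_def)

text \<open>Besides the step that enters \<open>S\<close>, the part of the path before it is
  recorded as staying outside \<open>S\<close>; that part survives when the entering step is
  deleted.\<close>

lemma first_crossing:
  assumes "(x, y) \<in> R\<^sup>*" "x \<notin> S" "y \<in> S"
  shows "\<exists>p q. (x, p) \<in> (R \<inter> (- S) \<times> (- S))\<^sup>* \<and> (p, q) \<in> R \<and> p \<notin> S \<and> q \<in> S"
  using assms
proof (induction rule: converse_rtrancl_induct)
  case (step x z)
  show ?case
  proof (cases "z \<in> S")
    case True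
    then show ?thesis using step by blast
  next
    case False
    then obtain p q where "(z, p) \<in> (R \<inter> (- S) \<times> (- S))\<^sup>*" "(p, q) \<in> R" "p \<notin> S" "q \<in> S"
      using step by blast
    moreover have "(x, z) \<in> R \<inter> (- S) \<times> (- S)" using step False by auto
    ultimately show ?thesis by (meson converse_rtrancl_into_rtrancl)
  qed
qed simp

lemma attaches_path:
  assumes "v \<in> set ys"
  shows "attaches ys {..<length ys - 1} {v}"
proof -
  let ?R = "(links ys {..<length ys - 1})\<^sup>*"
  have sym: "(y, x) \<in> ?R" if "(x, y) \<in> ?R" for x y
    using that by (induction) (auto intro: converse_rtrancl_into_rtrancl links_sym)
  have fwd: "(ys ! 0, ys ! b) \<in> ?R" if "b < length ys" for b
    using that
  proof (induction b)
    case (Suc b)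
    then have "(ys ! b, ys ! Suc b) \<in> links ys {..<length ys - 1}" by (auto simp: links_def)
    then show ?case using Suc by (auto intro: rtrancl_into_rtrancl)
  qed simp
  have "(x, v) \<in> ?R" if "x \<in> set ys" for x
  proof -
    obtain a where a: "a < length ys" "ys ! a = x" using \<open>x \<in> set ys\<close> by (auto simp: in_set_conv_nth)
    obtain b where b: "b < length ys" "ys ! b = v" using assms by (auto simp: in_set_conv_nth)
    show ?thesis using rtrancl_trans[OF sym[OF fwd[OF a(1)]] fwd[OF b(1)]] a(2) b(2) by simp
  qed
  then show ?thesis by (auto simp: attaches_def)
qed

definition link_len :: "(nat \<Rightarrow> nat \<Rightarrow> real) \<Rightarrow> nat list \<Rightarrow> nat set \<Rightarrow> real" where
  "link_len d ys I = (\<Sum>a\<in>I. d (ys ! a) (ys ! Suc a))"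

lemma link_len_path: "link_len d ys {..<length ys - 1} = pl d ys"
proof (cases "ys = []")
  case False
  then obtain m where m: "length ys = Suc m" by (cases ys) auto
  have "pl d ys = pl d (map ((!) ys) [0..<Suc m])" by (simp only: m[symmetric] map_nth)
  then show ?thesis unfolding pl_map_upt link_len_def by (simp add: m)
qed (simp add: link_len_def)

definition insert_at :: "nat \<Rightarrow> nat \<Rightarrow> nat list \<Rightarrow> nat list" where
  "insert_at p u xs = take (Suc p) xs @ u # drop (Suc p) xs"

context ttp_met begin

text \<open>Prim's exchange step: the first link that leads from \<open>u\<close> into \<open>S\<close> can be given up
  once \<open>u\<close> itself belongs to \<open>S\<close>.\<close>

lemma exchange:
  assumes I: "I \<subseteq> {..<length ys - 1}" and a: "attaches ys I S" and ys: "set ys \<subseteq> {..<n}"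
    and u: "u \<in> set ys" "u \<notin> S"
    and e: "\<And>x y. x \<in> set ys \<Longrightarrow> x \<notin> S \<Longrightarrow> y \<in> S \<Longrightarrow> e \<le> d x y"
  shows "\<exists>I'\<subseteq>I. attaches ys I' (insert u S) \<and> link_len d ys I' + e \<le> link_len d ys I"
proof -
  let ?R = "links ys I \<inter> (- S) \<times> (- S)"
  have inys: "x \<in> set ys" "y \<in> set ys" if "(x, y) \<in> links ys I" for x y
    using that I by (auto simp: links_def less_diff_conv intro!: nth_mem)
  obtain y where "y \<in> S" "(u, y) \<in> (links ys I)\<^sup>*" using a u by (auto simp: attaches_def)
  then obtain p q where pq: "(u, p) \<in> ?R\<^sup>*" "(p, q) \<in> links ys I" "p \<notin> S" "q \<in> S"
    using first_crossing[of u y "links ys I" S] u(2) by blast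
  then obtain f where f: "f \<in> I" "(p, q) = (ys ! f, ys ! Suc f) \<or> (p, q) = (ys ! Suc f, ys ! f)"
    by (auto simp: links_def)
  let ?I = "I - {f}"
  have sub: "?R \<subseteq> links ys ?I"
  proof
    fix z assume "z \<in> ?R"
    then obtain x y g where z: "z = (x, y)" "x \<notin> S" "y \<notin> S" "g \<in> I"
      "(x, y) = (ys ! g, ys ! Suc g) \<or> (x, y) = (ys ! Suc g, ys ! g)"
      by (auto simp: links_def)
    then have "g \<noteq> f" using f(2) pq(4) by auto
    then show "z \<in> links ys ?I" using z by (auto simp: links_def)
  qed
  have R_sym: "(y, x) \<in> ?R\<^sup>*" if "(x, y) \<in> ?R\<^sup>*" for x y
    using that
  proof induction
    case (step y z)
    then have "(z, y) \<in> ?R" using links_sym by auto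
    then show ?case using step by (meson converse_rtrancl_into_rtrancl)
  qed simp
  have R_star: "?R\<^sup>* \<subseteq> (links ys ?I)\<^sup>*" by (rule rtrancl_mono[OF sub])
  have "attaches ys ?I (insert u S)"
    unfolding attaches_def
  proof
    fix x assume x: "x \<in> set ys - insert u S"
    then obtain y where "y \<in> S" "(x, y) \<in> (links ys I)\<^sup>*" using a by (auto simp: attaches_def)
    then obtain p' q' where pq': "(x, p') \<in> ?R\<^sup>*" "(p', q') \<in> links ys I" "p' \<notin> S" "q' \<in> S"
      using first_crossing[of x y "links ys I" S] x by blast
    then obtain g where g: "g \<in> I" "(p', q') = (ys ! g, ys ! Suc g) \<or> (p', q') = (ys ! Suc g, ys ! g)"
      by (auto simp: links_def)
    show "\<exists>y\<in>insert u S. (x, y) \<in> (links ys ?I)\<^sup>*"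
    proof (cases "g = f")
      case True
      \<comment> \<open>A route that enters \<open>S\<close> through the deleted link leaves from
        the same outer end \<open>p\<close>, and \<open>p\<close> is joined to \<open>u\<close>
        outside \<open>S\<close>. Such a route is therefore redirected to \<open>u\<close>.\<close>
      then have "p' = p" using f(2) g(2) pq pq' by auto
      then have "(x, u) \<in> ?R\<^sup>*" using pq'(1) R_sym[OF pq(1)] by (meson rtrancl_trans)
      then show ?thesis using R_star by blast
    next
      case False
      then have "(p', q') \<in> links ys ?I" using g by (auto simp: links_def)
      then have "(x, q') \<in> (links ys ?I)\<^sup>*" using pq'(1) R_star by (meson rtrancl_into_rtrancl subsetD)
      then show ?thesis using pq'(4) by blast
    qed
  qed
  moreover have "link_len d ys ?I + e \<le> link_len d ys I"
  proof -
    have "finite I" using I finite_subset by blast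
    then have "link_len d ys I = d (ys ! f) (ys ! Suc f) + link_len d ys ?I"
      unfolding link_len_def using f(1) by (rule sum.remove)
    moreover have "d (ys ! f) (ys ! Suc f) = d p q"
      using f(2) inys[OF pq(2)] ys sym by auto
    moreover have "e \<le> d p q" using e inys[OF pq(2)] pq by auto
    ultimately show ?thesis by simp
  qed
  ultimately show ?thesis by blast
qed

definition closed_len :: "nat list \<Rightarrow> real" where
  "closed_len xs = pl d (xs @ [hd xs])"

lemma pl_insert:
  assumes "x < n" "y < n" "u < n"
  shows "pl d (a @ x # u # y # b) \<le> pl d (a @ x # y # b) + 2 * d u x"
proof -
  have "d u y \<le> d u x + d x y" "d x u = d u x" using assms tri sym by auto
  then show ?thesis by (simp add: pl_append[of d a x "u # y # b"] pl_append[of d a x "y # b"])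
qed

lemma closed_len_insert:
  assumes "p < length xs" "set xs \<subseteq> {..<n}" "u < n"
  shows "closed_len (insert_at p u xs) \<le> closed_len xs + 2 * d u (xs ! p)"
proof -
  let ?x = "xs ! p"
  have xn: "?x < n" using assms by (meson lessThan_iff nth_mem subsetD)
  have t: "take (Suc p) xs = take p xs @ [?x]" using assms(1) by (simp add: take_Suc_conv_app_nth)
  have hd: "hd (insert_at p u xs) = hd xs" using assms(1) by (cases xs) (auto simp: insert_at_def)
  obtain y b where yb: "drop (Suc p) xs @ [hd xs] = y # b" by (cases "drop (Suc p) xs") auto
  have "y \<in> set (drop (Suc p) xs @ [hd xs])" by (simp add: yb)
  then have "y \<in> set xs" using assms(1) by (cases xs) (auto dest: in_set_dropD)
  then have yn: "y < n" using assms(2) by auto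
  have "xs @ [hd xs] = take p xs @ ?x # y # b"
    using id_take_nth_drop[OF assms(1)] yb by (metis append.assoc append_Cons)
  moreover have "insert_at p u xs @ [hd xs] = take p xs @ ?x # u # y # b"
    using yb by (simp add: insert_at_def t)
  ultimately show ?thesis
    unfolding closed_len_def hd using pl_insert[OF xn yn assms(3)] by simp
qed

text \<open>The links given up so far have paid for the tour; those in \<open>I\<close> are still
  available. The quantification over all walks \<open>ys\<close> covering \<open>V\<close> removes
  any reference to an optimum, so the finished tour can be compared with the walk of every team in
  every schedule.\<close>

definition tour_inv :: "nat set \<Rightarrow> nat list \<Rightarrow> bool" where
  "tour_inv V xs \<longleftrightarrow> distinct xs \<and> xs \<noteq> [] \<and> set xs \<subseteq> V \<and>
     (\<forall>ys. set ys = V \<longrightarrow> (\<exists>I. I \<subseteq> {..<length ys - 1} \<and> attaches ys I (set xs) \<and>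
        closed_len xs + 2 * link_len d ys I \<le> 2 * pl d ys))"

lemma tour_inv_init: "v \<in> V \<Longrightarrow> V \<subseteq> {..<n} \<Longrightarrow> tour_inv V [v]"
proof -
  assume v: "v \<in> V" "V \<subseteq> {..<n}"
  then have "closed_len [v] = 0" using self[of v] by (auto simp: closed_len_def)
  then have "\<exists>I\<subseteq>{..<length ys - 1}. attaches ys I (set [v]) \<and> closed_len [v] + 2 * link_len d ys I \<le> 2 * pl d ys"
    if "set ys = V" for ys
    using attaches_path[of v ys] v(1) that link_len_path[of d ys] by (intro exI[of _ "{..<length ys - 1}"]) auto
  then show ?thesis using v(1) by (simp add: tour_inv_def)
qed

text \<open>Inserting \<open>u\<close> next to its closest tour member costs at most
  \<open>2 * d u (xs ! p)\<close>, and \<open>exchange\<close> releases a link at least as long as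
  \<open>d u (xs ! p)\<close>, which counts twice in the invariant.\<close>

lemma tour_inv_step:
  assumes inv: "tour_inv V xs" and V: "V \<subseteq> {..<n}" and p: "p < length xs" and u: "u \<in> V" "u \<notin> set xs"
    and min: "\<And>x y. x \<in> V \<Longrightarrow> x \<notin> set xs \<Longrightarrow> y \<in> set xs \<Longrightarrow> d u (xs ! p) \<le> d x y"
  shows "tour_inv V (insert_at p u xs)"
proof -
  have set: "set (insert_at p u xs) = insert u (set xs)"
    unfolding insert_at_def by (metis append_take_drop_id list.simps(15) set_append Un_insert_right)
  have dist: "distinct (insert_at p u xs)"
    using inv u unfolding insert_at_def tour_inv_def
    by (auto simp: set_take_disj_set_drop_if_distinct dest: in_set_takeD in_set_dropD)
  show ?thesis
    unfolding tour_inv_def set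
  proof (intro conjI allI impI)
    fix ys assume ys: "set ys = V"
    then obtain I where I: "I \<subseteq> {..<length ys - 1}" "attaches ys I (set xs)"
      "closed_len xs + 2 * link_len d ys I \<le> 2 * pl d ys"
      using inv unfolding tour_inv_def by blast
    obtain I' where I': "I' \<subseteq> I" "attaches ys I' (insert u (set xs))"
      "link_len d ys I' + d u (xs ! p) \<le> link_len d ys I"
      using exchange[OF I(1,2), of u "d u (xs ! p)"] ys V u min by blast
    have "closed_len (insert_at p u xs) \<le> closed_len xs + 2 * d u (xs ! p)"
      using closed_len_insert[OF p, of u] inv V u unfolding tour_inv_def by auto
    then show "\<exists>I. I \<subseteq> {..<length ys - 1} \<and> attaches ys I (insert u (set xs)) \<and>
        closed_len (insert_at p u xs) + 2 * link_len d ys I \<le> 2 * pl d ys"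
      using I I' by (intro exI[of _ I']) auto
  next
    show "distinct (insert_at p u xs)" by (rule dist)
    show "insert u (set xs) \<subseteq> V" using inv u by (simp add: tour_inv_def)
  qed (simp add: insert_at_def)
qed

lemma tour_inv_le:
  assumes "tour_inv V xs" "V \<subseteq> {..<n}" "set ys = V"
  shows "closed_len xs \<le> 2 * pl d ys"
proof -
  obtain I where I: "I \<subseteq> {..<length ys - 1}" "closed_len xs + 2 * link_len d ys I \<le> 2 * pl d ys"
    using assms(1,3) unfolding tour_inv_def by blast
  have "0 \<le> link_len d ys I"
    unfolding link_len_def
  proof (rule sum_nonneg)
    fix a assume "a \<in> I"
    then have "Suc a < length ys" using I(1) by auto
    then have "ys ! a \<in> V" "ys ! Suc a \<in> V" using assms(3) nth_mem[of a ys] nth_mem[of "Suc a" ys] by auto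
    then show "0 \<le> d (ys ! a) (ys ! Suc a)" using assms(2) by (intro nonneg) auto
  qed
  then show ?thesis using I(2) by simp
qed

lemma closed_len_tour:
  assumes "xs \<noteq> []"
  shows "closed_len xs = tour_len (length xs) (\<lambda>a b. d (xs ! a) (xs ! b))"
proof -
  obtain m where m: "length xs = Suc m" using assms by (cases xs) auto
  have "xs @ [hd xs] = map (\<lambda>a. xs ! (a mod Suc m)) [0..<Suc (Suc m)]"
  proof (rule nth_equalityI)
    fix i assume "i < length (xs @ [hd xs])"
    then have "i \<le> Suc m" by (simp add: m)
    then show "(xs @ [hd xs]) ! i = map (\<lambda>a. xs ! (a mod Suc m)) [0..<Suc (Suc m)] ! i"
      using assms by (cases "i = Suc m") (simp_all add: nth_append m hd_conv_nth del: upt_Suc)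
  qed (simp add: m)
  then show ?thesis unfolding closed_len_def by (simp only: pl_map_upt tour_len_def m) simp
qed

end

section \<open>Lower bounds on the cost of an arbitrary feasible schedule\<close>

context ttp_met begin

definition walk :: "schedule \<Rightarrow> nat \<Rightarrow> nat list" where
  "walk s i = map (\<lambda>t. venue s t i) [0..<num_days n]"

lemma remdups_subseq: "subseq (remdups xs) xs" for xs :: "nat list"
  by (induction xs) (auto intro: list_emb.intros)

context
  fixes s :: schedule and k :: nat
  assumes feas: "ttp_feasible n k s" and n2: "2 \<le> n"
begin

lemma set_walk: "i < n \<Longrightarrow> set (walk s i) \<subseteq> {..<n}"
  using venue_less[OF feas] by (auto simp: walk_def)

lemma walk_visits:
  assumes "i < n" "j < n" shows "j \<in> set (i # walk s i)"
proof (cases "i = j")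
  case False
  have "card {t. t < num_days n \<and> fst s t i = j \<and> snd s t j} = 1"
    using feas assms False unfolding ttp_feasible_def Let_def by blast
  then obtain t where "{t. t < num_days n \<and> fst s t i = j \<and> snd s t j} = {t}"
    by (rule card_1_singletonE)
  then have t: "t < num_days n" "fst s t i = j" "snd s t j" by auto
  have "snd s t (fst s t i) = (\<not> snd s t i)"
    using feas assms(1) t(1) unfolding ttp_feasible_def Let_def by blast
  then have "venue s t i = j" using t by (simp add: venue_def)
  then show ?thesis using t(1) by (auto simp: walk_def)
qed simp

lemma cost_walk: "ttp_cost n d s = (\<Sum>i<n. pl d (i # walk s i @ [i]))"
  unfolding ttp_cost_def
proof (rule sum.cong)
  fix i
  obtain M where M: "num_days n = Suc M" using n2 by (cases "num_days n") (auto simp: num_days_def)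
  define f where "f t = venue s t i" for t
  have w: "walk s i = f 0 # map f [1..<Suc M]" "walk s i = map f [0..<M] @ [f M]"
    unfolding walk_def M f_def by (simp add: upt_conv_Cons del: upt_Suc, simp)
  have "pl d (i # walk s i @ [i]) = d i (f 0) + pl d (walk s i @ [i])" by (simp add: w(1))
  also have "pl d (walk s i @ [i]) = pl d (walk s i) + d (f M) i"
    using pl_append[of d "map f [0..<M]" "f M" "[i]"] by (simp add: w(2))
  also have "pl d (walk s i) = (\<Sum>t<M. d (f t) (f (Suc t)))"
    unfolding walk_def M f_def[symmetric] by (rule pl_map_upt)
  finally show "d i (venue s 0 i) + (\<Sum>t<num_days n - 1. d (venue s t i) (venue s (Suc t) i)) +
      d (venue s (num_days n - 1) i) i = pl d (i # walk s i @ [i])"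
    by (simp add: M f_def)
qed simp

lemma cost_nonneg: "0 \<le> ttp_cost n d s"
  unfolding cost_walk using set_walk by (intro sum_nonneg pl_nonneg) auto

lemma twice_total_le: "2 * (\<Sum>i<n. \<Sum>j<n. d i j) \<le> real k * ttp_cost n d s"
proof -
  have bnd: "\<forall>i<n. \<forall>a. a + k < num_days n \<longrightarrow>
      \<not> (\<forall>t\<in>{a..a + k}. snd s t i) \<and> \<not> (\<forall>t\<in>{a..a + k}. \<not> snd s t i)"
    using feas unfolding ttp_feasible_def Let_def by blast
  have "2 * (\<Sum>j<n. d i j) \<le> real k * pl d (i # walk s i @ [i])" if i: "i < n" for i
  proof -
    have "2 * (\<Sum>x\<leftarrow>walk s i. d i x) \<le> real k * pl d (i # walk s i @ [i])"
    proof (rule trips_bound[OF set_walk[OF i] i])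
      \<comment> \<open>A stretch of the walk that avoids \<open>i\<close> and is longer than
        \<open>k\<close> would give \<open>k + 1\<close> consecutive away games.\<close>
      fix ys zs us assume w: "walk s i = ys @ zs @ us" "i \<notin> set zs"
      show "length zs \<le> k"
      proof (rule ccontr)
        assume l: "\<not> length zs \<le> k"
        have len: "length ys + length zs \<le> num_days n"
          using arg_cong[OF w(1), of length] by (simp add: walk_def)
        have "\<not> snd s t i" if t: "t \<in> {length ys..length ys + k}" for t
        proof
          assume h: "snd s t i"
          have tD: "t < num_days n" "t - length ys < length zs" using t l len by auto
          have "walk s i ! t = i" using h tD(1) by (simp add: walk_def venue_def)
          moreover have "walk s i ! t = zs ! (t - length ys)"
            using t tD(2) by (simp add: w(1) nth_append)
          ultimately show False using w(2) tD(2) by (metis nth_mem)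
        qed
        moreover have "length ys + k < num_days n" using l len by linarith
        ultimately show False using bnd[rule_format, OF i, of "length ys"] by blast
      qed
    qed
    moreover have "(\<Sum>x\<leftarrow>walk s i. d i x) = (\<Sum>j<n. d i j)"
      using metric_sum_venue[OF feas met i]
      by (simp add: walk_def interv_sum_list_conv_sum_set_nat o_def lessThan_atLeast0)
    ultimately show ?thesis by simp
  qed
  then have "(\<Sum>i<n. 2 * (\<Sum>j<n. d i j)) \<le> (\<Sum>i<n. real k * pl d (i # walk s i @ [i]))"
    by (intro sum_mono) auto
  then show ?thesis unfolding cost_walk by (simp add: sum_distrib_left)
qed

text \<open>Dropping repeated venues from the walk leaves a tour through all of them, which is no
  longer than the walk by shortcutting; \<open>total_le_tour\<close> applies to it.\<close>

lemma total_le_walk: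
  assumes i: "i < n" and h: "n = 2 * h"
  shows "(\<Sum>i<n. \<Sum>j<n. d i j) \<le> real (h * h) * pl d (i # walk s i @ [i])"
proof -
  define ws where "ws = remdups (filter (\<lambda>x. x \<noteq> i) (walk s i))"
  let ?xs = "i # ws"
  have st: "set ?xs = {..<n}" using walk_visits[OF i] set_walk[OF i] i by (auto simp: ws_def)
  have di: "distinct ?xs" by (simp add: ws_def)
  have ln: "length ?xs = n" using distinct_card[OF di] st by simp
  have "bij_betw ((!) ?xs) {..<n} {..<n}"
    by (rule bij_betw_nth[OF di]) (simp_all only: ln st)
  from total_le_tour[OF this h]
  have "(\<Sum>i<n. \<Sum>j<n. d i j) \<le> real (h * h) * closed_len ?xs"
    using closed_len_tour[of ?xs] unfolding ln by (simp only: list.distinct not_False_eq_True simp_thms)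
  moreover have "closed_len ?xs \<le> pl d (i # walk s i @ [i])"
  proof -
    have "subseq ws (walk s i)"
      unfolding ws_def using remdups_subseq subseq_filter_left subseq_order.trans by blast
    then have "subseq (ws @ [i]) (walk s i @ [i])" by simp
    from pl_subseq_Cons[OF this _ i] show ?thesis using set_walk[OF i] i by (simp add: closed_len_def)
  qed
  ultimately show ?thesis by (meson mult_left_mono of_nat_0_le_iff order_trans)
qed

text \<open>With \<open>T\<close> the sum of all distances, adding \<open>total_le_walk\<close> over
  the \<open>n = 2 * h\<close> teams gives \<open>2 * h * T \<le> h * h * cost\<close>; a factor
  \<open>h\<close> cancels.\<close>

lemma four_total_le: 
  assumes "even n" shows "4 * (\<Sum>i<n. \<Sum>j<n. d i j) \<le> real n * ttp_cost n d s"
proof -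
  obtain h where h: "n = 2 * h" using assms by blast
  have "(\<Sum>a<n. \<Sum>i<n. \<Sum>j<n. d i j) \<le> (\<Sum>a<n. real (h * h) * pl d (a # walk s a @ [a]))"
    using total_le_walk[OF _ h] by (intro sum_mono) auto
  then have "real n * (\<Sum>i<n. \<Sum>j<n. d i j) \<le> real (h * h) * ttp_cost n d s"
    unfolding cost_walk by (simp add: sum_distrib_left)
  then have "real h * (4 * (\<Sum>i<n. \<Sum>j<n. d i j)) \<le> real h * (real n * ttp_cost n d s)"
    by (simp add: h algebra_simps)
  moreover have "0 < real h" using n2 h by simp
  ultimately show ?thesis by (simp only: mult_le_cancel_left_pos)
qed

text \<open>Every team visits all venues, so its walk without \<open>v\<close> is a spanning walk of
  the remaining venues, and \<open>tour_inv_le\<close> applies once for each of the \<open>n\<close>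
  teams.\<close>

lemma tour_le_cost:
  assumes t: "tour_inv ({..<n} - {v}) xs"
  shows "real n * closed_len xs \<le> 2 * ttp_cost n d s"
proof -
  have "closed_len xs \<le> 2 * pl d (i # walk s i @ [i])" if i: "i < n" for i
  proof -
    let ?ys = "filter (\<lambda>x. x \<noteq> v) (i # walk s i)"
    have "set ?ys = {..<n} - {v}" using walk_visits[OF i] set_walk[OF i] i by auto
    then have "closed_len xs \<le> 2 * pl d ?ys" using tour_inv_le[OF t] by auto
    also have "pl d ?ys \<le> pl d ((i # walk s i) @ [i])"
      using set_walk[OF i] i by (intro pl_subseq) (auto intro: list_emb_append2 subseq_order.trans[OF subseq_filter_left])
    finally show ?thesis by simp
  qed
  then have "(\<Sum>i<n. closed_len xs) \<le> (\<Sum>i<n. 2 * pl d (i # walk s i @ [i]))" by (intro sum_mono) auto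
  then show ?thesis unfolding cost_walk by (simp add: sum_distrib_left)
qed

end

end

section \<open>Averaging over the rotations of the tour, and the two ratios\<close>

lemma sum_day_len_rotations:
  fixes f :: "nat \<Rightarrow> nat \<Rightarrow> real"
  assumes N: "odd N"
  shows "(\<Sum>r<N. day_len N (\<lambda>i j. f ((i + r) mod N) ((j + r) mod N)) t) = (\<Sum>x<N. \<Sum>y<N. f x y)"
proof -
  have N0: "0 < N" using N odd_pos by blast
  define S where "S e = (\<Sum>x<N. f x ((x + e) mod N))" for e
  define D where "D i = (t + 2 * (N - i)) mod N" for i
  \<comment> \<open>For a fixed label, the rotations run exactly through the pairs at the fixed
    offset \<open>D i\<close>, which is \<open>t - 2 * i\<close> modulo \<open>N\<close>.\<close>
  have A: "(\<Sum>r<N. f ((i + r) mod N) ((cj N t i + r) mod N)) = S (D i)" if i: "i < N" for i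
  proof -
    have "S (D i) = (\<Sum>r<N. f ((r + i) mod N) (((r + i) mod N + D i) mod N))"
      unfolding S_def by (rule sum.reindex_bij_betw[OF bij_rot[OF N0], symmetric])
    also have "\<dots> = (\<Sum>r<N. f ((i + r) mod N) ((cj N t i + r) mod N))"
    proof (rule sum.cong)
      fix r
      have "((r + i) mod N + D i) mod N = (r + i + (t + 2 * (N - i))) mod N"
        by (simp add: D_def mod_add_eq)
      also have "r + i + (t + 2 * (N - i)) = (t + (N - i) + r) + N" using i by simp
      also have "\<dots> mod N = (cj N t i + r) mod N" by (simp add: cj_def mod_add_left_eq)
      finally show "f ((r + i) mod N) (((r + i) mod N + D i) mod N) = f ((i + r) mod N) ((cj N t i + r) mod N)"
        by (simp add: add.commute)
    qed simp
    finally show ?thesis ..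
  qed
  \<comment> \<open>Doubling is injective modulo an odd number, so different labels have different
    offsets and together they exhaust all pairs.\<close>
  have inj: "inj_on D {..<N}"
  proof (rule linorder_inj_onI)
    fix i j assume ij: "i < j" "i \<in> {..<N}" "j \<in> {..<N}"
    show "D i \<noteq> D j"
    proof
      assume "D i = D j"
      then have "N dvd (t + 2 * (N - i)) - (t + 2 * (N - j))"
        using ij unfolding D_def by (subst mod_eq_dvd_iff_nat[symmetric]) auto
      moreover have "(t + 2 * (N - i)) - (t + 2 * (N - j)) = 2 * (j - i)" using ij by auto
      moreover have "coprime N 2" using N by (simp add: coprime_commute)
      ultimately have "N dvd j - i" by (simp add: coprime_dvd_mult_right_iff)
      then show False using ij by (auto dest: dvd_imp_le)
    qed
  qed auto
  then have bij: "bij_betw D {..<N} {..<N}"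
    using N0 by (intro bij_betw_imageI endo_inj_surj) (auto simp: D_def)
  have "(\<Sum>r<N. day_len N (\<lambda>i j. f ((i + r) mod N) ((j + r) mod N)) t)
      = (\<Sum>i<N. \<Sum>r<N. f ((i + r) mod N) ((cj N t i + r) mod N))"
    unfolding day_len_def by (rule sum.swap)
  also have "\<dots> = (\<Sum>i<N. S (D i))" using A by (intro sum.cong) auto
  also have "\<dots> = (\<Sum>e<N. S e)" by (rule sum.reindex_bij_betw[OF bij])
  also have "\<dots> = (\<Sum>x<N. \<Sum>e<N. f x ((x + e) mod N))" unfolding S_def by (rule sum.swap)
  also have "\<dots> = (\<Sum>x<N. \<Sum>y<N. f x y)"
  proof (rule sum.cong)
    fix x
    show "(\<Sum>e<N. f x ((x + e) mod N)) = (\<Sum>y<N. f x y)"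
      using sum.reindex_bij_betw[OF bij_rot[OF N0, of x], of "f x"] by (simp add: add.commute)
  qed simp
  finally show ?thesis .
qed

lemma tour_len_rotate:
  fixes f :: "nat \<Rightarrow> nat \<Rightarrow> real"
  assumes "0 < N"
  shows "tour_len N (\<lambda>i j. f ((i + r) mod N) ((j + r) mod N)) = tour_len N f"
proof -
  have "tour_len N f = (\<Sum>a<N. f ((a + r) mod N) (Suc ((a + r) mod N) mod N))"
    unfolding tour_len_def by (rule sum.reindex_bij_betw[OF bij_rot[OF assms], symmetric])
  also have "\<dots> = tour_len N (\<lambda>i j. f ((i + r) mod N) ((j + r) mod N))"
    unfolding tour_len_def by (intro sum.cong refl arg_cong2[where f = f]) (simp_all add: mod_Suc_eq mod_add_left_eq)
  finally show ?thesis ..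
qed

text \<open>The final estimates, with \<open>X\<close> the cost of a competing schedule, \<open>T\<close> the sum of all distances,
  \<open>S\<close> the distance sum of the special team and \<open>q\<close> the number of blocks.\<close>

lemma ratio_four:
  fixes N c L G S T X :: real
  assumes N: "1 \<le> N" and X: "0 \<le> X" and c: "c \<le> (N - 2) * L + G + 4 * S" and G: "N * G \<le> 4 * (T - 2 * S)"
    and S: "(N + 1) * S \<le> T" and L: "(N + 1) * L \<le> 2 * X" and T: "4 * T \<le> (N + 1) * X" and N2: "2 \<le> N"
  shows "c \<le> 4 * X"
proof -
  have "N * ((N + 1) * c) \<le> N * ((N + 1) * ((N - 2) * L + G + 4 * S))"
    using N c by (intro mult_left_mono) auto
  also have "\<dots> = N * (N - 2) * ((N + 1) * L) + (N + 1) * (N * G) + 4 * N * ((N + 1) * S)"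
    by (simp add: algebra_simps)
  also have "\<dots> \<le> N * (N - 2) * (2 * X) + (N + 1) * (4 * (T - 2 * S)) + 4 * N * ((N + 1) * S)"
    using N N2 G L by (intro add_mono order_refl mult_left_mono) auto
  also have "\<dots> = N * (N - 2) * (2 * X) + 4 * (N + 1) * T + (4 * N - 8) * ((N + 1) * S)"
    by (simp add: algebra_simps)
  also have "\<dots> \<le> N * (N - 2) * (2 * X) + 4 * (N + 1) * T + (4 * N - 8) * T"
    using N2 S by (intro add_mono order_refl mult_left_mono) auto
  also have "\<dots> = N * (N - 2) * (2 * X) + (2 * N - 1) * (4 * T)" by (simp add: algebra_simps)
  also have "\<dots> \<le> N * (N - 2) * (2 * X) + (2 * N - 1) * ((N + 1) * X)"
    using N T by (intro add_mono order_refl mult_left_mono) auto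
  also have "\<dots> = N * ((N + 1) * (4 * X)) - (7 * N + 1) * X" by (simp add: algebra_simps)
  also have "\<dots> \<le> N * ((N + 1) * (4 * X))" using N X by simp
  finally show ?thesis using N by simp
qed

text \<open>After multiplication by \<open>N * (N + 1)\<close>, the tours contribute at most
  \<open>2 * N * N\<close>, the boundaries \<open>(2 * N - 1) * (N + 1)\<close> because of
  \<open>q * k \<le> 2 * N - 1\<close>, and the special team \<open>(N - 1) * N\<close> because of
  \<open>2 * k \<le> N - 1\<close>. The three add up to \<open>5 * N * N - 1\<close>, which stays
  below \<open>5 * N * (N + 1)\<close>.\<close>

lemma ratio_five:
  fixes N c L G S T X k q :: real
  assumes N: "1 \<le> N" and X: "0 \<le> X" and c: "c \<le> (N - q) * L + G + 4 * S" and G: "N * G \<le> 2 * q * (T - 2 * S)"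
    and S: "(N + 1) * S \<le> T" and L: "(N + 1) * L \<le> 2 * X" and T: "2 * T \<le> k * X"
    and q: "0 \<le> q" "q \<le> N" "q * k \<le> 2 * N - 1" and k: "0 \<le> k" "2 * k \<le> N - 1"
  shows "c \<le> 5 * X"
proof -
  have "N * ((N + 1) * c) \<le> N * ((N + 1) * ((N - q) * L + G + 4 * S))"
    using N c by (intro mult_left_mono) auto
  also have "\<dots> = N * (N - q) * ((N + 1) * L) + (N + 1) * (N * G) + 4 * N * ((N + 1) * S)"
    by (simp add: algebra_simps)
  also have "\<dots> \<le> N * (N - q) * (2 * X) + (N + 1) * (2 * q * (T - 2 * S)) + 4 * N * ((N + 1) * S)"
    using N q G L by (intro add_mono order_refl mult_left_mono) auto
  also have "\<dots> = N * (N - q) * (2 * X) + 2 * q * (N + 1) * T + 4 * (N - q) * ((N + 1) * S)"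
    by (simp add: algebra_simps)
  also have "\<dots> \<le> N * (N - q) * (2 * X) + 2 * q * (N + 1) * T + 4 * (N - q) * T"
    using q S by (intro add_mono order_refl mult_left_mono) auto
  also have "\<dots> = N * (N - q) * (2 * X) + (q * (N + 1) + 2 * (N - q)) * (2 * T)" by (simp add: algebra_simps)
  also have "\<dots> \<le> N * (N - q) * (2 * X) + (q * (N + 1) + 2 * (N - q)) * (k * X)"
    using N q T by (intro add_mono order_refl mult_left_mono) auto
  also have "\<dots> = (2 * N * (N - q) + (q * k) * (N + 1) + (2 * k) * (N - q)) * X" by (simp add: algebra_simps)
  also have "\<dots> \<le> (2 * N * N + (2 * N - 1) * (N + 1) + (N - 1) * N) * X"
    using N q k X by (intro mult_right_mono add_mono mult_mono) auto
  also have "\<dots> = N * ((N + 1) * (5 * X)) - (5 * N + 1) * X" by (simp add: algebra_simps)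
  also have "\<dots> \<le> N * ((N + 1) * (5 * X))" using N X by simp
  finally show ?thesis using N by simp
qed

definition label :: "nat \<Rightarrow> nat list \<Rightarrow> nat \<Rightarrow> nat \<Rightarrow> nat \<Rightarrow> nat" where
  "label N xs v r i = (if i = N then v else xs ! ((i + r) mod N))"

text \<open>The boundary term of \<open>circle_cost\<close> once the tour has been turned by
  \<open>r\<close>. It is the only part of that bound which depends on \<open>r\<close>, and the
  program minimises it.\<close>

definition switch_cost :: "(nat \<Rightarrow> nat \<Rightarrow> real) \<Rightarrow> nat \<Rightarrow> nat list \<Rightarrow> nat set \<Rightarrow> nat \<Rightarrow> real" where
  "switch_cost d N xs B r = (\<Sum>b\<in>B. day_len N (\<lambda>i j. d (xs ! ((i + r) mod N)) (xs ! ((j + r) mod N))) (b + N - 1)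
     + day_len N (\<lambda>i j. d (xs ! ((i + r) mod N)) (xs ! ((j + r) mod N))) b)"

lemma label_bij:
  assumes "length xs = N" "distinct xs" "set xs = {..<Suc N} - {v}" "v < Suc N" "0 < N"
  shows "bij_betw (label N xs v r) {..<Suc N} {..<Suc N}"
proof -
  have "bij_betw (\<lambda>i. xs ! ((i + r) mod N)) {..<N} (set xs)"
    using bij_betw_trans[OF bij_rot[OF assms(5)] bij_betw_nth[OF assms(2)]] assms(1) by (simp add: o_def)
  then have "bij_betw (label N xs v r) {..<N} (set xs)"
    by (rule bij_betw_cong[THEN iffD1, rotated]) (simp add: label_def)
  then have comb: "bij_betw (label N xs v r) ({..<N} \<union> {N}) (set xs \<union> {v})"
    by (rule bij_betw_combine) (use assms in \<open>auto simp: label_def bij_betw_def\<close>)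
  have "v \<in> {..<Suc N}" using assms(4) by simp
  then have e: "set xs \<union> {v} = {..<Suc N}" unfolding assms(3) by blast
  have e': "{..<N} \<union> {N} = {..<Suc N}" by auto
  show ?thesis using comb unfolding e e' .
qed

theorem block_schedule_ratio:
  assumes bl: "blocks N k B" and met: "ttp_metric (Suc N) d"
    and xs: "ttp_met.tour_inv d ({..<Suc N} - {v}) xs" "length xs = N" and v: "v < Suc N"
    and vmin: "\<forall>u<Suc N. (\<Sum>j<Suc N. d v j) \<le> (\<Sum>j<Suc N. d u j)"
    and r: "r < N" "\<forall>r'<N. switch_cost d N xs B r \<le> switch_cost d N xs B r'"
    and s': "relabels (Suc N) (label N xs v r) (copp N, chome N (blk_orient N B)) s'"
    and q: "N \<le> 2 * k \<longrightarrow> card B = 2" "card B < N" "card B * k \<le> N + 2 * k - 1"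
    and x: "ttp_feasible (Suc N) k x"
  shows "ttp_feasible (Suc N) k s'"
    "Suc N \<le> 2 * k \<Longrightarrow> ttp_cost (Suc N) d s' \<le> 4 * ttp_cost (Suc N) d x"
    "\<not> Suc N \<le> 2 * k \<Longrightarrow> ttp_cost (Suc N) d s' \<le> 5 * ttp_cost (Suc N) d x"
proof -
  interpret blocks N k B by (rule bl)
  interpret ttp_met "Suc N" d by unfold_locales (rule met)
  let ?n = "Suc N"
  let ?s = "(copp N, chome N (blk_orient N B))"
  have N0: "0 < N" using N by simp
  show "ttp_feasible ?n k s'" by (rule relabel_feasible[OF s' blocks_feasible])
  define \<tau> where "\<tau> = label N xs v r"
  have dist: "distinct xs" and sub: "set xs \<subseteq> {..<?n} - {v}" using xs(1) by (auto simp: tour_inv_def)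
  have st: "set xs = {..<?n} - {v}"
    using sub distinct_card[OF dist] xs(2) v by (intro card_subset_eq) auto
  have bij: "bij_betw \<tau> {..<?n} {..<?n}" unfolding \<tau>_def using label_bij[OF xs(2) dist st v N0] .
  have \<tau>l: "\<tau> i < ?n" if "i < ?n" for i using bij that by (auto simp: bij_betw_def)
  let ?d = "\<lambda>i j. d (\<tau> i) (\<tau> j)"
  have m: "ttp_metric ?n ?d" using met \<tau>l unfolding ttp_metric_def by auto
  define f where "f i j = d (xs ! i) (xs ! j)" for i j
  have fr: "?d i j = f ((i + r) mod N) ((j + r) mod N)" if "i < N" "j < N" for i j
    using that by (simp add: \<tau>_def label_def f_def)
  have keep: "blk_orient N B (Suc t) i = blk_orient N B t i"
    if "Suc t < N" "Suc t \<notin> B" "i < N" "cj N t i \<noteq> i" "cj N (Suc t) i \<noteq> i" for t i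
    using orient_keep[of t i] that by simp
  have "ttp_cost ?n ?d ?s \<le> (real N - real (card B)) * tour_len N ?d
      + (\<Sum>b\<in>B. day_len N ?d (b + N - 1) + day_len N ?d b) + 4 * (\<Sum>i<N. ?d i N)"
    by (rule circle_cost[OF N blocks_feasible m orient_shift B(1,2) keep])
  moreover have "ttp_cost ?n d s' = ttp_cost ?n ?d ?s"
    unfolding \<tau>_def using relabel_cost[OF s' blocks_feasible] N by simp
  moreover have "tour_len N ?d = closed_len xs"
  proof -
    have "tour_len N ?d = tour_len N (\<lambda>i j. f ((i + r) mod N) ((j + r) mod N))"
      unfolding tour_len_def using fr N0 by (intro sum.cong) auto
    also have "\<dots> = tour_len N f" by (rule tour_len_rotate[OF N0])
    also have "\<dots> = closed_len xs"
      using closed_len_tour[of xs] xs(2) N0 unfolding f_def by auto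
    finally show ?thesis .
  qed
  moreover have "day_len N ?d t = day_len N (\<lambda>i j. f ((i + r) mod N) ((j + r) mod N)) t" for t
    unfolding day_len_def using fr cj_less by (intro sum.cong) auto
  then have "(\<Sum>b\<in>B. day_len N ?d (b + N - 1) + day_len N ?d b) = switch_cost d N xs B r"
    by (simp add: switch_cost_def f_def)
  moreover define S where "S = (\<Sum>j<?n. d v j)"
  have nv: "d a v = d v a" if "a < ?n" for a using sym[OF that v] .
  have Srem: "(\<Sum>j\<in>{..<?n} - {v}. d v j) = S" unfolding S_def
    using v self[OF v] by (subst sum.remove[of "{..<?n}" v]) auto
  have sumxs: "(\<Sum>i<N. g (xs ! i)) = (\<Sum>j\<in>{..<?n} - {v}. g j)" for g :: "nat \<Rightarrow> real"
    using sum.reindex_bij_betw[OF bij_betw_nth[OF dist], of "{..<N}" "set xs" g] xs(2) st by simp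
  have "(\<Sum>i<N. ?d i N) = S"
  proof -
    have "(\<Sum>i<N. ?d i N) = (\<Sum>i<N. d (xs ! ((i + r) mod N)) v)"
      by (intro sum.cong) (auto simp: \<tau>_def label_def)
    also have "\<dots> = (\<Sum>i<N. d (xs ! i) v)"
      by (rule sum.reindex_bij_betw[OF bij_rot[OF N0], of "\<lambda>i. d (xs ! i) v"])
    also have "\<dots> = (\<Sum>j\<in>{..<?n} - {v}. d j v)" by (rule sumxs)
    also have "\<dots> = (\<Sum>j\<in>{..<?n} - {v}. d v j)" using nv by (intro sum.cong) auto
    finally show ?thesis using Srem by simp
  qed
  ultimately have c: "ttp_cost ?n d s' \<le> (real N - real (card B)) * closed_len xs + switch_cost d N xs B r + 4 * S"
    by simp
  define T where "T = (\<Sum>i<?n. \<Sum>j<?n. d i j)"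
  \<comment> \<open>Deleting the row and the column of \<open>v\<close> from the distance matrix
    removes \<open>S\<close> twice; the diagonal entry is 0.\<close>
  have xy: "(\<Sum>x<N. \<Sum>y<N. f x y) = T - 2 * S"
  proof -
    have "(\<Sum>x<N. \<Sum>y<N. f x y) = (\<Sum>x<N. \<Sum>j\<in>{..<?n} - {v}. d (xs ! x) j)"
      unfolding f_def by (intro sum.cong refl sumxs)
    also have "\<dots> = (\<Sum>i\<in>{..<?n} - {v}. \<Sum>j\<in>{..<?n} - {v}. d i j)" by (rule sumxs)
    also have "\<dots> = (\<Sum>i\<in>{..<?n} - {v}. (\<Sum>j<?n. d i j) - d v i)"
      using v nv by (intro sum.cong) (auto simp: sum_diff1)
    also have "\<dots> = (\<Sum>i\<in>{..<?n} - {v}. \<Sum>j<?n. d i j) - S" by (simp add: sum_subtractf Srem)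
    also have "(\<Sum>i\<in>{..<?n} - {v}. \<Sum>j<?n. d i j) = T - S"
      unfolding T_def S_def using v by (simp add: sum_diff1)
    finally show ?thesis by simp
  qed
  \<comment> \<open>The best rotation is no worse than the average, and each of the
    \<open>2 * card B\<close> day sums adds up to \<open>T - 2 * S\<close> over all
    rotations.\<close>
  have G: "real N * switch_cost d N xs B r \<le> 2 * real (card B) * (T - 2 * S)"
  proof -
    have "(\<Sum>r'<N. switch_cost d N xs B r) \<le> (\<Sum>r'<N. switch_cost d N xs B r')"
      using r(2) by (intro sum_mono) auto
    also have "\<dots> = (\<Sum>b\<in>B. (\<Sum>r'<N. day_len N (\<lambda>i j. f ((i + r') mod N) ((j + r') mod N)) (b + N - 1))
        + (\<Sum>r'<N. day_len N (\<lambda>i j. f ((i + r') mod N) ((j + r') mod N)) b))"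
      unfolding switch_cost_def f_def by (subst sum.swap) (simp add: sum.distrib)
    also have "\<dots> = (\<Sum>b\<in>B. 2 * (T - 2 * S))"
      using sum_day_len_rotations[OF N(1), of f] xy by simp
    finally show ?thesis by (simp add: algebra_simps)
  qed
  have Sn: "(real N + 1) * S \<le> T"
  proof -
    have "(\<Sum>u<?n. S) \<le> T" unfolding T_def S_def by (rule sum_mono) (use vmin in simp)
    then show ?thesis by (simp add: algebra_simps)
  qed
  have L: "(real N + 1) * closed_len xs \<le> 2 * ttp_cost ?n d x"
    using tour_le_cost[OF x _ xs(1)] N by (simp add: add.commute)
  have X: "0 \<le> ttp_cost ?n d x" using cost_nonneg[OF x] N by simp
  have even: "even ?n" using N by simp
  have N1: "1 \<le> real N" using N by simp
  { assume k4: "?n \<le> 2 * k"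
    have "4 * T \<le> (real N + 1) * ttp_cost ?n d x"
      using four_total_le[OF x _ even] N by (simp add: T_def add.commute)
    note T = this
    have q2: "card B = 2" using q(1) k4 by simp
    have c': "ttp_cost ?n d s' \<le> (real N - 2) * closed_len xs + switch_cost d N xs B r + 4 * S"
      and G': "real N * switch_cost d N xs B r \<le> 4 * (T - 2 * S)"
      using c G unfolding q2 by (simp_all only: of_nat_numeral mult_numeral_left_semiring_numeral numeral_times_numeral semiring_norm)
    show "ttp_cost ?n d s' \<le> 4 * ttp_cost ?n d x"
      by (rule ratio_four[OF N1 X c' G' Sn L T]) (use N in simp) }
  { assume k5: "\<not> ?n \<le> 2 * k"
    have T: "2 * T \<le> real k * ttp_cost ?n d x"
      using twice_total_le[OF x] N by (simp add: T_def)
    have "card B * k \<le> 2 * N - 1" using q(3) k5 by simp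
    then have "real (card B * k) \<le> real (2 * N - 1)" by (simp only: of_nat_le_iff)
    then have qk: "real (card B) * real k \<le> 2 * real N - 1" using N0 by (simp add: of_nat_diff)
    \<comment> \<open>By parity: \<open>2 * k \<le> N\<close> and \<open>N\<close> is odd.\<close>
    have "2 * k + 1 \<le> N" using k5 N(1) by presburger
    then have k2: "2 * real k \<le> real N - 1" by linarith
    show "ttp_cost ?n d s' \<le> 5 * ttp_cost ?n d x"
      by (rule ratio_five[OF N1 X c G Sn L T _ _ qk _ k2]) (use q(2) in simp_all) }
qed

text \<open>\<open>ttp_OPT\<close> is an infimum, so a bound against every competing schedule
  suffices; \<open>s\<close> only witnesses that there is one.\<close>

lemma le_OPT:
  assumes "ttp_feasible n k s" "0 < c" "\<And>x. ttp_feasible n k x \<Longrightarrow> A \<le> c * ttp_cost n d x"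
  shows "A \<le> c * ttp_OPT n k d"
proof -
  have "A / c \<le> ttp_OPT n k d"
    unfolding ttp_OPT_def
  proof (rule cInf_greatest)
    show "{ttp_cost n d s |s. ttp_feasible n k s} \<noteq> {}" using assms(1) by blast
    fix y assume "y \<in> {ttp_cost n d s |s. ttp_feasible n k s}"
    then obtain x where "ttp_feasible n k x" "y = ttp_cost n d x" by blast
    then show "A / c \<le> y" using assms(2,3) by (simp add: divide_le_eq mult.commute)
  qed
  then show ?thesis using assms(2) by (simp add: divide_le_eq mult.commute)
qed

section \<open>The program\<close>

notation NAdd (infixl \<open>[+]\<close> 65)
notation NSub (infixl \<open>[-]\<close> 65)
notation Seq (infixr \<open>;;\<close> 55)

text \<open>Variables: 0 \<open>n\<close>, 1 \<open>k\<close>, 2 size of the output, 3 \<open>N = n - 1\<close>, 4 special team, 5 rotation, 6 mode.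
  Arrays: 0 opponents, 1 home flags, 2 multiples of \<open>n\<close>, 3 tour, 4 scratch, 5 tour members, 6 block starts,
  7 team of a label, 8 residues modulo \<open>N\<close>.\<close>

definition p_rows :: com where
  "p_rows = NSet 3 (NV 0 [-] NC 1) ;; NSet 10 (NC 0) ;;
     For 11 (NStore 2 (NV 11) (NV 10) ;; NSet 10 (NV 10 [+] NV 0)) ;;
     NSet 2 (NA 2 (NV 3) [+] NA 2 (NV 3))"

definition p_residues :: com where
  "p_residues = For 11 (IfLe (NV 11 [+] NC 1) (NV 3)
     (NStore 8 (NV 11) (NV 11) ;; NStore 8 (NV 11 [+] NV 3) (NV 11) ;;
      NStore 8 (NV 11 [+] NV 3 [+] NV 3) (NV 11) ;; NStore 8 (NV 11 [+] NV 3 [+] NV 3 [+] NV 3) (NV 11)) Skip)"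

text \<open>Entries of row 0 may have been lost to the scratch registers. They are read off column
  0, and the zero at the corner is written explicitly.\<close>

definition p_first_row :: com where
  "p_first_row = For 11 (RLoad 0 (NA 2 (NV 11)) ;; RStore (NV 11) 0) ;; RZero 0 ;; RStore (NC 0) 0"

definition p_special :: com where
  "p_special = For 11 (RZero 0 ;; For 12 (RLoad 1 (NA 2 (NV 11) [+] NV 12) ;; RAdd 0 0 1) ;;
     IfLe (NV 11) (NC 0) (RMov 2 0 ;; NSet 4 (NV 11)) (IfRLe 2 0 Skip (RMov 2 0 ;; NSet 4 (NV 11))))"

text \<open>Variable 13 tells whether any candidate has been seen, which takes the place of an
  infinite initial distance. The candidate team is in 14 and its closest tour position in
  15.\<close>

definition p_search :: com where
  "p_search = NSet 13 (NC 0) ;;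
     For 11 (IfLe (NA 5 (NV 11)) (NC 0)
       (For 12 (IfLe (NV 12 [+] NC 1) (NV 16)
         (RLoad 0 (NA 2 (NV 11) [+] NA 3 (NV 12)) ;;
          IfLe (NV 13) (NC 0)
            (RMov 1 0 ;; NSet 13 (NC 1) ;; NSet 14 (NV 11) ;; NSet 15 (NV 12))
            (IfRLe 1 0 Skip (RMov 1 0 ;; NSet 14 (NV 11) ;; NSet 15 (NV 12))))
         Skip)) Skip)"

definition p_insert :: com where
  "p_insert = For 11 (IfLe (NV 11) (NV 15) (NStore 4 (NV 11) (NA 3 (NV 11)))
       (IfLe (NV 11) (NV 15 [+] NC 1) (NStore 4 (NV 11) (NV 14)) (NStore 4 (NV 11) (NA 3 (NV 11 [-] NC 1))))) ;;
     For 11 (NStore 3 (NV 11) (NA 4 (NV 11))) ;;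
     NStore 5 (NV 14) (NC 1) ;; NSet 16 (NV 16 [+] NC 1)"

text \<open>Truncated subtraction makes \<open>1 - v\<close> equal to 1 for \<open>v = 0\<close> and
  to 0 otherwise, in any case a team other than the special one. Marking the special team in array 5
  keeps it out of the tour.\<close>

definition p_tour :: com where
  "p_tour = NStore 5 (NV 4) (NC 1) ;; NSet 14 (NC 1 [-] NV 4) ;; NStore 5 (NV 14) (NC 1) ;;
     NStore 3 (NC 0) (NV 14) ;; NSet 16 (NC 1) ;;
     For 10 (IfLe (NV 16 [+] NC 1) (NV 3) (p_search ;; p_insert) Skip)"

text \<open>The number of blocks is the least even \<open>q \<ge> 2\<close> with
  \<open>q * k \<ge> N\<close>. Then each block is made as long as possible, subject to the bound
  \<open>k\<close> and to leaving two days for every later block.\<close>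

definition p_blocks :: com where
  "p_blocks = NSet 13 (NC 2) ;; NSet 14 (NV 1 [+] NV 1) ;;
     For 11 (IfLe (NV 14 [+] NC 1) (NV 3) (NSet 13 (NV 13 [+] NC 2) ;; NSet 14 (NV 14 [+] NV 1 [+] NV 1)) Skip) ;;
     NSet 14 (NC 0) ;; NSet 15 (NV 3) ;;
     For 11 (IfLe (NC 1) (NV 13)
       (NStore 6 (NV 14) (NC 1) ;; NSet 13 (NV 13 [-] NC 1) ;; NSet 16 (NV 15 [-] NV 13 [-] NV 13) ;;
        IfLe (NV 1) (NV 16) (NSet 16 (NV 1)) Skip ;;
        NSet 14 (NV 14 [+] NV 16) ;; NSet 15 (NV 15 [-] NV 16)) Skip)"

definition p_rotation :: com where
  "p_rotation = For 10 (IfLe (NV 10 [+] NC 1) (NV 3)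
     (RZero 0 ;;
      For 11 (IfLe (NV 11 [+] NC 1) (NV 3) (IfLe (NC 1) (NA 6 (NV 11))
        (For 12 (IfLe (NV 12 [+] NC 1) (NV 3)
          (NSet 13 (NA 2 (NA 3 (NA 8 (NV 12 [+] NV 10)))) ;;
           NSet 14 (NA 8 (NV 11 [+] NV 3 [-] NC 1 [+] (NV 3 [-] NV 12))) ;;
           RLoad 1 (NV 13 [+] NA 3 (NA 8 (NV 14 [+] NV 10))) ;; RAdd 0 0 1 ;;
           NSet 14 (NA 8 (NV 11 [+] (NV 3 [-] NV 12))) ;;
           RLoad 1 (NV 13 [+] NA 3 (NA 8 (NV 14 [+] NV 10))) ;; RAdd 0 0 1) Skip)) Skip) Skip) ;;
      IfLe (NV 10) (NC 0) (RMov 2 0 ;; NSet 5 (NV 10)) (IfRLe 2 0 Skip (RMov 2 0 ;; NSet 5 (NV 10)))) Skip)"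

definition p_labels :: com where
  "p_labels = For 11 (IfLe (NV 11 [+] NC 1) (NV 3) (NStore 7 (NV 11) (NA 3 (NA 8 (NV 11 [+] NV 5)))) (NStore 7 (NV 11) (NV 4)))"

text \<open>Every day is declared a block start, so the parity toggled by \<open>p_days\<close> is
  the parity of the day; in mode 1 this yields \<open>alt_orient\<close>. Both kinds of schedule are
  thus written by the same code.\<close>

definition p_trivial :: com where
  "p_trivial = For 11 (NStore 7 (NV 11) (NV 11) ;; NStore 6 (NV 11) (NC 1)) ;; NSet 6 (NC 1)"

definition p_main :: com where
  "p_main = p_special ;; p_tour ;; p_blocks ;; p_rotation ;; p_labels"

text \<open>Writes the entry of label \<open>NV 13\<close> on day \<open>NV 10\<close> (opponent \<open>NV 14\<close>, home flag \<open>NV 15\<close>) and its mirror image.\<close>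

definition p_entry :: com where
  "p_entry = NSet 16 (NA 2 (NV 10) [+] NA 7 (NV 13)) ;;
     NStore 0 (NV 16) (NA 7 (NV 14)) ;; NStore 1 (NV 16) (NV 15) ;;
     NSet 16 (NV 16 [+] NA 2 (NV 3)) ;;
     NStore 0 (NV 16) (NA 7 (NV 14)) ;; NStore 1 (NV 16) (NC 1 [-] NV 15)"

text \<open>\<open>NV 18\<close> becomes the side of \<open>NV 17\<close>: in mode 0 whether the phase lies below \<open>N\<close>, corrected at block starts.\<close>

definition p_side :: com where
  "p_side = NSet 17 (NV 10 [+] (NV 3 [-] NV 11) [+] (NV 3 [-] NV 11)) ;;
     IfLe (NV 6) (NC 0)
       (NSet 18 (NC 0) ;; IfLe (NV 17 [+] NC 1) (NV 3) (NSet 18 (NC 1)) Skip ;;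
        IfLe (NV 3 [+] NV 3) (NV 17) (NSet 18 (NC 1)) Skip ;;
        IfLe (NC 1) (NA 6 (NV 10)) (IfLe (NV 14) (NV 11) (IfLe (NV 11) (NV 14) (NSet 18 (NC 1 [-] NV 18)) Skip) Skip) Skip)
       (NSet 18 (NC 0) ;; IfLe (NV 3) (NA 8 (NV 17) [+] NA 8 (NV 17)) (NSet 18 (NC 1)) Skip)"

text \<open>Writes the entry of label \<open>NV 11\<close> only; its opponent has a round of its
  own. The special label has none, so the label on the axis, recognised by being its own partner,
  writes the special entry too.\<close>

definition p_game :: com where
  "p_game = NSet 14 (NA 8 (NV 10 [+] (NV 3 [-] NV 11))) ;; p_side ;;
     IfLe (NC 1) (NV 18) (NSet 19 (NC 1 [-] NV 20)) (NSet 19 (NV 20)) ;;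
     IfLe (NV 14) (NV 11) (IfLe (NV 11) (NV 14)
       (NSet 13 (NV 3) ;; NSet 15 (NV 19) ;; p_entry ;; NSet 14 (NV 3)) Skip) Skip ;;
     NSet 13 (NV 11) ;; NSet 15 (NC 1 [-] NV 19) ;; p_entry"

definition p_days :: com where
  "p_days = NSet 20 (NC 1) ;;
     For 10 (IfLe (NV 10 [+] NC 1) (NV 3)
       (IfLe (NC 1) (NA 6 (NV 10)) (NSet 20 (NC 1 [-] NV 20)) Skip ;;
        For 11 (IfLe (NV 11 [+] NC 1) (NV 3) p_game Skip)) Skip)"

definition table :: "nat \<Rightarrow> nat list \<Rightarrow> com" where
  "table a vs = foldr (\<lambda>(i, v) c. NStore a (NC i) (NC v) ;; c) (zip [0..<length vs] vs) Skip"

definition p_four :: com where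
  "p_four = table 0 (concat opp4) ;; table 1 (concat home4)"

text \<open>Four parked entries are wanted by \<open>unstash_code\<close>; a loop always has
  \<open>n\<close> rounds, so \<open>n\<close> of them are parked.\<close>

definition p_stash :: com where
  "p_stash = For 11 (NStore 0 (NV 2 [+] NV 11) (NA 0 (NV 11)) ;; NStore 1 (NV 2 [+] NV 11) (NA 1 (NV 11)))"

definition p_all :: com where
  "p_all = p_rows ;; p_residues ;; p_first_row ;;
     IfLe (NV 0) (NC 4) p_four
       (IfLe (NV 0) (NC 8) p_trivial (IfLe (NV 1) (NC 4) p_trivial p_main) ;; p_days) ;;
     p_stash"

lemmas prog_defs = p_rows_def p_residues_def p_first_row_def p_special_def p_search_def p_insert_def p_tour_def
  p_blocks_def p_rotation_def p_labels_def p_trivial_def p_main_def p_entry_def p_side_def p_game_def p_days_def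
  p_four_def p_stash_def

lemma table_wf: "a < 15 \<Longrightarrow> cwf (table a vs)" "loop_depth (table a vs) = 0"
proof -
  have "a < 15 \<Longrightarrow> cwf (foldr (\<lambda>(i, v) c. NStore a (NC i) (NC v) ;; c) ps Skip) \<and>
     loop_depth (foldr (\<lambda>(i, v) c. NStore a (NC i) (NC v) ;; c) ps Skip) = 0" for ps
    by (induction ps) auto
  moreover have "loop_depth (foldr (\<lambda>(i, v) c. NStore a (NC i) (NC v) ;; c) ps Skip) = 0" for ps
    by (induction ps) auto
  ultimately show "a < 15 \<Longrightarrow> cwf (table a vs)" "loop_depth (table a vs) = 0" by (auto simp: table_def)
qed

lemma p_all_wf: "cwf p_all" "loop_depth p_all \<le> 8"
  by (simp_all add: p_all_def prog_defs table_wf)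

subsection \<open>Reasoning about programs\<close>

lemma nset_sel [simp]: "nv (nset x v s) = (nv s)(x := v)" "na (nset x v s) = na s" "rv (nset x v s) = rv s" "ra (nset x v s) = ra s"
  by (simp_all add: nset_def)

text \<open>The syntactic write set: natural scalars, natural arrays, real scalars, and whether the
  real array may change. With \<open>frame\<close> the preservation of everything else is settled by
  simplification.\<close>

fun mods :: "com \<Rightarrow> nat set \<times> nat set \<times> nat set \<times> bool" where
  "mods (NSet x e) = ({x}, {}, {}, False)"
| "mods (NStore a e f) = ({}, {a}, {}, False)"
| "mods (RZero x) = ({}, {}, {x}, False)"
| "mods (RMov x y) = ({}, {}, {x}, False)"
| "mods (RAdd x y z) = ({}, {}, {x}, False)"
| "mods (RLoad x e) = ({}, {}, {x}, False)"
| "mods (RStore e x) = ({}, {}, {}, True)"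
| "mods Skip = ({}, {}, {}, False)"
| "mods (Seq c c') = (case (mods c, mods c') of ((a, b, e, f), (a', b', e', f')) \<Rightarrow> (a \<union> a', b \<union> b', e \<union> e', f \<or> f'))"
| "mods (IfLe e1 e2 c c') = (case (mods c, mods c') of ((a, b, e, f), (a', b', e', f')) \<Rightarrow> (a \<union> a', b \<union> b', e \<union> e', f \<or> f'))"
| "mods (IfRLe x y c c') = (case (mods c, mods c') of ((a, b, e, f), (a', b', e', f')) \<Rightarrow> (a \<union> a', b \<union> b', e \<union> e', f \<or> f'))"
| "mods (For x c) = (case mods c of (a, b, e, f) \<Rightarrow> (insert x a, b, e, f))"

lemma frame:
  "(x \<notin> fst (mods c) \<longrightarrow> nv (exec n c s) x = nv s x) \<and>
   (a \<notin> fst (snd (mods c)) \<longrightarrow> na (exec n c s) a = na s a) \<and>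
   (y \<notin> fst (snd (snd (mods c))) \<longrightarrow> rv (exec n c s) y = rv s y) \<and>
   (\<not> snd (snd (snd (mods c))) \<longrightarrow> ra (exec n c s) = ra s)"
proof (induction c arbitrary: s)
  case (For z c)
  obtain A B E F where m: "mods c = (A, B, E, F)" by (cases "mods c") auto
  have "(x \<notin> insert z A \<longrightarrow> nv (fold (\<lambda>v s. exec n c (nset z v s)) vs s) x = nv s x) \<and>
   (a \<notin> B \<longrightarrow> na (fold (\<lambda>v s. exec n c (nset z v s)) vs s) a = na s a) \<and>
   (y \<notin> E \<longrightarrow> rv (fold (\<lambda>v s. exec n c (nset z v s)) vs s) y = rv s y) \<and>
   (\<not> F \<longrightarrow> ra (fold (\<lambda>v s. exec n c (nset z v s)) vs s) = ra s)" for vs s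
  proof (induction vs arbitrary: s)
    case (Cons v vs)
    then show ?case using For.IH[of "nset z v s"] by (auto simp: m)
  qed simp
  then show ?case by (simp add: m)
next
  case (Seq c c')
  obtain A B E F where m: "mods c = (A, B, E, F)" by (cases "mods c") auto
  obtain A' B' E' F' where m': "mods c' = (A', B', E', F')" by (cases "mods c'") auto
  show ?case using Seq.IH(1)[of s] Seq.IH(2)[of "exec n c s"] by (auto simp: m m')
next
  case (IfLe e f c c')
  obtain A B E F where m: "mods c = (A, B, E, F)" by (cases "mods c") auto
  obtain A' B' E' F' where m': "mods c' = (A', B', E', F')" by (cases "mods c'") auto
  show ?case using IfLe.IH(1)[of s] IfLe.IH(2)[of s] by (auto simp: m m')
next
  case (IfRLe e f c c')
  obtain A B E F where m: "mods c = (A, B, E, F)" by (cases "mods c") auto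
  obtain A' B' E' F' where m': "mods c' = (A', B', E', F')" by (cases "mods c'") auto
  show ?case using IfRLe.IH(1)[of s] IfRLe.IH(2)[of s] by (auto simp: m m')
qed (auto simp: nset_def)

lemmas frame_nv = frame[THEN conjunct1, rule_format]
  and frame_na = frame[THEN conjunct2, THEN conjunct1, rule_format]
  and frame_ra = frame[THEN conjunct2, THEN conjunct2, THEN conjunct2, rule_format]

lemma For_inv:
  assumes "I 0 s" "\<And>v s. v < n \<Longrightarrow> I v s \<Longrightarrow> I (Suc v) (exec n c (nset x v s))"
  shows "I n (exec n (For x c) s)"
proof -
  have "I j (fold (\<lambda>v s. exec n c (nset x v s)) [0..<j] s)" if "j \<le> n" for j
    using that by (induction j) (use assms in auto)
  then show ?thesis by simp
qed

declare exec.simps(12) [simp del]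

section \<open>Tables and the restored distance matrix\<close>

definition base :: "nat \<Rightarrow> (nat \<Rightarrow> nat \<Rightarrow> real) \<Rightarrow> st \<Rightarrow> bool" where
  "base N d s \<longleftrightarrow> nv s 0 = Suc N \<and> nv s 3 = N \<and> (\<forall>i\<le>N. na s 2 i = i * Suc N) \<and>
     (\<forall>x<4 * N. na s 8 x = x mod N) \<and> (\<forall>i\<le>N. \<forall>j\<le>N. ra s (i * Suc N + j) = d i j)"

lemma base_frame:
  assumes "base N d s" "0 \<notin> fst (mods c)" "3 \<notin> fst (mods c)" "2 \<notin> fst (snd (mods c))" "8 \<notin> fst (snd (mods c))"
    "\<not> snd (snd (snd (mods c)))"
  shows "base N d (exec n c s)"
  using assms frame_nv[of 0 c n s] frame_nv[of 3 c n s] frame_na[of 2 c n s] frame_na[of 8 c n s] frame_ra[of c n s]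
  by (simp add: base_def)

lemma base_nset: "base N d s \<Longrightarrow> x \<noteq> 0 \<Longrightarrow> x \<noteq> 3 \<Longrightarrow> base N d (nset x v s)"
  by (simp add: base_def)

lemma rows_spec:
  assumes "nv s 0 = Suc N"
  defines "s' \<equiv> exec (Suc N) p_rows s"
  shows "nv s' 3 = N" "nv s' 2 = 2 * N * Suc N" "\<forall>i\<le>N. na s' 2 i = i * Suc N"
proof -
  let ?b = "NStore 2 (NV 11) (NV 10) ;; NSet 10 (NV 10 [+] NV 0)"
  define s1 where "s1 = nset 10 0 (nset 3 N s)"
  define s2 where "s2 = exec (Suc N) (For 11 ?b) s1"
  have I: "nv s2 0 = Suc N \<and> nv s2 3 = N \<and> nv s2 10 = Suc N * Suc N \<and> (\<forall>i<Suc N. na s2 2 i = i * Suc N)"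
    unfolding s2_def
    by (rule For_inv[where I = "\<lambda>j s. nv s 0 = Suc N \<and> nv s 3 = N \<and> nv s 10 = j * Suc N \<and> (\<forall>i<j. na s 2 i = i * Suc N)"])
      (auto simp: s1_def assms(1) less_Suc_eq)
  have "s' = nset 2 (na s2 2 N + na s2 2 N) s2"
    using I by (simp add: s'_def p_rows_def s2_def s1_def assms(1))
  then show "nv s' 3 = N" "nv s' 2 = 2 * N * Suc N" "\<forall>i\<le>N. na s' 2 i = i * Suc N"
    using I by (simp_all add: less_Suc_eq_le)
qed

lemma residues_spec:
  assumes "nv s 3 = N"
  shows "\<forall>x<4 * N. na (exec (Suc N) p_residues s) 8 x = x mod N"
proof -
  have I: "nv (exec (Suc N) p_residues s) 3 = N \<and> (\<forall>i<Suc N. i < N \<longrightarrow> (let s' = exec (Suc N) p_residues s in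
     na s' 8 i = i \<and> na s' 8 (i + N) = i \<and> na s' 8 (i + N + N) = i \<and> na s' 8 (i + N + N + N) = i))"
    unfolding p_residues_def Let_def
    by (rule For_inv[where I = "\<lambda>j s. nv s 3 = N \<and> (\<forall>i<j. i < N \<longrightarrow>
       na s 8 i = i \<and> na s 8 (i + N) = i \<and> na s 8 (i + N + N) = i \<and> na s 8 (i + N + N + N) = i)"])
      (auto simp: assms less_Suc_eq)
  show ?thesis
  proof (intro allI impI)
    fix x assume x: "x < 4 * N"
    define i where "i = x mod N"
    define c where "c = x div N"
    have i: "i < N" using x by (simp add: i_def)
    have xc: "x = i + c * N" by (simp add: i_def c_def)
    have "c < 4" using x by (simp add: c_def less_mult_imp_div_less)
    then consider "c = 0" | "c = 1" | "c = 2" | "c = 3" by linarith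
    then have "x = i \<or> x = i + N \<or> x = i + N + N \<or> x = i + N + N + N" using xc by cases auto
    then have "na (exec (Suc N) p_residues s) 8 x = i" using I i unfolding Let_def by auto
    then show "na (exec (Suc N) p_residues s) 8 x = x mod N" by (simp add: i_def)
  qed
qed

text \<open>\<open>N \<ge> 9\<close> means that a row has at least ten entries, so the indices below
  10, where \<open>D\<close> is silent, all lie in row 0. Column 0 below the corner is intact, and
  symmetry does the rest.\<close>

lemma first_row_spec:
  assumes row: "\<forall>i\<le>N. na s 2 i = i * Suc N" and N: "9 \<le> N" and m: "ttp_metric (Suc N) d"
    and D: "\<And>x. 10 \<le> x \<Longrightarrow> x < Suc N * Suc N \<Longrightarrow> ra s x = d (x div Suc N) (x mod Suc N)"
  shows "\<forall>i\<le>N. \<forall>j\<le>N. ra (exec (Suc N) p_first_row s) (i * Suc N + j) = d i j"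
proof -
  let ?b = "RLoad 0 (NA 2 (NV 11)) ;; RStore (NV 11) 0"
  define s2 where "s2 = exec (Suc N) (For 11 ?b) s"
  have I: "na s2 2 = na s 2 \<and> (\<forall>x. Suc N \<le> x \<longrightarrow> x < Suc N * Suc N \<longrightarrow> ra s2 x = d (x div Suc N) (x mod Suc N)) \<and>
     (\<forall>i<Suc N. 0 < i \<longrightarrow> ra s2 i = d i 0)"
    unfolding s2_def
  proof (rule For_inv[where I = "\<lambda>j s'. na s' 2 = na s 2 \<and> (\<forall>x. Suc N \<le> x \<longrightarrow> x < Suc N * Suc N \<longrightarrow> ra s' x = d (x div Suc N) (x mod Suc N)) \<and>
     (\<forall>i<j. 0 < i \<longrightarrow> ra s' i = d i 0)"], goal_cases)
    case 1
    then show ?case using D N by auto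
  next
    case (2 v s')
    have v: "na s' 2 v = v * Suc N" using 2 row by simp
    have "ra s' (v * Suc N) = d v 0" if "0 < v"
    proof -
      have "Suc N \<le> v * Suc N" using that by (cases v) auto
      moreover have "v * Suc N < Suc N * Suc N" using 2(1) mult_less_cancel2 by blast
      moreover have "v * Suc N div Suc N = v" "v * Suc N mod Suc N = 0" by (simp_all only: nonzero_mult_div_cancel_right mod_mult_self2_is_0)
      ultimately show ?thesis using 2(2) by metis
    qed
    moreover define t where "t = exec (Suc N) ?b (nset 11 v s')"
    moreover have "ra t = (ra s')(v := ra s' (v * Suc N))" "na t 2 = na s' 2" using v by (simp_all add: t_def)
    ultimately show ?case unfolding t_def[symmetric] using 2 by (auto simp: less_Suc_eq simp del: mult_Suc mult_Suc_right)
  qed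
  define s' where "s' = exec (Suc N) p_first_row s"
  have s': "ra s' = (ra s2)(0 := 0)" by (simp add: s'_def p_first_row_def s2_def)
  show ?thesis
    unfolding s'_def[symmetric]
  proof (intro allI impI)
    fix i j assume ij: "i \<le> N" "j \<le> N"
    consider "i = 0" "j = 0" | "i = 0" "0 < j" | "0 < i" by auto
    then show "ra s' (i * Suc N + j) = d i j"
    proof cases
      case 1 then show ?thesis using s' m by (simp add: ttp_metric_def)
    next
      case 2
      then have "d j 0 = d 0 j" using m ij by (auto simp: ttp_metric_def)
      then show ?thesis using s' I 2 ij by auto
    next
      case 3
      have le: "Suc N \<le> i * Suc N" using 3 by (cases i) auto
      have "i * Suc N \<le> N * Suc N" using ij by (intro mult_right_mono) auto
      then have lt: "i * Suc N + j < Suc N * Suc N" using ij by simp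
      have "(i * Suc N + j) div Suc N = i" "(i * Suc N + j) mod Suc N = j"
        using ij by (simp_all del: mult_Suc mult_Suc_right)
      moreover have "ra s' (i * Suc N + j) = ra s2 (i * Suc N + j)" using s' 3 by simp
      moreover have "Suc N \<le> i * Suc N + j" using le by linarith
      ultimately show ?thesis using I lt by metis
    qed
  qed
qed

section \<open>Choosing the special team and building the tour\<close>

lemma special_spec:
  assumes b: "base N d s"
  defines "s' \<equiv> exec (Suc N) p_special s"
  shows "nv s' 4 \<le> N" "\<forall>u\<le>N. (\<Sum>j<Suc N. d (nv s' 4) j) \<le> (\<Sum>j<Suc N. d u j)"
proof -
  let ?r = "For 12 (RLoad 1 (NA 2 (NV 11) [+] NV 12) ;; RAdd 0 0 1)"
  define S where "S u = (\<Sum>j<Suc N. d u j)" for u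
  have row: "rv (exec (Suc N) ?r s) 0 = rv s 0 + S (nv s 11)"
    if "base N d s" "nv s 11 \<le> N" for s
  proof -
    have "base N d (exec (Suc N) ?r s) \<and> nv (exec (Suc N) ?r s) 11 = nv s 11 \<and>
       rv (exec (Suc N) ?r s) 0 = rv s 0 + (\<Sum>j<Suc N. d (nv s 11) j)"
      by (rule For_inv[where I = "\<lambda>j s'. base N d s' \<and> nv s' 11 = nv s 11 \<and> rv s' 0 = rv s 0 + (\<Sum>j<j. d (nv s 11) j)"])
        (use that in \<open>auto simp: base_def\<close>)
    then show ?thesis by (simp add: S_def)
  qed
  have "base N d s' \<and> (0 < Suc N \<longrightarrow> nv s' 4 < Suc N \<and> rv s' 2 = S (nv s' 4) \<and> (\<forall>u<Suc N. S (nv s' 4) \<le> S u))"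
    unfolding s'_def p_special_def
  proof (rule For_inv[where I = "\<lambda>j s'. base N d s' \<and> (0 < j \<longrightarrow> nv s' 4 < j \<and> rv s' 2 = S (nv s' 4) \<and> (\<forall>u<j. S (nv s' 4) \<le> S u))"], goal_cases)
    case 1 then show ?case using b by simp
  next
    case (2 v s1)
    define s2 where "s2 = exec (Suc N) (RZero 0) (nset 11 v s1)"
    define s3 where "s3 = exec (Suc N) ?r s2"
    have b2: "base N d s2" "nv s2 11 = v" "rv s2 0 = 0" "nv s2 4 = nv s1 4" "rv s2 2 = rv s1 2"
      using 2(2) by (simp_all add: s2_def base_def)
    have b3: "base N d s3" unfolding s3_def using b2(1) by (rule base_frame) auto
    have s3: "rv s3 0 = S v" using row[OF b2(1)] 2(1) b2 by (simp add: s3_def)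
    have f3: "nv s3 11 = v" "nv s3 4 = nv s1 4" "rv s3 2 = rv s1 2"
      using frame_nv[of 11 ?r "Suc N" s2] frame_nv[of 4 ?r "Suc N" s2] b2
        frame[THEN conjunct2, THEN conjunct2, THEN conjunct1, rule_format, of 2 ?r "Suc N" s2]
      by (simp_all add: s3_def)
    let ?f = "IfLe (NV 11) (NC 0) (RMov 2 0 ;; NSet 4 (NV 11)) (IfRLe 2 0 Skip (RMov 2 0 ;; NSet 4 (NV 11)))"
    have bt: "base N d (exec (Suc N) ?f s3)" using b3 by (rule base_frame) auto
    show ?case
      unfolding exec.simps(9)
      unfolding s2_def[symmetric] s3_def[symmetric]
    proof (intro conjI impI bt)
      have "if v = 0 then True else nv s1 4 < v \<and> rv s1 2 = S (nv s1 4) \<and> (\<forall>u<v. S (nv s1 4) \<le> S u)"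
        using 2(2) by auto
      then show "nv (exec (Suc N) ?f s3) 4 < Suc v" "rv (exec (Suc N) ?f s3) 2 = S (nv (exec (Suc N) ?f s3) 4)"
        "\<forall>u<Suc v. S (nv (exec (Suc N) ?f s3) 4) \<le> S u"
        using s3 f3 by (cases "v = 0"; cases "rv s1 2 \<le> S v"; force simp: less_Suc_eq)+
    qed
  qed
  then show "nv s' 4 \<le> N" "\<forall>u\<le>N. (\<Sum>j<Suc N. d (nv s' 4) j) \<le> (\<Sum>j<Suc N. d u j)"
    unfolding S_def[symmetric] by (auto simp: less_Suc_eq_le)
qed

text \<open>\<open>P\<close> is the set of pairs of a team and a tour position examined so far;
  variable 13 records whether it is empty.\<close>

definition best :: "(nat \<Rightarrow> nat \<Rightarrow> real) \<Rightarrow> (nat \<Rightarrow> nat) \<Rightarrow> (nat \<times> nat) set \<Rightarrow> st \<Rightarrow> bool" where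
  "best d c P s \<longleftrightarrow> (if nv s 13 = 0 then P = {} else
     (nv s 14, nv s 15) \<in> P \<and> rv s 1 = d (nv s 14) (c (nv s 15)) \<and> (\<forall>(u, p)\<in>P. rv s 1 \<le> d u (c p)))"

lemma best_nset: "x \<notin> {13, 14, 15} \<Longrightarrow> best d c P (nset x v s) = best d c P s"
  by (simp add: best_def)

text \<open>The innermost body of \<open>p_search\<close>, named so that the two loops around it can
  be treated one at a time.\<close>

definition p_try :: com where
  "p_try = RLoad 0 (NA 2 (NV 11) [+] NA 3 (NV 12)) ;;
          IfLe (NV 13) (NC 0)
            (RMov 1 0 ;; NSet 13 (NC 1) ;; NSet 14 (NV 11) ;; NSet 15 (NV 12))
            (IfRLe 1 0 Skip (RMov 1 0 ;; NSet 14 (NV 11) ;; NSet 15 (NV 12)))"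

lemma try_best:
  assumes b: "base N d s" "best d (na s 3) P s" and le: "nv s 11 \<le> N" "na s 3 (nv s 12) \<le> N"
  shows "best d (na s 3) (insert (nv s 11, nv s 12) P) (exec (Suc N) p_try s)"
proof -
  have D: "ra s (na s 2 (nv s 11) + na s 3 (nv s 12)) = d (nv s 11) (na s 3 (nv s 12))"
    using b(1) le unfolding base_def by metis
  consider "nv s 13 = 0" | "nv s 13 \<noteq> 0" "rv s 1 \<le> d (nv s 11) (na s 3 (nv s 12))"
    | "nv s 13 \<noteq> 0" "\<not> rv s 1 \<le> d (nv s 11) (na s 3 (nv s 12))" by blast
  then show ?thesis
  proof cases
    case 3
    then show ?thesis using b(2) unfolding p_try_def best_def by (auto simp: D)
  qed (use b(2) in \<open>auto simp: p_try_def best_def D\<close>)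
qed

definition searching :: "nat \<Rightarrow> (nat \<Rightarrow> nat \<Rightarrow> real) \<Rightarrow> nat \<Rightarrow> (nat \<Rightarrow> nat) \<Rightarrow> (nat \<Rightarrow> nat) \<Rightarrow> st \<Rightarrow> bool" where
  "searching N d l c g s \<longleftrightarrow> base N d s \<and> nv s 16 = l \<and> na s 3 = c \<and> na s 5 = g"

lemma searching_frame:
  assumes "searching N d l c g s" "fst (mods e) \<inter> {0, 3, 16} = {}" "fst (snd (mods e)) \<inter> {2, 3, 5, 8} = {}"
    "\<not> snd (snd (snd (mods e)))"
  shows "searching N d l c g (exec (Suc N) e s)"
  using assms base_frame[of N d s e] frame_nv[of 16 e "Suc N" s] frame_na[of 3 e "Suc N" s] frame_na[of 5 e "Suc N" s]
  by (auto simp: searching_def)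

lemma searching_nset: "searching N d l c g s \<Longrightarrow> x \<notin> {0, 3, 16} \<Longrightarrow> searching N d l c g (nset x v s)"
  by (simp add: searching_def base_nset)

lemma search_spec:
  assumes s: "searching N d l c g s" and l: "l \<le> N" "\<And>p. p < l \<Longrightarrow> c p \<le> N"
  shows "best d c {(u, p). u \<le> N \<and> g u = 0 \<and> p < l} (exec (Suc N) p_search s)"
proof -
  let ?in = "For 12 (IfLe (NV 12 [+] NC 1) (NV 16) p_try Skip)"
  have inner: "best d c (P \<union> {(nv s 11, p) |p. p < l}) (exec (Suc N) ?in s)"
    if "searching N d l c g s" "best d c P s" "nv s 11 \<le> N" for s P
  proof -
    let ?I = "\<lambda>j s'. searching N d l c g s' \<and> nv s' 11 = nv s 11 \<and> best d c (P \<union> {(nv s 11, p) |p. p < min j l}) s'"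
    have "?I (Suc N) (exec (Suc N) ?in s)"
    proof (rule For_inv[where I = ?I], goal_cases)
      case 1 then show ?case using that by simp
    next
      case (2 v s')
      define s2 where "s2 = nset 12 v s'"
      have s2: "searching N d l c g s2" "nv s2 11 = nv s 11" "nv s2 12 = v"
        "best d c (P \<union> {(nv s 11, p) |p. p < min v l}) s2"
        using 2 searching_nset[of N d l c g s' 12 v] by (simp_all add: s2_def best_nset)
      show ?case
        unfolding s2_def[symmetric]
      proof (cases "v < l")
        case True
        have "best d (na s2 3) (insert (nv s2 11, nv s2 12) (P \<union> {(nv s 11, p) |p. p < min v l})) (exec (Suc N) p_try s2)"
          using s2 True l that(3) by (intro try_best) (auto simp: searching_def)
        moreover have "insert (nv s2 11, nv s2 12) (P \<union> {(nv s 11, p) |p. p < min v l}) = P \<union> {(nv s 11, p) |p. p < min (Suc v) l}"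
          using True s2 by (auto simp: less_Suc_eq)
        moreover have "searching N d l c g (exec (Suc N) p_try s2)"
          using s2(1) by (rule searching_frame) (auto simp: p_try_def)
        moreover have "nv (exec (Suc N) p_try s2) 11 = nv s 11"
          using frame_nv[of 11 p_try "Suc N" s2] s2 by (simp add: p_try_def)
        moreover have "exec (Suc N) (IfLe (NV 12 [+] NC 1) (NV 16) p_try Skip) s2 = exec (Suc N) p_try s2"
          using True s2 by (simp add: searching_def)
        ultimately show "?I (Suc v) (exec (Suc N) (IfLe (NV 12 [+] NC 1) (NV 16) p_try Skip) s2)"
          using s2(1) by (simp add: searching_def)
      next
        case False
        then have "min v l = min (Suc v) l" by auto
        moreover have "exec (Suc N) (IfLe (NV 12 [+] NC 1) (NV 16) p_try Skip) s2 = s2"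
          using False s2 by (simp add: searching_def)
        ultimately show "?I (Suc v) (exec (Suc N) (IfLe (NV 12 [+] NC 1) (NV 16) p_try Skip) s2)"
          using s2 by simp
      qed
    qed
    then show ?thesis using l(1) by (simp add: min_def)
  qed
  let ?P = "\<lambda>j. {(u, p). u < j \<and> g u = 0 \<and> p < l}"
  let ?I = "\<lambda>j s'. searching N d l c g s' \<and> best d c (?P j) s'"
  have "?I (Suc N) (exec (Suc N) (For 11 (IfLe (NA 5 (NV 11)) (NC 0) ?in Skip)) (nset 13 0 s))"
  proof (rule For_inv[where I = ?I], goal_cases)
    case 1 then show ?case using s searching_nset[OF s, of 13 0] by (simp add: best_def)
  next
    case (2 v s')
    define s2 where "s2 = nset 11 v s'"
    have s2: "searching N d l c g s2" "nv s2 11 = v" "best d c (?P v) s2"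
      using 2 searching_nset[of N d l c g s' 11 v] by (simp_all add: s2_def best_nset)
    have e: "exec (Suc N) (IfLe (NA 5 (NV 11)) (NC 0) ?in Skip) s2 = (if g v = 0 then exec (Suc N) ?in s2 else s2)"
      using s2 by (simp add: searching_def)
    show ?case
    proof (cases "g v = 0")
      case True
      have "?P v \<union> {(nv s2 11, p) |p. p < l} = ?P (Suc v)" using True s2(2) by (auto simp: less_Suc_eq)
      then have "best d c (?P (Suc v)) (exec (Suc N) ?in s2)"
        using inner[OF s2(1,3)] s2(2) 2(1) by simp
      moreover have "searching N d l c g (exec (Suc N) ?in s2)"
        using s2(1) by (rule searching_frame) (auto simp: p_try_def)
      ultimately show ?thesis using e True by (simp add: s2_def)
    next
      case False
      then have "?P (Suc v) = ?P v" by (auto simp: less_Suc_eq)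
      then show ?thesis using e False s2 by (simp add: s2_def)
    qed
  qed
  moreover have "{(u, p). u < Suc N \<and> g u = 0 \<and> p < l} = {(u, p). u \<le> N \<and> g u = 0 \<and> p < l}"
    by (auto simp: less_Suc_eq_le)
  ultimately show ?thesis by (simp add: p_search_def p_try_def)
qed

lemma insert_spec:
  assumes s: "base N d s" "nv s 16 < N" "nv s 15 < nv s 16" "xs = map (na s 3) [0..<nv s 16]"
  defines "s' \<equiv> exec (Suc N) p_insert s"
  shows "base N d s'" "nv s' 16 = Suc (nv s 16)" "map (na s' 3) [0..<nv s' 16] = insert_at (nv s 15) (nv s 14) xs"
    "na s' 5 = (na s 5)(nv s 14 := 1)" "nv s' 4 = nv s 4"
proof -
  let ?l1 = "For 11 (IfLe (NV 11) (NV 15) (NStore 4 (NV 11) (NA 3 (NV 11)))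
       (IfLe (NV 11) (NV 15 [+] NC 1) (NStore 4 (NV 11) (NV 14)) (NStore 4 (NV 11) (NA 3 (NV 11 [-] NC 1)))))"
  let ?l2 = "For 11 (NStore 3 (NV 11) (NA 4 (NV 11)))"
  let ?p = "nv s 15" and ?u = "nv s 14" and ?c = "na s 3"
  define h where "h i = (if i \<le> ?p then ?c i else if i \<le> ?p + 1 then ?u else ?c (i - 1))" for i
  define s1 where "s1 = exec (Suc N) ?l1 s"
  have 1: "nv s1 15 = ?p \<and> nv s1 14 = ?u \<and> na s1 3 = ?c \<and> (\<forall>i<Suc N. na s1 4 i = h i)"
    unfolding s1_def
    by (rule For_inv[where I = "\<lambda>j s'. nv s' 15 = ?p \<and> nv s' 14 = ?u \<and> na s' 3 = ?c \<and> (\<forall>i<j. na s' 4 i = h i)"])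
      (auto simp: h_def less_Suc_eq)
  define s2 where "s2 = exec (Suc N) ?l2 s1"
  have 2: "na s2 4 = na s1 4 \<and> (\<forall>i<Suc N. na s2 3 i = na s1 4 i)"
    unfolding s2_def
    by (rule For_inv[where I = "\<lambda>j s'. na s' 4 = na s1 4 \<and> (\<forall>i<j. na s' 3 i = na s1 4 i)"])
      (auto simp: less_Suc_eq)
  have fr: "nv s2 x = nv s x" if "x \<noteq> 11" for x
    using frame_nv[of x "?l1 ;; ?l2" "Suc N" s] that by (simp add: s2_def s1_def)
  have fa: "na s2 5 = na s 5"
    using frame_na[of 5 "?l1 ;; ?l2" "Suc N" s] by (simp add: s2_def s1_def)
  have s': "s' = exec (Suc N) (NStore 5 (NV 14) (NC 1) ;; NSet 16 (NV 16 [+] NC 1)) s2"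
    by (simp add: s'_def p_insert_def s2_def s1_def)
  show "base N d s'" unfolding s'_def using s(1) by (rule base_frame) (auto simp: p_insert_def)
  show l: "nv s' 16 = Suc (nv s 16)" by (simp add: s' fr)
  show "na s' 5 = (na s 5)(?u := 1)" by (simp add: s' fr fa)
  show "nv s' 4 = nv s 4" by (simp add: s' fr)
  have c: "na s' 3 i = h i" if "i \<le> N" for i using 1 2 that by (simp add: s')
  show "map (na s' 3) [0..<nv s' 16] = insert_at ?p ?u xs"
  proof (rule nth_equalityI)
    have len: "length xs = nv s 16" by (simp add: s(4))
    then show "length (map (na s' 3) [0..<nv s' 16]) = length (insert_at ?p ?u xs)"
      using s(3) by (simp add: l insert_at_def)
    fix i assume "i < length (map (na s' 3) [0..<nv s' 16])"
    then have i: "i \<le> nv s 16" by (simp add: l)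
    then have "map (na s' 3) [0..<nv s' 16] ! i = h i" using c[of i] s(2) by (simp add: l del: upt_Suc)
    moreover have "Suc (i - 2) = i - Suc 0" if "\<not> i < Suc ?p" "i \<noteq> Suc ?p" using that by linarith
    then have "h i = insert_at ?p ?u xs ! i"
      using s(3) i len by (auto simp: h_def insert_at_def nth_append s(4) nth_Cons' min_def)
    ultimately show "map (na s' 3) [0..<nv s' 16] ! i = insert_at ?p ?u xs ! i" by (simp only:)
  qed
qed

definition touring :: "nat \<Rightarrow> (nat \<Rightarrow> nat \<Rightarrow> real) \<Rightarrow> nat \<Rightarrow> nat \<Rightarrow> st \<Rightarrow> bool" where
  "touring N d v l s \<longleftrightarrow> base N d s \<and> nv s 4 = v \<and> nv s 16 = l \<and>
     ttp_met.tour_inv d ({..<Suc N} - {v}) (map (na s 3) [0..<l]) \<and>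
     (\<forall>u\<le>N. na s 5 u = 0 \<longleftrightarrow> u \<noteq> v \<and> u \<notin> set (map (na s 3) [0..<l]))"

lemma touring_step:
  assumes met: "ttp_metric (Suc N) d" and t: "touring N d v l s" and l: "l < N" and v: "v \<le> N"
  shows "touring N d v (Suc l) (exec (Suc N) (p_search ;; p_insert) s)"
proof -
  interpret ttp_met "Suc N" d by unfold_locales (rule met)
  let ?c = "na s 3" and ?V = "{..<Suc N} - {v}"
  let ?xs = "map ?c [0..<l]"
  have b: "base N d s" "nv s 4 = v" "nv s 16 = l" "tour_inv ?V ?xs"
    and g: "\<And>u. u \<le> N \<Longrightarrow> na s 5 u = 0 \<longleftrightarrow> u \<noteq> v \<and> u \<notin> set ?xs"
    using t unfolding touring_def by auto
  have xs: "distinct ?xs" "?xs \<noteq> []" "set ?xs \<subseteq> ?V" using b(4) by (auto simp: tour_inv_def)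
  have c: "?c p \<le> N" if "p < l" for p
  proof -
    have "?c p \<in> set ?xs" using that by auto
    then show ?thesis using xs(3) by auto
  qed
  define s1 where "s1 = exec (Suc N) p_search s"
  have best: "best d ?c {(u, p). u \<le> N \<and> na s 5 u = 0 \<and> p < l} s1"
    unfolding s1_def by (rule search_spec) (use b l c in \<open>auto simp: searching_def\<close>)
  \<comment> \<open>While the tour has fewer than \<open>N\<close> members some ordinary team is
    still free, so the search cannot come back empty.\<close>
  have "card (set ?xs) < card ?V" using distinct_card[OF xs(1)] l v by simp
  then have "\<not> ?V \<subseteq> set ?xs" using card_mono[of "set ?xs" ?V] by (meson List.finite_set linorder_not_less)
  then obtain u where u: "u \<in> ?V" "u \<notin> set ?xs" by blast
  then have "(u, 0) \<in> {(u, p). u \<le> N \<and> na s 5 u = 0 \<and> p < l}" using g[of u] xs(2) by auto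
  then have B: "nv s1 14 \<le> N" "na s 5 (nv s1 14) = 0" "nv s1 15 < l"
    "\<And>x p. x \<le> N \<Longrightarrow> na s 5 x = 0 \<Longrightarrow> p < l \<Longrightarrow> d (nv s1 14) (?c (nv s1 15)) \<le> d x (?c p)"
    using best unfolding best_def by (auto split: if_splits)
  have b1: "base N d s1" unfolding s1_def using b(1) by (rule base_frame) (auto simp: p_search_def)
  have f1: "nv s1 16 = l" "nv s1 4 = v" "na s1 3 = ?c" "na s1 5 = na s 5"
    using frame_nv[of 16 p_search "Suc N" s] frame_nv[of 4 p_search "Suc N" s]
      frame_na[of 3 p_search "Suc N" s] frame_na[of 5 p_search "Suc N" s] b
    by (simp_all add: s1_def p_search_def)
  define s2 where "s2 = exec (Suc N) p_insert s1"
  note ins = insert_spec[OF b1, of ?xs, folded s2_def]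
  have i: "base N d s2" "nv s2 16 = Suc l" "map (na s2 3) [0..<nv s2 16] = insert_at (nv s1 15) (nv s1 14) ?xs"
    "na s2 5 = (na s 5)(nv s1 14 := 1)" "nv s2 4 = v"
    using ins f1 l B(3) by auto
  have un: "nv s1 14 \<in> ?V" "nv s1 14 \<notin> set ?xs" using g[OF B(1)] B(1,2) by auto
  have T: "tour_inv ?V (insert_at (nv s1 15) (nv s1 14) ?xs)"
  proof (rule tour_inv_step[OF b(4)])
    fix x y assume x: "x \<in> ?V" "x \<notin> set ?xs" "y \<in> set ?xs"
    then obtain p where "p < l" "y = ?c p" by auto
    then show "d (nv s1 14) (?xs ! nv s1 15) \<le> d x y" using B(3,4) g[of x] x by auto
  qed (use un B(3) in auto)
  have set: "set (insert_at (nv s1 15) (nv s1 14) ?xs) = insert (nv s1 14) (set ?xs)"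
    unfolding insert_at_def by (metis append_take_drop_id list.simps(15) set_append Un_insert_right)
  have e: "map (na s2 3) [0..<Suc l] = insert_at (nv s1 15) (nv s1 14) ?xs" using i(2,3) by metis
  show ?thesis
    unfolding touring_def exec.simps(9) s1_def[symmetric] s2_def[symmetric] e set
    using i T g un by auto
qed

lemma tour_spec:
  assumes met: "ttp_metric (Suc N) d" and b: "base N d s" and v: "nv s 4 \<le> N" and N: "1 \<le> N" and z: "na s 5 = (\<lambda>i. 0)"
  shows "touring N d (nv s 4) N (exec (Suc N) p_tour s)"
proof -
  interpret ttp_met "Suc N" d by unfold_locales (rule met)
  let ?v = "nv s 4"
  let ?i = "NStore 5 (NV 4) (NC 1) ;; NSet 14 (NC 1 [-] NV 4) ;; NStore 5 (NV 14) (NC 1) ;;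
     NStore 3 (NC 0) (NV 14) ;; NSet 16 (NC 1)"
  let ?b = "IfLe (NV 16 [+] NC 1) (NV 3) (p_search ;; p_insert) Skip"
  define s1 where "s1 = exec (Suc N) ?i s"
  have b1: "base N d s1" unfolding s1_def using b by (rule base_frame) auto
  have w: "1 - ?v \<in> {..<Suc N} - {?v}" using N by (cases "?v") auto
  have e: "map (na s1 3) [0..<Suc 0] = [1 - ?v]" "nv s1 16 = Suc 0" "nv s1 4 = ?v"
    "na s1 5 u = 0 \<longleftrightarrow> u \<noteq> ?v \<and> u \<noteq> 1 - ?v" for u
    by (simp_all add: s1_def z)
  have t1: "touring N d ?v (Suc 0) s1"
    unfolding touring_def e(1) using b1 e(2-4) tour_inv_init[OF w] by auto
  \<comment> \<open>The loop has \<open>Suc N\<close> rounds, but a tour started with one team is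
    complete after \<open>N - 1\<close> insertions; the minimum describes the idle rounds at the
    end.\<close>
  have "touring N d ?v (min N (Suc (Suc N))) (exec (Suc N) (For 10 ?b) s1)"
  proof (rule For_inv[where I = "\<lambda>j. touring N d ?v (min N (Suc j))"], goal_cases)
    case 1
    have "min N (Suc 0) = Suc 0" using N by auto
    then show ?case using t1 by (simp only:)
  next
    case (2 j s')
    have t: "touring N d ?v (min N (Suc j)) (nset 10 j s')" (is "touring _ _ _ _ ?s")
      using 2(2) base_nset[of N d s' 10 j] by (simp add: touring_def)
    have l: "nv ?s 16 = min N (Suc j)" "nv ?s 3 = N" using t by (auto simp: touring_def base_def)
    show ?case
    proof (cases "Suc j < N")
      case True
      then have "exec (Suc N) ?b ?s = exec (Suc N) (p_search ;; p_insert) ?s" using l by simp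
      moreover have "touring N d ?v (Suc (min N (Suc j))) (exec (Suc N) (p_search ;; p_insert) ?s)"
        using touring_step[OF met t _ v] True by simp
      moreover have "Suc (min N (Suc j)) = min N (Suc (Suc j))" using True by simp
      ultimately show ?thesis by (simp del: exec.simps)
    next
      case False
      then have "exec (Suc N) ?b ?s = ?s" using l by simp
      moreover have "min N (Suc j) = min N (Suc (Suc j))" using False by simp
      ultimately show ?thesis using t by (simp del: exec.simps)
    qed
  qed
  moreover have "exec (Suc N) p_tour s = exec (Suc N) (For 10 ?b) s1" by (simp add: p_tour_def s1_def)
  ultimately show ?thesis by simp
qed

section \<open>Cutting the days of one half into blocks\<close>

definition greedy :: "nat \<Rightarrow> nat \<Rightarrow> nat \<Rightarrow> nat \<Rightarrow> nat \<Rightarrow> nat \<Rightarrow> nat set \<Rightarrow> bool" where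
  "greedy N k q pos rm qq B \<longleftrightarrow> pos + rm = N \<and> 2 * qq \<le> rm \<and> rm \<le> k * qq \<and> B \<subseteq> {..<pos} \<and> card B + qq = q \<and>
     (0 \<in> B \<or> pos = 0) \<and> (\<forall>b\<in>B. b + 2 \<le> pos \<and> Suc b \<notin> B) \<and>
     (\<forall>a<pos. \<exists>b>a. b \<le> a + k \<and> (b \<in> B \<or> b = pos))"

text \<open>In \<open>greedy\<close>, \<open>pos\<close> days are already cut, \<open>rm\<close>
  remain, and \<open>qq\<close> blocks are to come. The bounds
  \<open>2 * qq \<le> rm \<le> k * qq\<close> say precisely that lengths between 2 and
  \<open>k\<close> can still be found; the choice of \<open>m\<close> preserves both, and the open
  end \<open>pos\<close> counts as the next block start.\<close>

lemma greedy_step: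
  assumes g: "greedy N k q pos rm qq B" and qq: "0 < qq" and k: "2 \<le> k"
  defines "m \<equiv> min k (rm - 2 * (qq - 1))"
  shows "greedy N k q (pos + m) (rm - m) (qq - 1) (insert pos B)"
proof -
  obtain q' where q': "qq = Suc q'" using qq by (cases qq) auto
  have h: "pos + rm = N" "2 * q' + 2 \<le> rm" "rm \<le> k * q' + k" "B \<subseteq> {..<pos}" "card B + Suc q' = q"
    "0 \<in> B \<or> pos = 0" "\<And>b. b \<in> B \<Longrightarrow> b + 2 \<le> pos \<and> Suc b \<notin> B"
    "\<And>a. a < pos \<Longrightarrow> \<exists>b>a. b \<le> a + k \<and> (b \<in> B \<or> b = pos)"
    using g unfolding greedy_def q' by auto
  have m: "2 \<le> m" "m \<le> k" "m + 2 * q' \<le> rm" using h(2) k by (auto simp: m_def q')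
  \<comment> \<open>Either the new block is full and the upper bound drops by \<open>k\<close> on
    both sides, or just two days per remaining block are left, which is below the bound as
    \<open>2 \<le> k\<close>.\<close>
  have m2: "rm \<le> k * q' + m"
  proof (cases "k \<le> rm - 2 * q'")
    case True then show ?thesis using h(3) by (simp add: m_def q')
  next
    case False
    have "2 * q' \<le> k * q'" using k by (rule mult_right_mono) simp
    moreover have "m = rm - 2 * q'" using False by (simp add: m_def q')
    ultimately show ?thesis using h(2) by linarith
  qed
  have nin: "pos \<notin> B" "finite B" using h(4) finite_subset by auto
  have "insert pos B \<subseteq> {..<pos + m}" using h(4) m by auto
  moreover have "card (insert pos B) + q' = q" using nin h(5) by simp
  moreover have "\<forall>b\<in>insert pos B. b + 2 \<le> pos + m \<and> Suc b \<notin> insert pos B"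
    using h(4,7) m by fastforce
  moreover have "\<exists>b>a. b \<le> a + k \<and> (b \<in> insert pos B \<or> b = pos + m)" if "a < pos + m" for a
  proof (cases "a < pos")
    case True then show ?thesis using h(8) by blast
  next
    case False then show ?thesis using that m by (intro exI[of _ "pos + m"]) auto
  qed
  ultimately show ?thesis
    using h(1,6) m m2 unfolding greedy_def q' by auto
qed

lemma greedy_final:
  assumes g: "greedy N k q pos rm 0 B" and N: "odd N" "3 \<le> N" and k: "2 \<le> k" and q: "even q"
  shows "blocks N k B" "card B = q" "B \<subseteq> {..<N}"
proof -
  have h: "pos = N" "B \<subseteq> {..<N}" "card B = q" "0 \<in> B" "\<And>b. b \<in> B \<Longrightarrow> b + 2 \<le> N \<and> Suc b \<notin> B"
    "\<And>a. a < N \<Longrightarrow> \<exists>b>a. b \<le> a + k \<and> (b \<in> B \<or> b = N)"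
    using g N unfolding greedy_def by auto
  show "card B = q" "B \<subseteq> {..<N}" using h by auto
  show "blocks N k B"
  proof
    show "odd N" "3 \<le> N" "2 \<le> k" "B \<subseteq> {..<N}" "0 \<in> B" "even (card B)" using N k h q by auto
  next
    fix t assume t: "Suc t mod N \<in> B"
    show "t mod N \<notin> B"
    proof
      assume b: "t mod N \<in> B"
      then have "Suc (t mod N) \<noteq> N" using h(5)[OF b] by auto
      then have "Suc t mod N = Suc (t mod N)" by (simp add: mod_Suc)
      then show False using h(5)[OF b] t by simp
    qed
  next
    fix a
    have "a mod N < N" using N by simp
    then obtain b where b: "a mod N < b" "b \<le> a mod N + k" "b \<in> B \<or> b = N" using h(6) by blast
    \<comment> \<open>The end of the last block is \<open>N\<close>, whose residue 0 is a block
      start again.\<close>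
    have "(b + N * (a div N)) mod N \<in> B"
      using b(3) h(2,4) by (auto simp: mod_less subsetD)
    moreover have "a = a mod N + N * (a div N)" by simp
    then have "a < b + N * (a div N)" "b + N * (a div N) \<le> a + k" using b(1,2) by linarith+
    ultimately show "\<exists>b>a. b \<le> a + k \<and> b mod N \<in> B" by blast
  qed
qed

lemma blocks_spec:
  assumes b: "base N d s" and z: "na s 6 = (\<lambda>i. 0)" and k: "nv s 1 = k" "5 \<le> k" and N: "odd N" "9 \<le> N"
  defines "s' \<equiv> exec (Suc N) p_blocks s"
  defines "B \<equiv> {b. na s' 6 b \<noteq> 0}"
  shows "blocks N k B" "N \<le> 2 * k \<longrightarrow> card B = 2" "card B < N" "card B * k \<le> N + 2 * k - 1"
proof -
  let ?l1 = "For 11 (IfLe (NV 14 [+] NC 1) (NV 3) (NSet 13 (NV 13 [+] NC 2) ;; NSet 14 (NV 14 [+] NV 1 [+] NV 1)) Skip)"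
  let ?b2 = "NStore 6 (NV 14) (NC 1) ;; NSet 13 (NV 13 [-] NC 1) ;; NSet 16 (NV 15 [-] NV 13 [-] NV 13) ;;
        IfLe (NV 1) (NV 16) (NSet 16 (NV 1)) Skip ;;
        NSet 14 (NV 14 [+] NV 16) ;; NSet 15 (NV 15 [-] NV 16)"
  let ?l2 = "For 11 (IfLe (NC 1) (NV 13) (?b2) Skip)"
  define s1 where "s1 = nset 14 (k + k) (nset 13 2 s)"
  define s2 where "s2 = exec (Suc N) ?l1 s1"
  let ?I = "\<lambda>j s'. nv s' 3 = N \<and> nv s' 1 = k \<and> even (nv s' 13) \<and> 2 \<le> nv s' 13 \<and> nv s' 14 = nv s' 13 * k \<and>
     (nv s' 13 = 2 \<or> (nv s' 13 - 2) * k < N) \<and> (N \<le> nv s' 14 \<or> 2 + j \<le> nv s' 13)"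
  have I: "?I (Suc N) s2"
    unfolding s2_def
  proof (rule For_inv[where I = ?I], goal_cases)
    case 1 then show ?case using b k by (simp add: s1_def base_def)
  next
    case (2 j s')
    then show ?case by (auto simp: add_mult_distrib)
  qed
  define q where "q = nv s2 13"
  have qk: "N \<le> q * k"
  proof (cases "N \<le> nv s2 14")
    case True then show ?thesis using I by (simp add: q_def)
  next
    case False
    then have "2 + Suc N \<le> nv s2 13" using I by blast
    then have "N \<le> q" by (simp add: q_def)
    moreover have "q * 1 \<le> q * k" using k by (intro mult_left_mono) auto
    ultimately show ?thesis by linarith
  qed
  have q: "even q" "2 \<le> q" "q = 2 \<or> (q - 2) * k < N" using I by (auto simp: q_def)
  \<comment> \<open>There must be room for \<open>q\<close> blocks of two days. This is where
    \<open>k \<ge> 5\<close> enters: \<open>(q - 2) * 5 < N\<close>, and \<open>N \<ge> 9\<close>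
    does the rest.\<close>
  have q5: "2 * q \<le> N"
  proof (cases "q = 2")
    case False
    have "(q - 2) * 5 \<le> (q - 2) * k" using k(2) by (rule mult_left_mono) simp
    then have "(q - 2) * 5 < N" using q(3) False by linarith
    then show ?thesis using N(2) by linarith
  qed (use N in simp)
  define s3 where "s3 = nset 15 N (nset 14 0 s2)"
  define s4 where "s4 = exec (Suc N) ?l2 s3"
  have z2: "na s2 6 = (\<lambda>i. 0)"
    using frame_na[of 6 ?l1 "Suc N" s1] z by (simp add: s2_def s1_def)
  let ?J = "\<lambda>j s'. nv s' 1 = k \<and> nv s' 13 = q - j \<and> greedy N k q (nv s' 14) (nv s' 15) (nv s' 13) {b. na s' 6 b \<noteq> 0}"
  have J: "?J (Suc N) s4"
    unfolding s4_def
  proof (rule For_inv[where I = ?J], goal_cases)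
    case 1
    show ?case using I q5 qk by (simp add: s3_def q_def z2 greedy_def mult.commute)
  next
    case (2 j s')
    show ?case
    proof (cases "0 < q - j")
      case False
      then show ?thesis using 2 by auto
    next
      case True
      define m where "m = min k (nv s' 15 - 2 * (nv s' 13 - 1))"
      define t where "t = exec (Suc N) ?b2 (nset 11 j s')"
      have t: "nv t 1 = k" "nv t 13 = nv s' 13 - 1" "nv t 14 = nv s' 14 + m" "nv t 15 = nv s' 15 - m"
        "na t 6 = (na s' 6)(nv s' 14 := 1)"
        using 2 by (auto simp: t_def m_def min_def mult_2)
      have "{b. na t 6 b \<noteq> 0} = insert (nv s' 14) {b. na s' 6 b \<noteq> 0}" by (auto simp: t)
      then have "greedy N k q (nv t 14) (nv t 15) (nv t 13) {b. na t 6 b \<noteq> 0}"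
        using greedy_step[of N k q "nv s' 14" "nv s' 15" "nv s' 13" "{b. na s' 6 b \<noteq> 0}"] 2 True k(2)
        by (auto simp: t m_def)
      moreover have "exec (Suc N) (IfLe (NC 1) (NV 13) (?b2) Skip) (nset 11 j s') = t"
      proof -
        have "1 \<le> nv s' 13" using True 2(2) by linarith
        then show ?thesis by (simp only: t_def exec.simps(10) neval.simps nset_sel) simp
      qed
      ultimately show ?thesis using t 2 by (simp del: exec.simps)
    qed
  qed
  have "s' = s4" using b k I by (simp add: s'_def p_blocks_def s4_def s3_def s2_def s1_def base_def)
  then have "greedy N k q (nv s' 14) (nv s' 15) 0 B" using J q5 by (auto simp: B_def)
  note fin = greedy_final[OF this N(1) _ _ q(1)]
  show "blocks N k B" using fin(1) N k by simp
  have c: "card B = q" using fin(2) N k by simp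
  show "card B < N" using c q5 q(2) by simp
  show "N \<le> 2 * k \<longrightarrow> card B = 2"
  proof (rule ccontr)
    assume "\<not> (N \<le> 2 * k \<longrightarrow> card B = 2)"
    then have a: "N \<le> 2 * k" "card B \<noteq> 2" by auto
    then have "(q - 2) * k < N" "4 \<le> q" using q c by (auto elim!: evenE)
    moreover have "2 * k \<le> (q - 2) * k" using \<open>4 \<le> q\<close> by (intro mult_right_mono) auto
    ultimately show False using a by linarith
  qed
  show "card B * k \<le> N + 2 * k - 1"
  proof (cases "q = 2")
    case False
    then have "(q - 2) * k < N" using q by simp
    then show ?thesis using c q(2) by (simp add: diff_mult_distrib)
  qed (use c N in simp)
qed

lemma rotation_spec:
  assumes b: "base N d s" and N: "1 \<le> N" and c: "\<forall>p<N. na s 3 p \<le> N"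
    and xs: "xs = map (na s 3) [0..<N]" and B: "B = {b. na s 6 b \<noteq> 0}" "B \<subseteq> {..<N}"
  defines "s' \<equiv> exec (Suc N) p_rotation s"
  shows "nv s' 5 < N" "\<forall>r<N. switch_cost d N xs B (nv s' 5) \<le> switch_cost d N xs B r"
proof -
  let ?r3 = "IfLe (NV 12 [+] NC 1) (NV 3)
          (NSet 13 (NA 2 (NA 3 (NA 8 (NV 12 [+] NV 10)))) ;;
           NSet 14 (NA 8 (NV 11 [+] NV 3 [-] NC 1 [+] (NV 3 [-] NV 12))) ;;
           RLoad 1 (NV 13 [+] NA 3 (NA 8 (NV 14 [+] NV 10))) ;; RAdd 0 0 1 ;;
           NSet 14 (NA 8 (NV 11 [+] (NV 3 [-] NV 12))) ;;
           RLoad 1 (NV 13 [+] NA 3 (NA 8 (NV 14 [+] NV 10))) ;; RAdd 0 0 1) Skip"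
  let ?r2 = "IfLe (NV 11 [+] NC 1) (NV 3) (IfLe (NC 1) (NA 6 (NV 11)) (For 12 ?r3) Skip) Skip"
  let ?fin = "IfLe (NV 10) (NC 0) (RMov 2 0 ;; NSet 5 (NV 10)) (IfRLe 2 0 Skip (RMov 2 0 ;; NSet 5 (NV 10)))"
  let ?r1 = "IfLe (NV 10 [+] NC 1) (NV 3) (RZero 0 ;; For 11 ?r2 ;; ?fin) Skip"
  define f where "f r i j = d (xs ! ((i + r) mod N)) (xs ! ((j + r) mod N))" for r i j
  define K where "K s' \<longleftrightarrow> base N d s' \<and> na s' 3 = na s 3 \<and> na s' 6 = na s 6" for s'
  have K_frame: "K (exec (Suc N) e s')"
    if "K s'" "fst (mods e) \<inter> {0, 3} = {}" "fst (snd (mods e)) \<inter> {2, 3, 6, 8} = {}" "\<not> snd (snd (snd (mods e)))" for e s'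
    using that base_frame[of N d s' e] frame_na[of 3 e "Suc N" s'] frame_na[of 6 e "Suc N" s'] by (auto simp: K_def)
  have K_nset: "K (nset x v s')" if "K s'" "x \<noteq> 0" "x \<noteq> 3" for x v s'
    using that base_nset by (simp add: K_def)
  have xs_nth: "xs ! x = na s 3 x" if "x < N" for x using that by (simp add: xs)
  have N0: "0 < N" using N by simp
  have trm: "rv (exec (Suc N) ?r3 s') 0 = rv s' 0 + (f r i (cj N (b + N - 1) i) + f r i (cj N b i))"
    if s': "K s'" "nv s' 10 = r" "nv s' 11 = b" "nv s' 12 = i" "r < N" "b < N" "i < N" for s' r b i
  proof -
    have h: "nv s' 3 = N" "\<And>x. x < 4 * N \<Longrightarrow> na s' 8 x = x mod N" "\<And>i. i \<le> N \<Longrightarrow> na s' 2 i = i * Suc N"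
      "\<And>i j. i \<le> N \<Longrightarrow> j \<le> N \<Longrightarrow> ra s' (i * Suc N + j) = d i j" "na s' 3 = na s 3"
      using s'(1) by (auto simp: K_def base_def)
    have cl: "na s 3 (x mod N) \<le> N" for x using c N0 by simp
    have e1: "na s' 8 (i + r) = (i + r) mod N" using h(2)[of "i + r"] s' by simp
    have e2: "na s' 8 (b + N - 1 + (N - i)) = cj N (b + N - 1) i" "na s' 8 (b + (N - i)) = cj N b i"
      using h(2)[of "b + N - 1 + (N - i)"] h(2)[of "b + (N - i)"] s'(5-7) by (auto simp: cj_def)
    have e3: "na s' 8 (cj N t i + r) = (cj N t i + r) mod N" for t
      using h(2)[of "cj N t i + r"] cj_less[OF s'(7), of t] s'(5) by simp
    have e4: "na s' 2 (na s' 3 ((i + r) mod N)) = na s 3 ((i + r) mod N) * Suc N"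
      using h(3)[OF cl] h(5) by simp
    have e5: "ra s' (na s 3 (x mod N) * Suc N + na s 3 (y mod N)) = d (xs ! (x mod N)) (xs ! (y mod N))" for x y
      using h(4)[OF cl cl] N0 by (simp add: xs_nth)
    show ?thesis
      using s'(2-4,7) e1 e2 e3 e4 e5 h(1,5) by (simp add: f_def del: mult_Suc mult_Suc_right)
  qed
  let ?t = "\<lambda>r b i. f r i (cj N (b + N - 1) i) + f r i (cj N b i)"
  have inner: "rv (exec (Suc N) (For 12 ?r3) s') 0 = rv s' 0 + (\<Sum>i<N. ?t r b i)"
    if s': "K s'" "nv s' 10 = r" "nv s' 11 = b" "r < N" "b < N" for s' r b
  proof -
    let ?I = "\<lambda>j t. K t \<and> nv t 10 = r \<and> nv t 11 = b \<and> rv t 0 = rv s' 0 + (\<Sum>i<min j N. ?t r b i)"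
    have "?I (Suc N) (exec (Suc N) (For 12 ?r3) s')"
    proof (rule For_inv[where I = ?I], goal_cases)
      case 1 then show ?case using s' by simp
    next
      case (2 i t)
      define t' where "t' = nset 12 i t"
      have t': "K t'" "nv t' 10 = r" "nv t' 11 = b" "nv t' 12 = i" "rv t' 0 = rv s' 0 + (\<Sum>i<min i N. ?t r b i)"
        using 2 K_nset by (simp_all add: t'_def)
      have "K (exec (Suc N) ?r3 t')" using t'(1) by (rule K_frame) auto
      moreover have "nv (exec (Suc N) ?r3 t') 10 = r" "nv (exec (Suc N) ?r3 t') 11 = b"
        using frame_nv[of 10 ?r3 "Suc N" t'] frame_nv[of 11 ?r3 "Suc N" t'] t' by simp_all
      moreover have "rv (exec (Suc N) ?r3 t') 0 = rv s' 0 + (\<Sum>i<min (Suc i) N. ?t r b i)"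
      proof (cases "i < N")
        case True
        then show ?thesis using trm[OF t'(1-4) s'(4,5) True] t'(5) by (simp add: min_def del: exec.simps)
      next
        case False
        moreover have "nv t' 3 = N" using t'(1) by (simp add: K_def base_def)
        ultimately have "exec (Suc N) ?r3 t' = t'" using t'(4) by simp
        then show ?thesis using t'(5) False by (simp add: min_def)
      qed
      ultimately show ?case by (simp only: t'_def)
    qed
    then show ?thesis by simp
  qed
  have total: "rv (exec (Suc N) (For 11 ?r2) s') 0 = rv s' 0 + (\<Sum>b\<in>B. \<Sum>i<N. ?t r b i)"
    if s': "K s'" "nv s' 10 = r" "r < N" for s' r
  proof -
    let ?I = "\<lambda>j t. K t \<and> nv t 10 = r \<and> rv t 0 = rv s' 0 + (\<Sum>b\<in>B \<inter> {..<j}. \<Sum>i<N. ?t r b i)"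
    have "?I (Suc N) (exec (Suc N) (For 11 ?r2) s')"
    proof (rule For_inv[where I = ?I], goal_cases)
      case 1 then show ?case using s' by simp
    next
      case (2 b t)
      define t' where "t' = nset 11 b t"
      have t': "K t'" "nv t' 10 = r" "nv t' 11 = b" "rv t' 0 = rv s' 0 + (\<Sum>b\<in>B \<inter> {..<b}. \<Sum>i<N. ?t r b i)"
        using 2 K_nset by (simp_all add: t'_def)
      have h: "nv t' 3 = N" "na t' 6 = na s 6" using t'(1) by (simp_all add: K_def base_def)
      have "K (exec (Suc N) ?r2 t')" using t'(1) by (rule K_frame) auto
      moreover have "nv (exec (Suc N) ?r2 t') 10 = r"
        using frame_nv[of 10 ?r2 "Suc N" t'] t' by simp
      moreover have "rv (exec (Suc N) ?r2 t') 0 = rv s' 0 + (\<Sum>b\<in>B \<inter> {..<Suc b}. \<Sum>i<N. ?t r b i)"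
      proof (cases "b \<in> B")
        case True
        then have "b < N" using B by auto
        then have "exec (Suc N) ?r2 t' = exec (Suc N) (For 12 ?r3) t'"
          using True h t'(3) B by simp
        moreover have "B \<inter> {..<Suc b} = insert b (B \<inter> {..<b})" using True by (auto simp: less_Suc_eq)
        ultimately show ?thesis using inner[OF t'(1-3) s'(3) \<open>b < N\<close>] t'(4) by simp
      next
        case False
        then have "exec (Suc N) ?r2 t' = t'" using h t'(3) B by simp
        moreover have "B \<inter> {..<Suc b} = B \<inter> {..<b}" using False by (auto simp: less_Suc_eq)
        ultimately show ?thesis using t'(4) by simp
      qed
      ultimately show ?case by (simp only: t'_def)
    qed
    moreover have "B \<inter> {..<Suc N} = B" using B(2) by auto
    ultimately show ?thesis by simp
  qed
  define G where "G r = switch_cost d N xs B r" for r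
  have G: "(\<Sum>b\<in>B. \<Sum>i<N. ?t r b i) = G r" for r
    by (simp add: G_def switch_cost_def day_len_def f_def sum.distrib)
  let ?I = "\<lambda>j t. K t \<and> (0 < min j N \<longrightarrow> nv t 5 < min j N \<and> rv t 2 = G (nv t 5) \<and> (\<forall>r<min j N. G (nv t 5) \<le> G r))"
  have "?I (Suc N) (exec (Suc N) (For 10 ?r1) s)"
  proof (rule For_inv[where I = ?I], goal_cases)
    case 1 then show ?case using b by (simp add: K_def)
  next
    case (2 r t)
    define t' where "t' = nset 10 r t"
    have t': "K t'" "nv t' 10 = r" "nv t' 5 = nv t 5" "rv t' 2 = rv t 2"
      using 2 K_nset by (simp_all add: t'_def)
    have h: "nv t' 3 = N" using t'(1) by (simp_all add: K_def base_def)
    have Kt: "K (exec (Suc N) ?r1 t')" using t'(1) by (rule K_frame) auto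
    show ?case
    proof (cases "r < N")
      case False
      then have e: "exec (Suc N) ?r1 t' = t'" using h t'(2) by (simp del: exec.simps(9))
      have "min (Suc r) N = min r N" using False by simp
      then show ?thesis unfolding t'_def[symmetric] e using 2 t' by simp
    next
      case True
      define t1 where "t1 = exec (Suc N) (RZero 0) t'"
      have t1: "K t1" "nv t1 10 = r" "rv t1 0 = 0" "nv t1 5 = nv t 5" "rv t1 2 = rv t 2"
        using K_frame[OF t'(1), of "RZero 0"] t' by (simp_all add: t1_def)
      define t2 where "t2 = exec (Suc N) (For 11 ?r2) t1"
      have t2: "nv t2 10 = r" "nv t2 5 = nv t 5" "rv t2 2 = rv t 2"
        using frame_nv[of 10 "For 11 ?r2" "Suc N" t1] frame_nv[of 5 "For 11 ?r2" "Suc N" t1] t1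
          frame[THEN conjunct2, THEN conjunct2, THEN conjunct1, rule_format, of 2 "For 11 ?r2" "Suc N" t1]
        by (simp_all add: t2_def)
      have g2: "rv t2 0 = G r" using total[OF t1(1,2) True] t1(3) G by (simp add: t2_def)
      have e: "exec (Suc N) ?r1 t' = exec (Suc N) ?fin t2"
        using True h t'(2) by (simp add: t1_def t2_def)
      have m: "min (Suc r) N = Suc r" "min r N = r" using True by auto
      have old: "if r = 0 then True else nv t 5 < r \<and> rv t 2 = G (nv t 5) \<and> (\<forall>u<r. G (nv t 5) \<le> G u)"
        using 2(2) m by auto
      have "nv (exec (Suc N) ?fin t2) 5 < Suc r \<and> rv (exec (Suc N) ?fin t2) 2 = G (nv (exec (Suc N) ?fin t2) 5) \<and>
        (\<forall>u<Suc r. G (nv (exec (Suc N) ?fin t2) 5) \<le> G u)"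
        using old t2 g2 by (cases "r = 0"; cases "rv t 2 \<le> G r"; force simp: less_Suc_eq)+
      then show ?thesis using Kt unfolding m t'_def[symmetric] e by blast
    qed
  qed
  then show "nv s' 5 < N" "\<forall>r<N. switch_cost d N xs B (nv s' 5) \<le> switch_cost d N xs B r"
    using N by (simp_all add: s'_def p_rotation_def G_def)
qed

lemma labels_spec:
  assumes b: "base N d s" and N: "1 \<le> N" and r: "nv s 5 < N" and xs: "xs = map (na s 3) [0..<N]"
  shows "\<forall>i\<le>N. na (exec (Suc N) p_labels s) 7 i = label N xs (nv s 4) (nv s 5) i"
proof -
  let ?b = "IfLe (NV 11 [+] NC 1) (NV 3) (NStore 7 (NV 11) (NA 3 (NA 8 (NV 11 [+] NV 5)))) (NStore 7 (NV 11) (NV 4))"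
  let ?I = "\<lambda>j t. base N d t \<and> nv t 4 = nv s 4 \<and> nv t 5 = nv s 5 \<and> na t 3 = na s 3 \<and>
    (\<forall>i<j. na t 7 i = label N xs (nv s 4) (nv s 5) i)"
  have "?I (Suc N) (exec (Suc N) (For 11 ?b) s)"
  proof (rule For_inv[where I = ?I], goal_cases)
    case 1 then show ?case using b by simp
  next
    case (2 i t)
    define t' where "t' = nset 11 i t"
    have t': "base N d t'" "nv t' 4 = nv s 4" "nv t' 5 = nv s 5" "na t' 3 = na s 3" "nv t' 11 = i"
      "\<forall>a<i. na t' 7 a = label N xs (nv s 4) (nv s 5) a"
      using 2 base_nset[of N d t 11 i] by (simp_all add: t'_def)
    have h: "nv t' 3 = N" "\<And>x. x < 4 * N \<Longrightarrow> na t' 8 x = x mod N" using t'(1) by (auto simp: base_def)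
    have bt: "base N d (exec (Suc N) ?b t')" using t'(1) by (rule base_frame) auto
    have e: "exec (Suc N) ?b t' = t'\<lparr>na := (na t')(7 := (na t' 7)(i := label N xs (nv s 4) (nv s 5) i))\<rparr>"
    proof (cases "i < N")
      case True
      then have "na t' 8 (i + nv s 5) = (i + nv s 5) mod N" using h(2)[of "i + nv s 5"] r by simp
      then show ?thesis using True t' h(1) by (simp add: label_def xs)
    next
      case False
      then show ?thesis using 2(1) t' h(1) by (simp add: label_def)
    qed
    show ?case
      unfolding t'_def[symmetric] using bt t' unfolding e by (simp add: less_Suc_eq)
  qed
  then show ?thesis by (simp add: p_labels_def less_Suc_eq_le)
qed

section \<open>Writing the table of the schedule\<close>

definition written :: "nat \<Rightarrow> (nat \<Rightarrow> nat) \<Rightarrow> st \<Rightarrow> nat \<Rightarrow> nat \<Rightarrow> nat \<Rightarrow> nat \<Rightarrow> bool" where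
  "written N \<tau> s t a j h \<longleftrightarrow>
     na s 0 (t * Suc N + \<tau> a) = \<tau> j \<and> na s 1 (t * Suc N + \<tau> a) = h \<and>
     na s 0 ((t + N) * Suc N + \<tau> a) = \<tau> j \<and> na s 1 ((t + N) * Suc N + \<tau> a) = 1 - h"

lemma row_index_inj: "x \<le> N \<Longrightarrow> y \<le> N \<Longrightarrow> t * Suc N + x = u * Suc N + y \<longleftrightarrow> t = u \<and> x = y" for x y t u N :: nat
proof
  assume a: "x \<le> N" "y \<le> N" "t * Suc N + x = u * Suc N + y"
  have "(t * Suc N + x) div Suc N = t" "(u * Suc N + y) div Suc N = u"
    using a(1,2) by (simp_all del: mult_Suc mult_Suc_right)
  then show "t = u \<and> x = y" using a(3) by auto
qed simp

lemma entry_spec: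
  assumes b: "base N d s" and \<tau>: "na s 7 = \<tau>" "inj_on \<tau> {..N}" "\<forall>i\<le>N. \<tau> i \<le> N"
    and v: "nv s 10 = t" "t < N" "nv s 13 = a" "a \<le> N"
  defines "s' \<equiv> exec (Suc N) p_entry s"
  shows "written N \<tau> s' t a (nv s 14) (nv s 15)"
    "\<And>u c j h. u < N \<Longrightarrow> c \<le> N \<Longrightarrow> (u, c) \<noteq> (t, a) \<Longrightarrow> written N \<tau> s u c j h \<Longrightarrow> written N \<tau> s' u c j h"
proof -
  have row: "na s 2 t = t * Suc N" "na s 2 N = N * Suc N" "nv s 3 = N" using b v by (auto simp: base_def)
  let ?x = "t * Suc N + \<tau> a" and ?y = "(t + N) * Suc N + \<tau> a"
  have y: "t * Suc N + \<tau> a + N * Suc N = ?y" by (simp add: add_mult_distrib)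
  have "na s' 0 = (na s 0)(?x := \<tau> (nv s 14), t * Suc N + \<tau> a + N * Suc N := \<tau> (nv s 14))"
    "na s' 1 = (na s 1)(?x := nv s 15, t * Suc N + \<tau> a + N * Suc N := 1 - nv s 15)"
    unfolding s'_def p_entry_def using v \<tau>(1) row by (simp_all del: mult_Suc mult_Suc_right)
  note s' = this[unfolded y]
  have ta: "\<tau> a \<le> N" using \<tau>(3) v(4) by simp
  have xy: "?x \<noteq> ?y" using row_index_inj[OF ta ta, of t "t + N"] v(2) by simp
  show "written N \<tau> s' t a (nv s 14) (nv s 15)"
    unfolding written_def s' using xy by (simp del: mult_Suc mult_Suc_right)
  fix u c j h assume u: "u < N" "c \<le> N" "(u, c) \<noteq> (t, a)" "written N \<tau> s u c j h"
  have tc: "\<tau> c \<le> N" using \<tau>(3) u(2) by simp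
  have ne: "u \<noteq> t \<or> \<tau> c \<noteq> \<tau> a" using u(2,3) v(4) inj_onD[OF \<tau>(2), of c a] by auto
  have "u * Suc N + \<tau> c \<noteq> ?x" "u * Suc N + \<tau> c \<noteq> ?y" "(u + N) * Suc N + \<tau> c \<noteq> ?x" "(u + N) * Suc N + \<tau> c \<noteq> ?y"
    unfolding row_index_inj[OF tc ta] using ne u(1) v(2) by auto
  then show "written N \<tau> s' u c j h"
    using u(4) unfolding written_def s' by (simp del: mult_Suc mult_Suc_right)
qed

lemma mods_entry: "mods p_entry = ({16}, {0, 1}, {}, False)"
  by (auto simp: p_entry_def)

text \<open>The part of an orientation that depends on the label. Combined with the block parity it
  is \<open>blk_orient\<close> in mode 0 and, when every day is a block start,
  \<open>alt_orient\<close> otherwise.\<close>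

definition side :: "nat \<Rightarrow> nat \<Rightarrow> nat set \<Rightarrow> nat \<Rightarrow> nat \<Rightarrow> bool" where
  "side N mode B t i \<longleftrightarrow> (if mode = 0 then (ee N t i < N) \<noteq> (t \<in> B \<and> (ee N t i = 0 \<or> ee N t i = N))
     else (N - 1) div 2 < ee N t i mod N)"

lemma side_spec:
  assumes b: "base N d s" and N: "odd N" and v: "nv s 10 = t" "t < N" "nv s 11 = i" "i < N" "nv s 14 = cj N t i"
    and B: "B = {b. na s 6 b \<noteq> 0}"
  shows "nv (exec (Suc N) p_side s) 18 = of_bool (side N (nv s 6) B t i)"
proof -
  let ?x = "t + (N - i) + (N - i)"
  have h: "nv s 3 = N" "na s 8 ?x = ?x mod N"
    using b v by (auto simp: base_def)
  have e: "ee N t i = ?x mod (2 * N)" by (simp add: ee_def mult_2 add.assoc)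
  \<comment> \<open>\<open>?x\<close> is below \<open>3 * N\<close>, so reduction modulo
    \<open>2 * N\<close> subtracts at most once, and two comparisons replace it.\<close>
  have lt: "ee N t i < N \<longleftrightarrow> ?x < N \<or> 2 * N \<le> ?x"
  proof (cases "?x < 2 * N")
    case True then show ?thesis by (simp add: e)
  next
    case False
    then have "?x mod (2 * N) = ?x - 2 * N" using v by (simp add: le_mod_geq)
    then show ?thesis using False v unfolding e by auto
  qed
  have cross: "(ee N t i = 0 \<or> ee N t i = N) \<longleftrightarrow> cj N t i = i"
    using ee_cross[OF N v(4)] v(2) by simp
  have m: "ee N t i mod N = ?x mod N" unfolding e by (rule mod_mod_cancel) simp
  have half: "(N - 1) div 2 < y \<longleftrightarrow> N \<le> y + y" for y using N by (auto elim!: oddE)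
  have eq: "cj N t i \<le> i \<and> i \<le> cj N t i \<longleftrightarrow> cj N t i = i" by auto
  have tB: "1 \<le> na s 6 t \<longleftrightarrow> t \<in> B" by (auto simp: B)
  show ?thesis
  proof (cases "nv s 6 = 0")
    case True
    then show ?thesis
      using h v lt cross tB eq unfolding side_def p_side_def by (auto simp: mult_2)
  next
    case False
    then show ?thesis
      using h v unfolding side_def p_side_def m half by (auto simp: mult_2)
  qed
qed

definition target :: "nat \<Rightarrow> (nat \<Rightarrow> nat) \<Rightarrow> (nat \<Rightarrow> nat \<Rightarrow> bool) \<Rightarrow> st \<Rightarrow> nat \<Rightarrow> nat \<Rightarrow> bool" where
  "target N \<tau> w s t i \<longleftrightarrow> written N \<tau> s t i (copp N t i) (of_bool (chome N w t i))"

lemma written_cong: "na s 0 = na s' 0 \<Longrightarrow> na s 1 = na s' 1 \<Longrightarrow> written N \<tau> s t a j h = written N \<tau> s' t a j h"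
  by (simp add: written_def)

definition labelled :: "nat \<Rightarrow> (nat \<Rightarrow> nat \<Rightarrow> real) \<Rightarrow> (nat \<Rightarrow> nat) \<Rightarrow> nat set \<Rightarrow> nat \<Rightarrow> st \<Rightarrow> bool" where
  "labelled N d \<tau> B mode s \<longleftrightarrow> base N d s \<and> na s 7 = \<tau> \<and> B = {b. na s 6 b \<noteq> 0} \<and> nv s 6 = mode"

lemma labelled_frame:
  assumes "labelled N d \<tau> B mode s" "fst (mods e) \<inter> {0, 3, 6} = {}" "fst (snd (mods e)) \<inter> {2, 6, 7, 8} = {}"
    "\<not> snd (snd (snd (mods e)))"
  shows "labelled N d \<tau> B mode (exec (Suc N) e s)"
  using assms base_frame[of N d s e] frame_nv[of 6 e "Suc N" s] frame_na[of 6 e "Suc N" s] frame_na[of 7 e "Suc N" s]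
  by (auto simp: labelled_def)

lemma labelled_nset: "labelled N d \<tau> B mode s \<Longrightarrow> x \<notin> {0, 3, 6} \<Longrightarrow> labelled N d \<tau> B mode (nset x v s)"
  by (simp add: labelled_def base_nset)

text \<open>The last conclusion is the frame: entries of other labels or days survive because
  \<open>\<tau>\<close> is injective, so that they occupy different cells of the table.\<close>

lemma game_spec:
  assumes l: "labelled N d \<tau> B mode s" and N: "odd N" and \<tau>: "inj_on \<tau> {..N}" "\<forall>i\<le>N. \<tau> i \<le> N"
    and v: "nv s 10 = t" "t < N" "nv s 11 = i" "i < N" "nv s 20 = of_bool \<beta>"
    and w: "w t i = (\<beta> \<noteq> side N mode B t i)"
  defines "s' \<equiv> exec (Suc N) p_game s"
  shows "target N \<tau> w s' t i" "i = mid N t \<Longrightarrow> target N \<tau> w s' t N"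
    "\<And>u c j h. u < N \<Longrightarrow> c \<le> N \<Longrightarrow> (u, c) \<noteq> (t, i) \<Longrightarrow> (i = mid N t \<Longrightarrow> (u, c) \<noteq> (t, N)) \<Longrightarrow>
       target N \<tau> w s u c \<Longrightarrow> target N \<tau> w s' u c"
proof -
  have b: "base N d s" "na s 7 = \<tau>" "B = {b. na s 6 b \<noteq> 0}" "nv s 6 = mode" using l by (auto simp: labelled_def)
  have self: "cj N t i = i \<longleftrightarrow> i = mid N t" by (rule cj_self_iff[OF N v(4)])
  have cl: "cj N t i < N" by (rule cj_less[OF v(4)])
  define s1 where "s1 = exec (Suc N) (NSet 14 (NA 8 (NV 10 [+] (NV 3 [-] NV 11)))) s"
  have "na s 8 (t + (N - i)) = cj N t i" using b(1) v by (auto simp: base_def cj_def)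
  then have s1: "nv s1 14 = cj N t i" "nv s1 10 = t" "nv s1 11 = i" "nv s1 20 = of_bool \<beta>" "nv s1 6 = mode" "na s1 6 = na s 6"
    using b v by (simp_all add: s1_def base_def)
  have l1: "labelled N d \<tau> B mode s1" unfolding s1_def using l by (rule labelled_frame) auto
  define s2 where "s2 = exec (Suc N) p_side s1"
  have "nv s2 18 = of_bool (side N mode B t i)"
    using side_spec[of N d s1 t i B] l1 N v s1 by (auto simp: s2_def labelled_def)
  moreover have f2: "nv s2 14 = cj N t i" "nv s2 10 = t" "nv s2 11 = i" "nv s2 20 = of_bool \<beta>"
    using frame_nv[of 14 p_side "Suc N" s1] frame_nv[of 10 p_side "Suc N" s1] frame_nv[of 11 p_side "Suc N" s1]
      frame_nv[of 20 p_side "Suc N" s1] s1 by (simp_all add: s2_def p_side_def)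
  moreover define s3 where "s3 = exec (Suc N) (IfLe (NC 1) (NV 18) (NSet 19 (NC 1 [-] NV 20)) (NSet 19 (NV 20))) s2"
  ultimately have s3: "nv s3 19 = of_bool (w t i)" "nv s3 14 = cj N t i" "nv s3 10 = t" "nv s3 11 = i"
    unfolding w by (cases \<beta>; cases "side N mode B t i"; simp)+
  have l3: "labelled N d \<tau> B mode s3"
    unfolding s3_def s2_def using l1 by (intro labelled_frame) (auto simp: p_side_def)
  let ?e3 = "NSet 14 (NA 8 (NV 10 [+] (NV 3 [-] NV 11))) ;; p_side ;; IfLe (NC 1) (NV 18) (NSet 19 (NC 1 [-] NV 20)) (NSet 19 (NV 20))"
  have m3: "s3 = exec (Suc N) ?e3 s" by (simp only: exec.simps(9) s3_def s2_def s1_def)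
  have "0 \<notin> fst (snd (mods ?e3))" "1 \<notin> fst (snd (mods ?e3))" by (simp_all add: p_side_def)
  then have a3: "na s3 0 = na s 0" "na s3 1 = na s 1" unfolding m3 by (simp_all only: frame_na not_False_eq_True)
  let ?sp = "NSet 13 (NV 3) ;; NSet 15 (NV 19) ;; p_entry ;; NSet 14 (NV 3)"
  define s4 where "s4 = exec (Suc N) (IfLe (NV 14) (NV 11) (IfLe (NV 11) (NV 14) ?sp Skip) Skip) s3"
  have s': "s' = exec (Suc N) p_entry (nset 15 (1 - nv s4 19) (nset 13 (nv s4 11) s4))"
    unfolding s'_def p_game_def
    by (simp only: exec.simps(9) s1_def[symmetric] s2_def[symmetric] s3_def[symmetric] s4_def[symmetric])
      (simp only: exec.simps(2) neval.simps nset_sel fun_upd_other num.distinct num.inject numeral_eq_iff not_False_eq_True)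
  have l4: "labelled N d \<tau> B mode s4"
    unfolding s4_def using l3 by (rule labelled_frame) (auto simp: mods_entry)
  have f4: "nv s4 10 = t" "nv s4 11 = i" "nv s4 19 = of_bool (w t i)"
    using frame_nv[of 10 "IfLe (NV 14) (NV 11) (IfLe (NV 11) (NV 14) ?sp Skip) Skip" "Suc N" s3]
      frame_nv[of 11 "IfLe (NV 14) (NV 11) (IfLe (NV 11) (NV 14) ?sp Skip) Skip" "Suc N" s3]
      frame_nv[of 19 "IfLe (NV 14) (NV 11) (IfLe (NV 11) (NV 14) ?sp Skip) Skip" "Suc N" s3] s3
    by (simp_all add: s4_def mods_entry)
  have N3: "nv s3 3 = N" using l3 by (simp add: labelled_def base_def)
  have s4: "nv s4 14 = copp N t i \<and> (i = mid N t \<longrightarrow> target N \<tau> w s4 t N) \<and>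
     (\<forall>u c j h. u < N \<longrightarrow> c \<le> N \<longrightarrow> (i = mid N t \<longrightarrow> (u, c) \<noteq> (t, N)) \<longrightarrow> written N \<tau> s u c j h \<longrightarrow> written N \<tau> s4 u c j h)"
  proof (cases "i = mid N t")
    case False
    then have "s4 = s3" using self s3 by (auto simp: s4_def)
    then show ?thesis using False self s3 v(4) written_cong[OF a3] by (auto simp: copp_def)
  next
    case True
    define s5 where "s5 = nset 15 (of_bool (w t i)) (nset 13 N s3)"
    have e: "s4 = nset 14 N (exec (Suc N) p_entry s5)"
      using True self s3 N3 frame_nv[of 3 p_entry "Suc N" s5]
      by (simp add: s4_def s5_def mods_entry)
    have l5: "labelled N d \<tau> B mode s5" unfolding s5_def using l3 by (simp add: labelled_nset)
    have w5: "written N \<tau> s u c j h = written N \<tau> s5 u c j h" for u c j h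
      using a3 by (simp add: written_def s5_def)
    have E: "written N \<tau> (exec (Suc N) p_entry s5) t N (nv s5 14) (nv s5 15)"
      "\<And>u c j h. u < N \<Longrightarrow> c \<le> N \<Longrightarrow> (u, c) \<noteq> (t, N) \<Longrightarrow> written N \<tau> s5 u c j h \<Longrightarrow>
         written N \<tau> (exec (Suc N) p_entry s5) u c j h"
      using entry_spec[of N d s5 \<tau> t N] l5 \<tau> v(2) s3 by (auto simp: labelled_def s5_def)
    have w4: "written N \<tau> s4 u c j h = written N \<tau> (exec (Suc N) p_entry s5) u c j h" for u c j h
      by (simp add: e written_def)
    have "copp N t N = i" "chome N w t N = w t i" "nv s5 14 = i" "nv s5 15 = of_bool (w t i)"
      using True self s3 by (simp_all add: copp_def chome_def s5_def)
    then have "target N \<tau> w s4 t N" using E(1) by (simp add: target_def w4)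
    moreover have "nv s4 14 = copp N t i" using True self v(4) by (simp add: e copp_def)
    ultimately show ?thesis using True E(2) w4 w5 by auto
  qed
  define s6 where "s6 = nset 15 (1 - nv s4 19) (nset 13 (nv s4 11) s4)"
  have l6: "labelled N d \<tau> B mode s6" unfolding s6_def using l4 by (simp add: labelled_nset)
  have w6: "written N \<tau> s6 u c j h = written N \<tau> s4 u c j h" for u c j h
    by (simp add: written_def s6_def)
  have E: "written N \<tau> s' t i (nv s6 14) (nv s6 15)"
    "\<And>u c j h. u < N \<Longrightarrow> c \<le> N \<Longrightarrow> (u, c) \<noteq> (t, i) \<Longrightarrow> written N \<tau> s6 u c j h \<Longrightarrow> written N \<tau> s' u c j h"
    using entry_spec[of N d s6 \<tau> t i] l6 \<tau> v(2,4) f4 by (auto simp: labelled_def s6_def s')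
  have "nv s6 14 = copp N t i" "nv s6 15 = of_bool (chome N w t i)"
    using s4 f4 v(4) by (auto simp: s6_def chome_def)
  then show "target N \<tau> w s' t i" using E(1) by (simp add: target_def)
  show "target N \<tau> w s' t N" if "i = mid N t"
    using s4 that E(2)[of t N] w6 v(2,4) by (auto simp: target_def)
  fix u c j h assume "u < N" "c \<le> N" "(u, c) \<noteq> (t, i)" "i = mid N t \<Longrightarrow> (u, c) \<noteq> (t, N)" "target N \<tau> w s u c"
  then show "target N \<tau> w s' u c" using s4 E(2) w6 unfolding target_def by blast
qed

lemma days_spec:
  assumes l: "labelled N d \<tau> B mode s" and N: "odd N" and \<tau>: "inj_on \<tau> {..N}" "\<forall>i\<le>N. \<tau> i \<le> N"
    and w: "\<And>t i. t < N \<Longrightarrow> i < N \<Longrightarrow> w t i = (bt B t \<noteq> side N mode B t i)"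
  shows "\<forall>t<N. \<forall>i\<le>N. target N \<tau> w (exec (Suc N) p_days s) t i"
proof -
  let ?g = "IfLe (NV 11 [+] NC 1) (NV 3) p_game Skip"
  let ?tog = "IfLe (NC 1) (NA 6 (NV 10)) (NSet 20 (NC 1 [-] NV 20)) Skip"
  let ?day = "IfLe (NV 10 [+] NC 1) (NV 3) (?tog ;; For 11 ?g) Skip"
  have gm: "20 \<notin> fst (mods p_game)" "10 \<notin> fst (mods p_game)" "fst (mods p_game) \<inter> {0, 3, 6} = {}"
    "fst (snd (mods p_game)) \<inter> {2, 6, 7, 8} = {}" "\<not> snd (snd (snd (mods p_game)))"
    by (auto simp: p_game_def p_side_def mods_entry)
  have N0: "0 < N" using N odd_pos by blast
  have day: "(\<forall>i\<le>N. target N \<tau> w (exec (Suc N) (For 11 ?g) s) t i) \<and>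
      (\<forall>u<N. \<forall>c\<le>N. u \<noteq> t \<longrightarrow> target N \<tau> w s u c \<longrightarrow> target N \<tau> w (exec (Suc N) (For 11 ?g) s) u c)"
    if s: "labelled N d \<tau> B mode s" "nv s 10 = t" "t < N" "nv s 20 = of_bool (bt B t)" for s t
  proof -
    \<comment> \<open>The special entry of the day appears in the round of the label on the axis,
      hence the condition \<open>mid N t < j\<close>. The minimum accounts for the idle round
      \<open>N\<close>.\<close>
    let ?I = "\<lambda>j s'. labelled N d \<tau> B mode s' \<and> nv s' 10 = t \<and> nv s' 20 = of_bool (bt B t) \<and>
       (\<forall>i<min j N. target N \<tau> w s' t i) \<and> (mid N t < j \<longrightarrow> target N \<tau> w s' t N) \<and>
       (\<forall>u<N. \<forall>c\<le>N. u \<noteq> t \<longrightarrow> target N \<tau> w s u c \<longrightarrow> target N \<tau> w s' u c)"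
    have "?I (Suc N) (exec (Suc N) (For 11 ?g) s)"
    proof (rule For_inv[where I = ?I], goal_cases)
      case 1 then show ?case using s by simp
    next
      case (2 i s')
      define s1 where "s1 = nset 11 i s'"
      have t1: "target N \<tau> w s1 u c = target N \<tau> w s' u c" for u c by (simp add: s1_def target_def written_def)
      have s1: "labelled N d \<tau> B mode s1" "nv s1 10 = t" "nv s1 11 = i" "nv s1 20 = of_bool (bt B t)"
        using 2 labelled_nset by (simp_all add: s1_def)
      have n3: "nv s1 3 = N" using s1(1) by (simp add: labelled_def base_def)
      show ?case
      proof (cases "i < N")
        case False
        then have "exec (Suc N) ?g s1 = s1" using s1 n3 by simp
        moreover have "min (Suc i) N = min i N" "mid N t < i" using False mid_less[OF N0, of t] by auto
        ultimately show ?thesis using 2 s1 t1 by (simp add: s1_def[symmetric] del: exec.simps)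
      next
        case True
        define s2 where "s2 = exec (Suc N) p_game s1"
        have e: "exec (Suc N) ?g s1 = s2" using True s1 n3 by (simp add: s2_def)
        note G = game_spec[where w = w, OF s1(1) N \<tau> s1(2) s(3) s1(3) True s1(4) w[OF s(3) True], folded s2_def]
        have "labelled N d \<tau> B mode s2" unfolding s2_def using s1(1) gm(3-5) by (rule labelled_frame)
        moreover have "nv s2 10 = t" "nv s2 20 = of_bool (bt B t)"
          using frame_nv[OF gm(2)] frame_nv[OF gm(1)] s1 by (simp_all add: s2_def)
        moreover have "target N \<tau> w s2 t a" if "a < min (Suc i) N" for a
        proof (cases "a = i")
          case True then show ?thesis using G(1) by simp
        next
          case False
          then have "target N \<tau> w s1 t a" using 2 that t1 by auto
          then show ?thesis using G(3)[OF s(3), of a] False that by auto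
        qed
        moreover have "target N \<tau> w s2 t N" if "mid N t < Suc i"
        proof (cases "i = mid N t")
          case True then show ?thesis by (rule G(2))
        next
          case False
          then have "target N \<tau> w s1 t N" using 2 that t1 by auto
          then show ?thesis using G(3)[OF s(3), of N] False \<open>i < N\<close> by auto
        qed
        moreover have "target N \<tau> w s2 u c" if "u < N" "c \<le> N" "u \<noteq> t" "target N \<tau> w s u c" for u c
          using G(3)[OF that(1,2)] 2 that t1 by auto
        ultimately show ?thesis unfolding s1_def[symmetric] e by blast
      qed
    qed
    moreover have "mid N t < Suc N" using mid_less[OF N0, of t] by simp
    ultimately show ?thesis by (auto simp: le_less)
  qed
  let ?J = "\<lambda>j s'. labelled N d \<tau> B mode s' \<and> nv s' 20 = of_bool (even (card (B \<inter> {..<min j N}))) \<and>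
     (\<forall>t<min j N. \<forall>i\<le>N. target N \<tau> w s' t i)"
  have "?J (Suc N) (exec (Suc N) (For 10 ?day) (nset 20 1 s))"
  proof (rule For_inv[where I = ?J], goal_cases)
    case 1 then show ?case using l labelled_nset by simp
  next
    case (2 t s')
    define s1 where "s1 = nset 10 t s'"
    have t1: "target N \<tau> w s1 u c = target N \<tau> w s' u c" for u c by (simp add: s1_def target_def written_def)
    have s1: "labelled N d \<tau> B mode s1" "nv s1 10 = t" "nv s1 20 = of_bool (even (card (B \<inter> {..<min t N})))"
      using 2 labelled_nset by (simp_all add: s1_def)
    have n3: "nv s1 3 = N" "B = {b. na s1 6 b \<noteq> 0}" using s1(1) by (simp_all add: labelled_def base_def)
    show ?case
    proof (cases "t < N")
      case False
      then have "exec (Suc N) ?day s1 = s1" using s1 n3 by (simp del: exec.simps(9))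
      moreover have "min (Suc t) N = min t N" using False by auto
      ultimately show ?thesis using 2 s1 t1 by (simp add: s1_def[symmetric] del: exec.simps)
    next
      case True
      have m: "min (Suc t) N = Suc t" "min t N = t" using True by auto
      define s2 where "s2 = exec (Suc N) ?tog s1"
      have bt: "bt B t = (even (card (B \<inter> {..<t})) \<noteq> (t \<in> B))"
      proof (cases "t \<in> B")
        case True
        then have "B \<inter> {..t} = insert t (B \<inter> {..<t})" by auto
        then show ?thesis using True by (simp add: bt_def)
      next
        case False
        then have "B \<inter> {..t} = B \<inter> {..<t}" by (auto simp: le_less)
        then show ?thesis using False by (simp add: bt_def)
      qed
      have s2: "nv s2 20 = of_bool (bt B t)" "nv s2 10 = t"
        using s1 n3(2) unfolding bt m by (auto simp: s2_def)
      have l2: "labelled N d \<tau> B mode s2" unfolding s2_def using s1(1) by (rule labelled_frame) auto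
      have t2: "target N \<tau> w s2 u c = target N \<tau> w s' u c" for u c
        by (simp add: s2_def s1_def target_def written_def)
      define s3 where "s3 = exec (Suc N) (For 11 ?g) s2"
      have e: "exec (Suc N) ?day s1 = s3" using True s1 n3(1) by (simp add: s3_def s2_def)
      note D = day[OF l2 s2(2) True s2(1), folded s3_def]
      have "labelled N d \<tau> B mode s3" unfolding s3_def using l2 by (rule labelled_frame) (use gm in \<open>auto split: prod.splits\<close>)
      moreover have "nv s3 20 = of_bool (bt B t)"
      proof -
        have "20 \<notin> fst (mods (For 11 ?g))" using gm(1) by (auto split: prod.splits)
        then show ?thesis unfolding s3_def using frame_nv[of 20 "For 11 ?g" "Suc N" s2] s2(1) by metis
      qed
      moreover have "bt B t = even (card (B \<inter> {..<Suc t}))" by (simp add: bt_def lessThan_Suc_atMost)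
      moreover have "\<forall>u<Suc t. \<forall>i\<le>N. target N \<tau> w s3 u i"
        using D 2 t2 True m by (auto simp: less_Suc_eq)
      ultimately show ?thesis unfolding s1_def[symmetric] e m by simp
    qed
  qed
  then show ?thesis by (simp add: p_days_def)
qed

section \<open>From the table to a schedule with the desired ratio\<close>

definition flat_sched :: "nat \<Rightarrow> (nat \<Rightarrow> nat) \<Rightarrow> (nat \<Rightarrow> nat) \<Rightarrow> schedule" where
  "flat_sched n f g = ((\<lambda>t i. f (t * n + i)), (\<lambda>t i. 0 < g (t * n + i)))"

lemma target_relabels:
  assumes N: "odd N" and w2: "\<And>t i. t < N \<Longrightarrow> i < N \<Longrightarrow> w (t + N) i = (\<not> w t i)"
    and t: "\<forall>t<N. \<forall>i\<le>N. target N \<tau> w s t i" and \<tau>: "\<And>i. i \<le> N \<Longrightarrow> \<tau> i = \<sigma> i"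
    and bij: "bij_betw \<sigma> {..<Suc N} {..<Suc N}"
  shows "relabels (Suc N) \<sigma> (copp N, chome N w) (flat_sched (Suc N) (na s 0) (na s 1))"
proof -
  have N0: "0 < N" using N odd_pos by blast
  have cl: "copp N u i \<le> N" if "i \<le> N" for u i using copp_less[OF N that, of u] by simp
  have shift: "copp N (u + N) i = copp N u i" "chome N w (u + N) i = (\<not> chome N w u i)" if "u < N" "i \<le> N" for u i
  proof -
    have "mid N (u + N) = mid N u" by (simp add: mid_def)
    then show "copp N (u + N) i = copp N u i" "chome N w (u + N) i = (\<not> chome N w u i)"
      using w2[OF that(1), of i] w2[OF that(1) mid_less[OF N0]] that(2) by (auto simp: copp_def chome_def cj_shift)
  qed
  have W: "na s 0 (u * Suc N + \<sigma> i) = \<sigma> (copp N u i)" "na s 1 (u * Suc N + \<sigma> i) = of_bool (chome N w u i)"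
    "na s 0 ((u + N) * Suc N + \<sigma> i) = \<sigma> (copp N u i)" "na s 1 ((u + N) * Suc N + \<sigma> i) = 1 - of_bool (chome N w u i)"
    if "u < N" "i \<le> N" for u i
  proof -
    have "target N \<tau> w s u i" using t that by blast
    then show "na s 0 (u * Suc N + \<sigma> i) = \<sigma> (copp N u i)" "na s 1 (u * Suc N + \<sigma> i) = of_bool (chome N w u i)"
      "na s 0 ((u + N) * Suc N + \<sigma> i) = \<sigma> (copp N u i)" "na s 1 ((u + N) * Suc N + \<sigma> i) = 1 - of_bool (chome N w u i)"
      unfolding target_def written_def \<tau>[OF that(2)] \<tau>[OF cl[OF that(2), of u]] by blast+
  qed
  have "na s 0 (u * Suc N + \<sigma> i) = \<sigma> (copp N u i) \<and> (0 < na s 1 (u * Suc N + \<sigma> i)) = chome N w u i"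
    if u: "u < 2 * N" "i \<le> N" for u i
  proof (cases "u < N")
    case True then show ?thesis using W[OF True u(2)] by simp
  next
    case False
    define v where "v = u - N"
    have v: "v < N" "u = v + N" using False u(1) by (auto simp: v_def)
    show ?thesis unfolding v(2) using W(3,4)[OF v(1) u(2)] shift[OF v(1) u(2)] by simp
  qed
  then show ?thesis
    using bij unfolding relabels_def flat_sched_def by (simp add: num_days_def less_Suc_eq_le del: mult_Suc mult_Suc_right)
qed

text \<open>Competing schedules take the place of \<open>ttp_OPT\<close>, so that the infimum is
  confined to the very last step.\<close>

definition good :: "nat \<Rightarrow> nat \<Rightarrow> (nat \<Rightarrow> nat \<Rightarrow> real) \<Rightarrow> schedule \<Rightarrow> bool" where
  "good n k d s \<longleftrightarrow> ttp_feasible n k s \<and> (\<forall>x. ttp_feasible n k x \<longrightarrow>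
     ttp_cost n d s \<le> 5 * ttp_cost n d x \<and> (n \<le> 2 * k \<longrightarrow> ttp_cost n d s \<le> 4 * ttp_cost n d x))"

lemma good_trivial:
  assumes m: "ttp_metric n d" and f: "ttp_feasible n k s" and n: "even n" "2 \<le> n" and small: "n \<le> 8 \<or> k \<le> 4"
  shows "good n k d s"
proof -
  interpret ttp_met n d by unfold_locales (rule m)
  define T where "T = (\<Sum>i<n. \<Sum>j<n. d i j)"
  have "ttp_cost n d s \<le> 4 * ttp_cost n d x \<and> 0 \<le> ttp_cost n d x" if x: "ttp_feasible n k x" for x
  proof -
    have X: "0 \<le> ttp_cost n d x" by (rule cost_nonneg[OF x n(2)])
    have c: "ttp_cost n d s \<le> 2 * T" unfolding T_def by (rule cost_le_twice_total[OF f m n(2)])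
    have 1: "2 * T \<le> real k * ttp_cost n d x" unfolding T_def by (rule twice_total_le[OF x n(2)])
    have 2: "4 * T \<le> real n * ttp_cost n d x" unfolding T_def by (rule four_total_le[OF x n(2,1)])
    have "2 * T \<le> 4 * ttp_cost n d x"
      using small
    proof
      assume "n \<le> 8"
      then have "real n * ttp_cost n d x \<le> 8 * ttp_cost n d x" using X by (intro mult_right_mono) auto
      then show ?thesis using 2 by linarith
    next
      assume "k \<le> 4"
      then have "real k * ttp_cost n d x \<le> 4 * ttp_cost n d x" using X by (intro mult_right_mono) auto
      then show ?thesis using 1 by linarith
    qed
    then show ?thesis using c X by linarith
  qed
  then show ?thesis using f unfolding good_def by fastforce
qed

lemma good_relabels_id:
  assumes "good n k d s" "relabels n id s s'" "2 \<le> n"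
  shows "good n k d s'"
  using assms relabel_feasible[OF assms(2)] relabel_cost[OF assms(2) _ assms(3), of k d] by (simp add: good_def)

lemma exec_table: "na (exec n (table a vs) s) = (na s)(a := \<lambda>i. if i < length vs then vs ! i else na s a i)"
proof -
  have "na (exec n (foldr (\<lambda>(i, v) c. NStore a (NC i) (NC v) ;; c) (zip [j..<j + length vs] vs) Skip) s)
     = (na s)(a := \<lambda>i. if j \<le> i \<and> i < j + length vs then vs ! (i - j) else na s a i)" for j
  proof (induction vs arbitrary: j s)
    case (Cons v vs)
    have "[j..<j + length (v # vs)] = j # [Suc j..<Suc j + length vs]"
      by (subst upt_conv_Cons) (simp_all del: upt_Suc)
    then show ?case using Cons[of "Suc j"] by (auto simp: fun_eq_iff nth_Cons' Suc_diff_le le_Suc_eq not_less_eq_eq)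
  qed (auto simp: fun_eq_iff)
  from this[of 0] show ?thesis by (simp add: table_def cong: if_cong)
qed

lemma four_relabels: "relabels 4 id sched4 (flat_sched 4 (na (exec n p_four s) 0) (na (exec n p_four s) 1))"
proof -
  have "list_all (\<lambda>t. list_all (\<lambda>i. concat opp4 ! (t * 4 + i) = opp4 ! t ! i \<and> concat home4 ! (t * 4 + i) = home4 ! t ! i)
    [0..<4]) [0..<6]" by code_simp
  then have c: "\<forall>t<6. \<forall>i<4. concat opp4 ! (t * 4 + i) = opp4 ! t ! i \<and> concat home4 ! (t * 4 + i) = home4 ! t ! i"
    by (simp only: all_less_upt)
  have l: "length (concat opp4) = 24" "length (concat home4) = 24" by (simp_all add: opp4_def home4_def)
  have "na (exec n p_four s) 0 (t * 4 + i) = concat opp4 ! (t * 4 + i)"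
    "na (exec n p_four s) 1 (t * 4 + i) = concat home4 ! (t * 4 + i)" if "t < 6" "i < 4" for t i
    using that by (auto simp: p_four_def exec_table l)
  then show ?thesis using c by (simp add: relabels_def flat_sched_def sched4_def num_days_def)
qed

lemma stash_spec:
  assumes "nv s 2 = T" "n \<le> T"
  defines "s' \<equiv> exec n p_stash s"
  shows "nv s' 2 = T" "\<forall>i<T. na s' 0 i = na s 0 i \<and> na s' 1 i = na s 1 i"
    "\<forall>i<n. na s' 0 (T + i) = na s' 0 i \<and> na s' 1 (T + i) = na s' 1 i"
proof -
  let ?I = "\<lambda>j t. nv t 2 = T \<and> (\<forall>i<T. na t 0 i = na s 0 i \<and> na t 1 i = na s 1 i) \<and>
    (\<forall>i<j. na t 0 (T + i) = na s 0 i \<and> na t 1 (T + i) = na s 1 i)"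
  have "?I n s'"
    unfolding s'_def p_stash_def
    by (rule For_inv[where I = ?I]) (use assms(1,2) in \<open>auto simp: less_Suc_eq\<close>)
  then show "nv s' 2 = T" "\<forall>i<T. na s' 0 i = na s 0 i \<and> na s' 1 i = na s 1 i"
    "\<forall>i<n. na s' 0 (T + i) = na s' 0 i \<and> na s' 1 (T + i) = na s' 1 i"
    using assms(2) by auto
qed

lemma alt_shift: "odd N \<Longrightarrow> t < N \<Longrightarrow> i < N \<Longrightarrow> alt_orient N (t + N) i = (\<not> alt_orient N t i)"
proof -
  assume a: "odd N" "t < N" "i < N"
  have "ee N (t + N) i mod N = ee N t i mod N"
    using ee_less[of N t i] a by (auto simp: ee_shift[OF a(3,2)] le_mod_geq)
  then show ?thesis using a(1) by (simp add: alt_orient_def)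
qed

lemma trivial_spec:
  assumes b: "base N d s" and N: "odd N" "5 \<le> N" and k: "2 \<le> k"
  defines "s' \<equiv> exec (Suc N) (p_trivial ;; p_days) s"
  shows "ttp_feasible (Suc N) k (flat_sched (Suc N) (na s' 0) (na s' 1))"
proof -
  define s1 where "s1 = exec (Suc N) p_trivial s"
  let ?l = "For 11 (NStore 7 (NV 11) (NV 11) ;; NStore 6 (NV 11) (NC 1))"
  have "\<forall>i<Suc N. na (exec (Suc N) ?l s) 7 i = i \<and> na (exec (Suc N) ?l s) 6 i = 1"
    by (rule For_inv[where I = "\<lambda>j t. \<forall>i<j. na t 7 i = i \<and> na t 6 i = 1"]) (auto simp: less_Suc_eq)
  then have t: "na s1 7 i = i" "na s1 6 i = 1" if "i \<le> N" for i
    using that by (simp_all add: s1_def p_trivial_def)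
  have m: "nv s1 6 = 1" by (simp add: s1_def p_trivial_def)
  define B where "B = {b. na s1 6 b \<noteq> 0}"
  have b1: "base N d s1" unfolding s1_def using b by (rule base_frame) (auto simp: p_trivial_def)
  have l1: "labelled N d (na s1 7) B 1 s1" using b1 m by (simp add: labelled_def B_def)
  have bt: "bt B u = odd u" if "u < N" for u
  proof -
    have "B \<inter> {..u} = {..u}" using t(2) that by (auto simp: B_def)
    then show ?thesis by (simp add: bt_def)
  qed
  have inj: "inj_on (na s1 7) {..N}" using t(1) by (auto simp: inj_on_def)
  have le: "\<forall>i\<le>N. na s1 7 i \<le> N" using t(1) by simp
  have s': "s' = exec (Suc N) p_days s1" by (simp add: s'_def s1_def)
  have T: "\<forall>u<N. \<forall>i\<le>N. target N (na s1 7) (alt_orient N) s' u i"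
    unfolding s' by (rule days_spec[OF l1 N(1) inj le]) (simp add: alt_orient_def side_def bt)
  have "relabels (Suc N) id (copp N, chome N (alt_orient N)) (flat_sched (Suc N) (na s' 0) (na s' 1))"
    by (rule target_relabels[where \<tau> = "na s1 7"]) (use N(1) alt_shift T t(1) bij_betw_id in auto)
  then show ?thesis by (rule relabel_feasible) (rule alt_feasible[OF N k])
qed

lemma main_good:
  assumes met: "ttp_metric (Suc N) d" and b: "base N d s" and z: "na s 5 = (\<lambda>i. 0)" "na s 6 = (\<lambda>i. 0)" "nv s 6 = 0"
    and k: "nv s 1 = k" "5 \<le> k" and N: "odd N" "9 \<le> N"
  defines "s' \<equiv> exec (Suc N) (p_main ;; p_days) s"
  shows "good (Suc N) k d (flat_sched (Suc N) (na s' 0) (na s' 1))"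
proof -
  interpret ttp_met "Suc N" d by unfold_locales (rule met)
  define s1 where "s1 = exec (Suc N) p_special s"
  define s2 where "s2 = exec (Suc N) p_tour s1"
  define s3 where "s3 = exec (Suc N) p_blocks s2"
  define s4 where "s4 = exec (Suc N) p_rotation s3"
  define s5 where "s5 = exec (Suc N) p_labels s4"
  have s': "s' = exec (Suc N) p_days s5"
    unfolding s'_def p_main_def s1_def s2_def s3_def s4_def s5_def by (simp only: exec.simps(9))
  define v where "v = nv s1 4"
  note sp = special_spec[OF b, folded s1_def]
  have b1: "base N d s1" unfolding s1_def using b by (rule base_frame) (auto simp: p_special_def)
  have z1: "na s1 5 = (\<lambda>i. 0)" "na s1 6 = (\<lambda>i. 0)" "nv s1 6 = 0" "nv s1 1 = k"
    using frame_na[of 5 p_special "Suc N" s] frame_na[of 6 p_special "Suc N" s] frame_nv[of 6 p_special "Suc N" s]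
      frame_nv[of 1 p_special "Suc N" s] z k by (simp_all add: s1_def p_special_def)
  have t2: "touring N d v N s2"
    unfolding s2_def v_def by (rule tour_spec[OF met b1 sp(1) _ z1(1)]) (use N in simp)
  define xs where "xs = map (na s2 3) [0..<N]"
  have b2: "base N d s2" and v2: "nv s2 4 = v" and inv: "tour_inv ({..<Suc N} - {v}) xs"
    using t2 unfolding touring_def xs_def by auto
  have mt: "6 \<notin> fst (mods p_tour)" "1 \<notin> fst (mods p_tour)" "6 \<notin> fst (snd (mods p_tour))"
    by (simp_all add: p_tour_def p_search_def p_insert_def)
  have z2: "na s2 6 = (\<lambda>i. 0)" "nv s2 6 = 0" "nv s2 1 = k"
    using frame_na[OF mt(3), of "Suc N" s1] frame_nv[OF mt(1), of "Suc N" s1] frame_nv[OF mt(2), of "Suc N" s1] z1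
    by (simp_all only: s2_def)
  define B where "B = {b. na s3 6 b \<noteq> 0}"
  note bl = blocks_spec[OF b2 z2(1,3) k(2) N, folded s3_def, folded B_def]
  have b3: "base N d s3" unfolding s3_def using b2 by (rule base_frame) (auto simp: p_blocks_def)
  have f3: "na s3 3 = na s2 3" "nv s3 4 = v" "nv s3 6 = 0"
    using frame_na[of 3 p_blocks "Suc N" s2] frame_nv[of 4 p_blocks "Suc N" s2] frame_nv[of 6 p_blocks "Suc N" s2] z2 v2
    by (simp_all add: s3_def p_blocks_def)
  have Bsub: "B \<subseteq> {..<N}" using bl(1) by (simp add: blocks_def)
  have xs3: "xs = map (na s3 3) [0..<N]" by (simp add: xs_def f3)
  have setxs: "set xs \<subseteq> {..<Suc N} - {v}" using inv by (simp add: tour_inv_def)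
  have c3: "\<forall>p<N. na s3 3 p \<le> N"
  proof (intro allI impI)
    fix p assume "p < N"
    then have "na s3 3 p \<in> set xs" by (auto simp: xs3)
    then show "na s3 3 p \<le> N" using setxs by auto
  qed
  have N1: "1 \<le> N" using N by simp
  define r where "r = nv s4 5"
  note ro = rotation_spec[OF b3 N1 c3 xs3 B_def Bsub, folded s4_def, folded r_def]
  have b4: "base N d s4" unfolding s4_def using b3 by (rule base_frame) (auto simp: p_rotation_def)
  have f4: "na s4 3 = na s3 3" "nv s4 4 = v" "nv s4 6 = 0" "na s4 6 = na s3 6"
    using frame_na[of 3 p_rotation "Suc N" s3] frame_nv[of 4 p_rotation "Suc N" s3] frame_nv[of 6 p_rotation "Suc N" s3]
      frame_na[of 6 p_rotation "Suc N" s3] f3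
    by (simp_all add: s4_def p_rotation_def)
  have la: "na s5 7 i = label N xs v r i" if "i \<le> N" for i
    using labels_spec[OF b4 N1, of xs] ro(1) that f4 by (simp add: s5_def r_def xs3)
  have b5: "base N d s5" unfolding s5_def using b4 by (rule base_frame) (auto simp: p_labels_def)
  have f5: "nv s5 6 = 0" "na s5 6 = na s3 6"
    using frame_nv[of 6 p_labels "Suc N" s4] frame_na[of 6 p_labels "Suc N" s4] f4 by (simp_all add: s5_def p_labels_def)
  have l5: "labelled N d (na s5 7) B 0 s5" using b5 f5 by (simp add: labelled_def B_def)
  have vN: "v < Suc N" using sp(1) by (simp add: v_def)
  have len: "length xs = N" by (simp add: xs_def)
  have dist: "distinct xs" using inv by (simp add: tour_inv_def)
  have st: "set xs = {..<Suc N} - {v}"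
    using setxs distinct_card[OF dist] len vN by (intro card_subset_eq) auto
  have bij: "bij_betw (label N xs v r) {..<Suc N} {..<Suc N}"
    by (rule label_bij[OF len dist st vN]) (use N in simp)
  have inj: "inj_on (na s5 7) {..N}"
  proof (rule inj_onI)
    fix i j assume a: "i \<in> {..N}" "j \<in> {..N}" "na s5 7 i = na s5 7 j"
    then have "label N xs v r i = label N xs v r j" using la by auto
    then show "i = j" using bij a(1,2) by (auto simp: bij_betw_def dest!: inj_onD)
  qed
  have le: "\<forall>i\<le>N. na s5 7 i \<le> N"
  proof (intro allI impI)
    fix i assume "i \<le> N"
    then show "na s5 7 i \<le> N" using bij_betwE[OF bij, rule_format, of i] la[of i] by simp
  qed
  interpret blocks N k B by (rule bl(1))
  have T: "\<forall>u<N. \<forall>i\<le>N. target N (na s5 7) (blk_orient N B) s' u i"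
    unfolding s' by (rule days_spec[OF l5 N(1) inj le]) (auto simp: blk_orient_def side_def)
  have R: "relabels (Suc N) (label N xs v r) (copp N, chome N (blk_orient N B)) (flat_sched (Suc N) (na s' 0) (na s' 1))"
    by (rule target_relabels[where \<tau> = "na s5 7"]) (use N(1) orient_shift T la bij in auto)
  have vmin: "\<forall>u<Suc N. (\<Sum>j<Suc N. d v j) \<le> (\<Sum>j<Suc N. d u j)"
    using sp(2) by (simp add: v_def less_Suc_eq_le del: sum.lessThan_Suc)
  note ratio = block_schedule_ratio[OF bl(1) met inv len vN vmin ro R bl(2-4)]
  show ?thesis
    unfolding good_def
  proof (intro conjI allI impI)
    show "ttp_feasible (Suc N) k (flat_sched (Suc N) (na s' 0) (na s' 1))"
      by (rule relabel_feasible[OF R blocks_feasible])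
    fix x assume x: "ttp_feasible (Suc N) k x"
    show "Suc N \<le> 2 * k \<Longrightarrow> ttp_cost (Suc N) d (flat_sched (Suc N) (na s' 0) (na s' 1)) \<le> 4 * ttp_cost (Suc N) d x"
      using ratio(2)[OF x] .
    have "0 \<le> ttp_cost (Suc N) d x" using cost_nonneg[OF x] N by simp
    then show "ttp_cost (Suc N) d (flat_sched (Suc N) (na s' 0) (na s' 1)) \<le> 5 * ttp_cost (Suc N) d x"
      using ratio(2)[OF x] ratio(3)[OF x] by (cases "Suc N \<le> 2 * k") auto
  qed
qed

lemma program_spec:
  assumes met: "ttp_metric (Suc N) d" and N: "odd N" "3 \<le> N" and k: "2 \<le> k"
    and D: "\<And>i. 10 \<le> i \<Longrightarrow> i < Suc N * Suc N \<Longrightarrow> D i = d (i div Suc N) (i mod Suc N)"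
  defines "s' \<equiv> exec (Suc N) p_all (init_st (Suc N) k D)"
  shows "nv s' 2 = 2 * N * Suc N"
    "\<forall>i<Suc N. na s' 0 (nv s' 2 + i) = na s' 0 i \<and> na s' 1 (nv s' 2 + i) = na s' 1 i"
    "good (Suc N) k d (flat_sched (Suc N) (na s' 0) (na s' 1))"
proof -
  let ?n = "Suc N"
  define s0 where "s0 = init_st ?n k D"
  define s1 where "s1 = exec ?n p_rows s0"
  define s2 where "s2 = exec ?n p_residues s1"
  define s3 where "s3 = exec ?n p_first_row s2"
  have i0: "nv s0 0 = ?n" "nv s0 1 = k" "nv s0 6 = 0" "na s0 5 = (\<lambda>i. 0)" "na s0 6 = (\<lambda>i. 0)" "ra s0 = D"
    by (simp_all add: s0_def init_st_def)
  note rows = rows_spec[OF i0(1), folded s1_def]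
  have keep: "nv s3 x = nv s1 x" if "x \<noteq> 11" for x
    using frame_nv[of x "p_residues ;; p_first_row" ?n s1] that
    by (simp add: s3_def s2_def p_residues_def p_first_row_def)
  have keep1: "nv s1 x = nv s0 x" if "x \<notin> {2, 3, 10, 11}" for x
    using frame_nv[of x p_rows ?n s0] that by (simp add: s1_def p_rows_def)
  have keepa: "na s3 a = na s1 a" if "a \<noteq> 8" for a
    using frame_na[of a "p_residues ;; p_first_row" ?n s1] that
    by (simp add: s3_def s2_def p_residues_def p_first_row_def)
  have keepa1: "na s1 a = na s0 a" if "a \<noteq> 2" for a
    using frame_na[of a p_rows ?n s0] that by (simp add: s1_def p_rows_def)
  have s2: "na s2 2 = na s1 2" "ra s2 = D" "na s3 8 = na s2 8"
    using frame_na[of 2 p_residues ?n s1] frame_ra[of "p_rows ;; p_residues" ?n s0] frame_na[of 8 p_first_row ?n s2] i0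
    by (simp_all add: s3_def s2_def s1_def p_rows_def p_residues_def p_first_row_def)
  have i3: "nv s3 0 = ?n" "nv s3 1 = k" "nv s3 6 = 0" "na s3 5 = (\<lambda>i. 0)" "na s3 6 = (\<lambda>i. 0)"
    "nv s3 2 = 2 * N * ?n" "nv s3 3 = N"
    using keep keep1 keepa keepa1 i0 rows by simp_all
  have b3: "base N d' s3" if "\<forall>i\<le>N. \<forall>j\<le>N. ra s3 (i * ?n + j) = d' i j" for d'
    using that i3 rows(3) keepa[of 2] residues_spec[OF rows(1)] s2 by (simp add: base_def s2_def)
  let ?c = "IfLe (NV 0) (NC 8) p_trivial (IfLe (NV 1) (NC 4) p_trivial p_main)"
  define s4 where "s4 = exec ?n (IfLe (NV 0) (NC 4) p_four (?c ;; p_days)) s3"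
  have s': "s' = exec ?n p_stash s4"
    unfolding s'_def p_all_def s4_def s3_def s2_def s1_def s0_def by (simp only: exec.simps(9))
  have n2: "2 \<le> ?n" "even ?n" using N by auto
  have g4: "good ?n k d (flat_sched ?n (na s4 0) (na s4 1))"
  proof (cases "?n \<le> 4")
    case True
    then have n4: "?n = 4" using N by simp
    have "s4 = exec ?n p_four s3" using i3 True by (simp add: s4_def)
    then have "relabels 4 id sched4 (flat_sched ?n (na s4 0) (na s4 1))" using four_relabels[of ?n s3] n4 by simp
    from relabel_feasible[OF this] ttp_feasible_mono[OF sched4_feasible k]
    have "ttp_feasible ?n k (flat_sched ?n (na s4 0) (na s4 1))" using n4 by simp
    then show ?thesis using good_trivial[OF met _ n2(2,1)] n4 by simp
  next
    case False
    then have N5: "5 \<le> N" using N by (auto elim!: oddE)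
    have s4: "s4 = exec ?n (?c ;; p_days) s3" using i3 False by (simp add: s4_def)
    show ?thesis
    proof (cases "?n \<le> 8 \<or> k \<le> 4")
      case True
      then have "s4 = exec ?n (p_trivial ;; p_days) s3"
        unfolding s4 exec.simps(9) using i3 by (auto simp: exec.simps(10))
      \<comment> \<open>For few teams the real array need not hold the distances, so
        \<open>base\<close> is used with whatever the array contains; feasibility does not refer to
        it.\<close>
      then have "ttp_feasible ?n k (flat_sched ?n (na s4 0) (na s4 1))"
        using trivial_spec[OF b3[of "\<lambda>i j. ra s3 (i * ?n + j)"] N(1) N5 k] by (simp only: simp_thms)
      then show ?thesis using good_trivial[OF met _ n2(2,1) True] by simp
    next
      case False
      \<comment> \<open>An even number of teams above 8 is at least 10, just enough for
        \<open>first_row_spec\<close>.\<close>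
      then have N9: "9 \<le> N" "5 \<le> k" using N by (auto elim!: oddE)
      have e: "s4 = exec ?n (p_main ;; p_days) s3"
        unfolding s4 exec.simps(9) using i3 False by (auto simp: exec.simps(10))
      have "\<forall>i\<le>N. \<forall>j\<le>N. ra s3 (i * ?n + j) = d i j"
        unfolding s3_def by (rule first_row_spec[OF _ N9(1) met]) (use rows(3) s2 D in simp_all)
      from main_good[OF met b3[OF this] i3(4,5,3,2) N9(2) N(1) N9(1)] show ?thesis unfolding e .
    qed
  qed
  have m4: "2 \<notin> fst (mods (IfLe (NV 0) (NC 4) p_four (?c ;; p_days)))"
  proof -
    have "mods (foldr (\<lambda>(i, v) c. NStore a (NC i) (NC v) ;; c) ps Skip) = ({}, if ps = [] then {} else {a}, {}, False)" for a ps
      by (induction ps) auto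
    then have "fst (mods p_four) = {}" by (simp add: p_four_def table_def)
    moreover have "2 \<notin> fst (mods (?c ;; p_days))"
      by (simp add: p_trivial_def p_main_def p_special_def p_tour_def p_search_def p_insert_def p_blocks_def p_rotation_def
          p_labels_def p_days_def p_game_def p_side_def mods_entry)
    ultimately show ?thesis by (auto split: prod.splits)
  qed
  have T4: "nv s4 2 = 2 * N * ?n" using frame_nv[OF m4, of ?n s3] i3(6) by (simp only: s4_def)
  have nT: "?n \<le> 2 * N * ?n" using N by simp
  note st = stash_spec[OF T4 nT, folded s']
  show "nv s' 2 = 2 * N * ?n" by (rule st(1))
  show "\<forall>i<?n. na s' 0 (nv s' 2 + i) = na s' 0 i \<and> na s' 1 (nv s' 2 + i) = na s' 1 i" using st(1,3) by simp
  have "relabels ?n id (flat_sched ?n (na s4 0) (na s4 1)) (flat_sched ?n (na s' 0) (na s' 1))"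
    unfolding relabels_def flat_sched_def fst_conv snd_conv id_apply
  proof (intro conjI allI impI)
    fix t i assume t: "t < num_days ?n" "i < ?n"
    have "t * ?n + i < Suc t * ?n" using t(2) by simp
    also have "\<dots> \<le> 2 * N * ?n" using t(1) by (intro mult_right_mono) (auto simp: num_days_def)
    finally show "na s' 0 (t * ?n + i) = na s4 0 (t * ?n + i)" "(0 < na s' 1 (t * ?n + i)) = (0 < na s4 1 (t * ?n + i))"
      using st(2) by simp_all
  qed (simp add: bij_betw_def)
  then show "good ?n k d (flat_sched ?n (na s' 0) (na s' 1))" by (rule good_relabels_id[OF g4 _ n2(1)])
qed

theorem mainTheorem1:
  shows "\<exists>(P :: instr list) (c :: nat).
     \<forall>n k d. even n \<and> 4 \<le> n \<and> 2 \<le> k \<and> k \<le> n - 1 \<and> ttp_metric n d \<longrightarrow>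
       (let cfg = (step P ^^ (c * (n + 1) ^ c)) (0, ttp_input n k d);
            s = ttp_output n (snd cfg) in
          halted P cfg \<and> ttp_feasible n k s \<and>
          ttp_cost n d s \<le> 5 * ttp_OPT n k d \<and>
          (n \<le> 2 * k \<longrightarrow> ttp_cost n d s \<le> 4 * ttp_OPT n k d))"
proof -
  \<comment> \<open>161 = 58 + 4 + 99 collects the coefficients of the time bound in
    \<open>program_correct\<close>. As an exponent, \<open>c\<close> has to be at least 2 and at
    least the loop depth, which is at most 8.\<close>
  define c where "c = tcost p_all + 161"
  show ?thesis
  proof (rule exI[of _ "program p_all"], rule exI[of _ c], intro allI impI)
    fix n k d assume a: "even n \<and> 4 \<le> n \<and> 2 \<le> k \<and> k \<le> n - 1 \<and> ttp_metric n d"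
    define N where "N = n - 1"
    have n: "n = Suc N" and N: "odd N" "3 \<le> N" using a by (auto simp: N_def)
    have met: "ttp_metric (Suc N) d" and k: "2 \<le> k" using a n by auto
    let ?t = "c * (n + 1) ^ c"
    have time: "tcost p_all * (n + 1) ^ loop_depth p_all + 58 * (n * n) + 4 * n + 99 \<le> ?t"
    proof -
      have "(n + 1) ^ loop_depth p_all \<le> (n + 1) ^ c" using p_all_wf(2) by (intro power_increasing) (auto simp: c_def)
      then have 1: "tcost p_all * (n + 1) ^ loop_depth p_all \<le> tcost p_all * (n + 1) ^ c" by simp
      have "58 * (n * n) + 4 * n + 99 \<le> 161 * (n + 1) ^ 2" by (simp add: power2_eq_square)
      also have "\<dots> \<le> 161 * (n + 1) ^ c" by (intro mult_left_mono power_increasing) (auto simp: c_def)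
      finally show ?thesis using 1 unfolding c_def add_mult_distrib by linarith
    qed
    let ?Q = "\<lambda>T f g. T = 2 * N * n \<and> good n k d (flat_sched n f g)"
    have "\<exists>T f g. let cfg = (step (program p_all) ^^ ?t) (0, ttp_input n k d) in
       halted (program p_all) cfg \<and> ?Q T f g \<and>
       (\<forall>i<T. snd cfg (2 * i) = real (f i) \<and> snd cfg (2 * i + 1) = real (g i))"
    proof (rule program_correct[OF p_all_wf _ time])
      fix D assume D: "\<And>i. 10 \<le> i \<Longrightarrow> i < n * n \<Longrightarrow> D i = d (i div n) (i mod n)"
      note sp = program_spec[OF met N k, of D, folded n, OF D]
      have "4 \<le> 2 * N * n" "2 * N * n \<le> 2 * n * n" using N n by auto
      then show "let s = exec n p_all (init_st n k D) in 4 \<le> nv s 2 \<and> nv s 2 \<le> 2 * n * n \<and>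
         (\<forall>i<4. na s 0 (nv s 2 + i) = na s 0 i \<and> na s 1 (nv s 2 + i) = na s 1 i) \<and>
         ?Q (nv s 2) (na s 0) (na s 1)"
        using sp a by (simp add: Let_def)
    qed
    then obtain f g where
      h: "halted (program p_all) ((step (program p_all) ^^ ?t) (0, ttp_input n k d))"
      and g: "good n k d (flat_sched n f g)"
      and o: "\<forall>i<2 * N * n. snd ((step (program p_all) ^^ ?t) (0, ttp_input n k d)) (2 * i) = real (f i) \<and>
         snd ((step (program p_all) ^^ ?t) (0, ttp_input n k d)) (2 * i + 1) = real (g i)"
      unfolding Let_def by blast
    define s where "s = ttp_output n (snd ((step (program p_all) ^^ ?t) (0, ttp_input n k d)))"
    have "relabels n id (flat_sched n f g) s"
      unfolding relabels_def
    proof (intro conjI allI impI)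
      fix t i assume t: "t < num_days n" "i < n"
      have "t * n + i < Suc t * n" using t(2) by simp
      also have "\<dots> \<le> 2 * N * n" using t(1) n by (intro mult_right_mono) (auto simp: num_days_def)
      finally have "snd ((step (program p_all) ^^ ?t) (0, ttp_input n k d)) (2 * (t * n + i)) = real (f (t * n + i)) \<and>
         snd ((step (program p_all) ^^ ?t) (0, ttp_input n k d)) (2 * (t * n + i) + 1) = real (g (t * n + i))"
        using o by blast
      then show "fst s t (id i) = id (fst (flat_sched n f g) t i)" "snd s t (id i) = snd (flat_sched n f g) t i"
        by (simp_all add: s_def ttp_output_def flat_sched_def)
    qed (rule bij_betw_id)
    then have gs: "good n k d s" using good_relabels_id[OF g] a by auto
    then have f: "ttp_feasible n k s" by (simp add: good_def)
    have "ttp_cost n d s \<le> 5 * ttp_OPT n k d" using gs by (intro le_OPT[OF f]) (auto simp: good_def)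
    moreover have "ttp_cost n d s \<le> 4 * ttp_OPT n k d" if "n \<le> 2 * k"
      using gs that by (intro le_OPT[OF f]) (auto simp: good_def)
    ultimately show "let cfg = (step (program p_all) ^^ ?t) (0, ttp_input n k d); s = ttp_output n (snd cfg) in
          halted (program p_all) cfg \<and> ttp_feasible n k s \<and> ttp_cost n d s \<le> 5 * ttp_OPT n k d \<and>
          (n \<le> 2 * k \<longrightarrow> ttp_cost n d s \<le> 4 * ttp_OPT n k d)"
      unfolding Let_def s_def[symmetric] using h f by blast
  qed
qed

end
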